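(* Let $d\ge2$ be an integer, $\lambda>1$, $\frac12<\alpha<1$, $p=\lambda\frac{(d-2)!}{N^{d-1}}$, and let $(S_t)$ be the martingale and $(\beta_t)$ the weights associated with the exploration process of $\mathcal G^d(N,p)$ started from $k_N=\lfloor N^{\kappa}\rfloor$ active vertices, where $2\alpha-1<\kappa<\alpha$ (see context). For $\zeta\in(-\infty,\infty)$ put $\gamma(N)=\lfloor\overline{\rho_\lambda}\,N+\zeta N^{\alpha}\rfloor$. Then, for any choice of $\zeta$, the sequence of random variables $$\frac{\beta_{\gamma(N)}\,S_{\gamma(N)}}{N^{\alpha}}$$ satisfies a moderate deviation principle with speed $N^{2\alpha-1}$ and rate function $I(x)=\frac{x^2}{2c}$, where $$c=c_{d,\lambda}=\lambda(1-\overline{\rho_\lambda})^2-\lambda_*(1-\overline{\rho_\lambda})+\overline{\rho_\lambda}(1-\overline{\rho_\lambda}).$$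
   Context: $\mathcal G^d(N,p)$ is the random $d$-uniform hypergraph on $\{1,\dots,N\}$ in which each $d$-element subset is a hyperedge independently with probability $p$ ($N$ large enough that $p\le1$). $\overline{\rho_\lambda}=\rho_{d,\lambda}$ is the unique solution in $(0,1)$ of $1-\overline{\rho_\lambda}=\exp\left(-\frac{\lambda}{d-1}\left(1-(1-\overline{\rho_\lambda})^{d-1}\right)\right)$, and $\lambda_*=\lambda(1-\overline{\rho_\lambda})^{d-1}$. Exploration process: each vertex is active, unseen or explored. At time $0$ vertices $1,\dots,k_N$ are active and all others unseen. In step $t=1,2,\dots,N$ the first active vertex $v_t$ (in the order of the labels; if there is no active vertex, the first unseen vertex) is selected and declared explored, and all unseen vertices other than $v_t$ that lie in a common hyperedge with $v_t$ containing no previously explored vertex become active; $\eta_t$ denotes the number of these newly activated vertices. Let $\mathcal F_t$ be the $\sigma$-algebra generated by $\eta_1,\dots,\eta_t$ and $$\Delta_t=\eta_t-\mathbb E[\eta_t\mid\mathcal F_{t-1}],\qquad a_t=p\binom{N-t-1}{d-2},\qquad \beta_t=\prod_{i=1}^t(1-a_i),\qquad S_t=\sum_{i=1}^t\frac{1}{\beta_i}\Delta_i .$$ ($N$ is taken large enough that $\gamma(N)\in\{1,\dots,N-1\}$ and all $\beta_i$ involved are positive.) A sequence of real random variables $(Y_N)$ satisfies a moderate deviation principle with speed $s_N$ and rate function $I:\mathbb R\to[0,\infty]$ if the level sets $\{I\le L\}$, $L\ge0$, are compact, $\liminf_N\frac1{s_N}\log\mathbb P(Y_N\in G)\ge-\inf_GI$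 for every open $G\subseteq\mathbb R$, and $\limsup_N\frac1{s_N}\log\mathbb P(Y_N\in A)\le-\inf_AI$ for every closed $A\subseteq\mathbb R$. *)

theory Defs
  imports "HOL-Probability.Probability"
begin

text \<open>The random variables \<open>Y N\<close> may live on different
  probability spaces \<open>P N\<close>.\<close>

definition log_prob :: "real \<Rightarrow> ereal" where
  "log_prob q = (if q = 0 then -\<infinity> else ereal (ln q))"

definition moderate_deviation_principle ::
  "(nat \<Rightarrow> 'a measure) \<Rightarrow> (nat \<Rightarrow> 'a \<Rightarrow> real) \<Rightarrow> (nat \<Rightarrow> real) \<Rightarrow> (real \<Rightarrow> ereal) \<Rightarrow> bool"
where
  "moderate_deviation_principle P Y s I \<longleftrightarrow>
     (\<forall>N. prob_space (P N) \<and> Y N \<in> borel_measurable (P N)) \<and>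
     (\<forall>x. 0 \<le> I x) \<and>
     (\<forall>L::real. 0 \<le> L \<longrightarrow> compact {x. I x \<le> ereal L}) \<and>
     (\<forall>G. open G \<longrightarrow>
        - (INF x\<in>G. I x) \<le>
        liminf (\<lambda>N. ereal (1 / s N) * log_prob (measure (P N) {\<omega> \<in> space (P N). Y N \<omega> \<in> G}))) \<and>
     (\<forall>A. closed A \<longrightarrow>
        limsup (\<lambda>N. ereal (1 / s N) * log_prob (measure (P N) {\<omega> \<in> space (P N). Y N \<omega> \<in> A}))
        \<le> - (INF x\<in>A. I x))"


text \<open>The random hypergraph, represented by its set of hyperedges. For \<open>p\<close> outside \<open>[0,1]\<close>
  the library's \<^const>\<open>bernoulli_pmf\<close> truncates \<open>p\<close> to that interval.\<close>

definition d_subsets :: "nat \<Rightarrow> nat \<Rightarrow> nat set set" where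
  "d_subsets d N = {e. e \<subseteq> {1..N} \<and> card e = d}"

definition random_hypergraph :: "nat \<Rightarrow> nat \<Rightarrow> real \<Rightarrow> nat set set pmf" where
  "random_hypergraph d N p =
     map_pmf (\<lambda>f. {e \<in> d_subsets d N. f e}) (Pi_pmf (d_subsets d N) False (\<lambda>_. bernoulli_pmf p))"


text \<open>The exploration process on the vertex set \<open>{1..N}\<close>. A state \<open>(A, X)\<close> consists of
  the sets of active and of explored vertices; all other vertices are unseen.\<close>

definition unseen :: "nat \<Rightarrow> nat set \<times> nat set \<Rightarrow> nat set" where
  "unseen N = (\<lambda>(A, X). {1..N} - A - X)"

definition next_vertex :: "nat \<Rightarrow> nat set \<times> nat set \<Rightarrow> nat" where
  "next_vertex N = (\<lambda>(A, X). if A \<noteq> {} then Min A else Min (unseen N (A, X)))"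

definition newly_active :: "nat \<Rightarrow> nat set set \<Rightarrow> nat set \<times> nat set \<Rightarrow> nat set" where
  "newly_active N H = (\<lambda>(A, X).
     {w \<in> unseen N (A, X) - {next_vertex N (A, X)}.
        \<exists>e\<in>H. next_vertex N (A, X) \<in> e \<and> w \<in> e \<and> e \<inter> X = {}})"

definition explore_step :: "nat \<Rightarrow> nat set set \<Rightarrow> nat set \<times> nat set \<Rightarrow> nat set \<times> nat set" where
  "explore_step N H = (\<lambda>(A, X).
     ((A - {next_vertex N (A, X)}) \<union> newly_active N H (A, X), insert (next_vertex N (A, X)) X))"

primrec explore :: "nat \<Rightarrow> nat \<Rightarrow> nat set set \<Rightarrow> nat \<Rightarrow> nat set \<times> nat set" where
  "explore N k H 0 = ({1..k}, {})"
| "explore N k H (Suc t) = explore_step N H (explore N k H t)"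

text \<open>Steps are numbered from 1: only \<open>1 \<le> t \<le> N\<close> is meaningful in the following
  (and \<open>t < N\<close> for \<open>a_coeff\<close>, because of truncated subtraction).\<close>

definition eta :: "nat \<Rightarrow> nat \<Rightarrow> nat \<Rightarrow> nat set set \<Rightarrow> nat" where
  "eta N k t H = card (newly_active N H (explore N k H (t - 1)))"

definition eta_algebra :: "nat \<Rightarrow> nat \<Rightarrow> nat \<Rightarrow> nat set set measure" where
  "eta_algebra N k t = sigma UNIV {eta N k i -` B | i B. i \<in> {1..t}}"

definition Delta :: "nat \<Rightarrow> nat \<Rightarrow> real \<Rightarrow> nat \<Rightarrow> nat \<Rightarrow> nat set set \<Rightarrow> real" where
  "Delta d N p k t H = real (eta N k t H) -
     real_cond_exp (measure_pmf (random_hypergraph d N p)) (eta_algebra N k (t - 1))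
       (\<lambda>H'. real (eta N k t H')) H"

definition a_coeff :: "nat \<Rightarrow> nat \<Rightarrow> real \<Rightarrow> nat \<Rightarrow> real" where
  "a_coeff d N p t = p * real ((N - t - 1) choose (d - 2))"

definition beta :: "nat \<Rightarrow> nat \<Rightarrow> real \<Rightarrow> nat \<Rightarrow> real" where
  "beta d N p t = (\<Prod>i=1..t. 1 - a_coeff d N p i)"

definition S_mart :: "nat \<Rightarrow> nat \<Rightarrow> real \<Rightarrow> nat \<Rightarrow> nat \<Rightarrow> nat set set \<Rightarrow> real" where
  "S_mart d N p k t H = (\<Sum>i=1..t. 1 / beta d N p i * Delta d N p k i H)"


definition rho :: "nat \<Rightarrow> real \<Rightarrow> real" where
  "rho d lam = (THE r. 0 < r \<and> r < 1 \<and>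
     1 - r = exp (- (lam / real (d - 1)) * (1 - (1 - r) ^ (d - 1))))"

definition lam_star :: "nat \<Rightarrow> real \<Rightarrow> real" where
  "lam_star d lam = lam * (1 - rho d lam) ^ (d - 1)"

definition c_const :: "nat \<Rightarrow> real \<Rightarrow> real" where
  "c_const d lam = lam * (1 - rho d lam)\<^sup>2 - lam_star d lam * (1 - rho d lam)
     + rho d lam * (1 - rho d lam)"

end

theory Submission
  imports Defs
begin

text \<open>Conditionally on the past, the hyperedges avoiding the explored vertices are still independent,
  so the step \<open>\<eta> t\<close> has, given the past, the law of a functional of a fresh hypergraph. Its mean and
  variance are explicit in the number \<open>m\<close> of unseen vertices available, and its exponential moments
  are bounded uniformly. Dividing \<open>exp (\<Sum>i. w i * \<Delta> i)\<close> by the product of the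
  conditional moment generating functions gives a martingale of mean 1. Off an event of
  probability \<open>exp (- const * N)\<close>, negligible at speed \<open>N powr (2 * \<alpha> - 1)\<close>, the martingale \<open>S\<close>
  stays below \<open>\<delta> * N\<close>; the recursion for the unseen vertices then forces \<open>m / N\<close> close to \<open>beta\<close>,
  since restarts of the exploration can only occur near times 0 and \<open>rho * N\<close>. Hence
  the logarithm of that product is asymptotically deterministic, and the weighted variances
  telescope to \<open>c_const\<close>. The Gaussian case of the Gaertner--Ellis theorem concludes.\<close>

section \<open>Gaussian moderate deviations from logarithmic moment generating functions\<close>

text \<open>The weights have size \<open>h = \<theta> * N powr (\<alpha> - 1)\<close>, so
  \<open>N * h\<^sup>2\<close> is \<open>\<theta>\<^sup>2\<close> times the speed, while a cubic
  error of order \<open>N * \<bar>h\<bar> ^ 3\<close> is smaller by a factor that tends to 0. Hence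
  a second-order expansion of each conditional moment generating function is enough. The obstacle is
  that a small probability of the bad event does not suffice: the exponential weight could be
  concentrated there. So the bad event is estimated under the weight itself, by adding a multiple of
  the deviating martingale to the exponent. The filtration is generated by the counts
  \<open>eta\<close> only, whereas independence is available given the whole trajectory of vertex
  sets. The two agree because the conditional mean depends on a count that the \<open>eta\<close>
  determine. Restarts are confined because \<open>1 - x - fluid x\<close> is concave, vanishes at 0
  and \<open>rho\<close>, and has slope \<open>lam - 1 > 0\<close> at 0. The variance of a step has
  two parts: the indicators of single vertices contribute \<open>1 / beta - 1\<close> after
  summation, and the covariance of two vertices sharing a hyperedge contributes the total decrease
  of \<open>N * a_coeff\<close>.\<close>

lemma limsup_log_prob_le:
  fixes s q :: "nat \<Rightarrow> real"
  assumes s: "\<forall>\<^sub>F N in sequentially. s N > 0" and q: "\<And>N. 0 \<le> q N"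
    and le: "\<forall>\<^sub>F N in sequentially. q N \<le> exp (s N * b)"
  shows "limsup (\<lambda>N. ereal (1 / s N) * log_prob (q N)) \<le> ereal b"
proof (rule Limsup_bounded, use s le in eventually_elim)
  case (elim N)
  show ?case
  proof (cases "q N = 0")
    case True
    then show ?thesis using elim by (simp add: log_prob_def)
  next
    case False
    then have "q N > 0" using q[of N] by simp
    then have "ln (q N) \<le> s N * b" using elim ln_ge_iff ln_le_cancel_iff[of "q N" "exp (s N * b)"] by simp
    then show ?thesis using False elim by (simp add: log_prob_def field_simps)
  qed
qed

lemma liminf_log_prob_ge:
  fixes s q :: "nat \<Rightarrow> real"
  assumes s: "\<forall>\<^sub>F N in sequentially. s N > 0"
    and le: "\<forall>\<^sub>F N in sequentially. exp (s N * b) \<le> q N"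
  shows "ereal b \<le> liminf (\<lambda>N. ereal (1 / s N) * log_prob (q N))"
proof (rule Liminf_bounded, use s le in eventually_elim)
  case (elim N)
  have "q N > 0" using elim(2) by (rule less_le_trans[rotated]) simp
  then have "s N * b \<le> ln (q N)" using elim ln_le_cancel_iff[of "exp (s N * b)" "q N"] by simp
  then show ?case using \<open>q N > 0\<close> elim by (simp add: log_prob_def field_simps)
qed

lemma (in prob_space) exp_markov:
  fixes Y :: "'a \<Rightarrow> real"
  assumes [measurable]: "Y \<in> borel_measurable M" and int: "integrable M (\<lambda>\<omega>. exp (Y \<omega>))"
  shows "measure M {\<omega> \<in> space M. b \<le> Y \<omega>} \<le> exp (- b) * expectation (\<lambda>\<omega>. exp (Y \<omega>))"
proof -
  have "measure M {\<omega> \<in> space M. b \<le> Y \<omega>} = measure M {\<omega> \<in> space M. exp b \<le> exp (Y \<omega>)}"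
    by simp
  also have "\<dots> \<le> expectation (\<lambda>\<omega>. exp (Y \<omega>)) / exp b"
    by (rule integral_Markov_inequality_measure[OF int, of "{}"]) auto
  finally show ?thesis by (simp add: exp_minus field_simps)
qed

lemma exp_uminus_mult_le: "a \<le> exp K * q \<Longrightarrow> exp (- K) * a \<le> q" for K a q :: real
  by (simp add: exp_minus field_simps)

lemma ereal_le_add: "ereal (a - e) \<le> l \<Longrightarrow> ereal a \<le> l + ereal e"
  by (cases l) auto

text \<open>The Gaussian case of the Gaertner--Ellis theorem. Exponential tilting is carried out
  without a change of measure: under the weight \<open>exp (\<theta> s Y)\<close> the mass away from
  \<open>c \<theta>\<close> is bounded by comparing the limiting log-Laplace transforms at \<open>\<theta>\<close>
  and \<open>\<theta> \<plusminus> \<eta>\<close>.\<close>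

theorem mdp_of_gaussian_log_mgf:
  fixes Y :: "nat \<Rightarrow> 'a \<Rightarrow> real"
  assumes prob: "\<And>N. prob_space (M N)" and meas: "\<And>N. Y N \<in> borel_measurable (M N)"
    and c: "c > 0" and s: "filterlim s at_top sequentially"
    and int: "\<And>N \<theta>. integrable (M N) (\<lambda>\<omega>. exp (\<theta> * s N * Y N \<omega>))"
    and lim: "\<And>\<theta>. ((\<lambda>N. ln (\<integral>\<omega>. exp (\<theta> * s N * Y N \<omega>) \<partial>M N) / s N) \<longlongrightarrow> c * \<theta>\<^sup>2 / 2) sequentially"
  shows "moderate_deviation_principle M Y s (\<lambda>x. ereal (x\<^sup>2 / (2 * c)))"
proof -
  define L where "L N \<theta> = (\<integral>\<omega>. exp (\<theta> * s N * Y N \<omega>) \<partial>M N)" for N \<theta>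
  note [measurable] = meas
  have s0: "\<forall>\<^sub>F N in sequentially. s N > 0"
    using s by (simp add: filterlim_at_top_dense)
  have Lpos: "L N \<theta> > 0" for N \<theta>
  proof -
    interpret prob_space "M N" by (rule prob)
    show ?thesis unfolding L_def
      using integral_less_AE_space[of "\<lambda>_. 0" "\<lambda>\<omega>. exp (\<theta> * s N * Y N \<omega>)"] int emeasure_space_1
      by simp
  qed
  have L_upper: "\<forall>\<^sub>F N in sequentially. L N \<theta> \<le> exp (s N * (c * \<theta>\<^sup>2 / 2 + e))" if "e > 0" for \<theta> e
  proof -
    have "\<forall>\<^sub>F N in sequentially. ln (L N \<theta>) / s N < c * \<theta>\<^sup>2 / 2 + e"
      using order_tendstoD(2)[OF lim[of \<theta>], of "c * \<theta>\<^sup>2 / 2 + e"] that by (simp add: L_def)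
    then show ?thesis using s0
    proof eventually_elim
      case (elim N)
      then have "ln (L N \<theta>) \<le> s N * (c * \<theta>\<^sup>2 / 2 + e)" by (simp add: field_simps)
      then show ?case using Lpos[of N \<theta>] by (metis exp_le_cancel_iff exp_ln)
    qed
  qed
  have L_lower: "\<forall>\<^sub>F N in sequentially. exp (s N * (c * \<theta>\<^sup>2 / 2 - e)) \<le> L N \<theta>" if "e > 0" for \<theta> e
  proof -
    have "\<forall>\<^sub>F N in sequentially. ln (L N \<theta>) / s N > c * \<theta>\<^sup>2 / 2 - e"
      using order_tendstoD(1)[OF lim[of \<theta>], of "c * \<theta>\<^sup>2 / 2 - e"] that by (simp add: L_def)
    then show ?thesis using s0
    proof eventually_elim
      case (elim N)
      then have "ln (L N \<theta>) \<ge> s N * (c * \<theta>\<^sup>2 / 2 - e)" by (simp add: field_simps)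
      then show ?case using Lpos[of N \<theta>] by (metis exp_le_cancel_iff exp_ln)
    qed
  qed
  have big: "\<forall>\<^sub>F N in sequentially. r \<le> exp (s N * e)" if "e > 0" for e r :: real
  proof -
    have "filterlim (\<lambda>N. exp (e * s N)) at_top sequentially"
      by (rule filterlim_compose[OF exp_at_top filterlim_tendsto_pos_mult_at_top[OF tendsto_const that s]])
    then show ?thesis by (simp add: filterlim_at_top mult.commute)
  qed
  have upper: "limsup (\<lambda>N. ereal (1 / s N) * log_prob (measure (M N) {\<omega> \<in> space (M N). Y N \<omega> \<in> A}))
      \<le> - (INF x\<in>A. ereal (x\<^sup>2 / (2 * c)))" (is "limsup ?q \<le> _") if A: "closed A" for A
  proof (cases "A = {}")
    case True
    \<comment> \<open>The infimum over the empty set is infinite, so the limit must be minus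
      infinity; as all probabilities vanish, every real \<open>b\<close> is a bound.\<close>
    have "limsup ?q \<le> ereal b" for b
      by (rule limsup_log_prob_le[OF s0]) (auto simp: True)
    then have "limsup ?q = - \<infinity>"
      by (intro ereal_bot) blast
    then show ?thesis by (simp add: True top_ereal_def)
  next
    case False
    \<comment> \<open>A point of \<open>A\<close> nearest to 0 minimises the rate, and
      \<open>A\<close> lies in the two tails beyond its absolute value \<open>a\<close>.\<close>
    obtain x0 where x0: "x0 \<in> A" "\<And>x. x \<in> A \<Longrightarrow> dist 0 x0 \<le> dist 0 x"
      using distance_attains_inf[OF A False, of 0] by metis
    define a where "a = \<bar>x0\<bar>"
    have a: "\<bar>x\<bar> \<ge> a" if "x \<in> A" for x using x0(2)[OF that] by (simp add: a_def dist_real_def)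
    have "limsup ?q \<le> ereal (- (a\<^sup>2 / (2 * c)) + e)" if e: "e > 0" for e
    proof (rule limsup_log_prob_le[OF s0])
      show "\<forall>\<^sub>F N in sequentially. measure (M N) {\<omega> \<in> space (M N). Y N \<omega> \<in> A}
          \<le> exp (s N * (- (a\<^sup>2 / (2 * c)) + e))"
        using L_upper[OF half_gt_zero[OF e], of "a / c"] L_upper[OF half_gt_zero[OF e], of "- a / c"]
          big[OF half_gt_zero[OF e], of 2] s0
      proof eventually_elim
        case (elim N)
        interpret prob_space "M N" by (rule prob)
        \<comment> \<open>This value maximises the Chernoff exponent
          \<open>\<theta> * a - c * \<theta>\<^sup>2 / 2\<close>; its negative serves the left
          tail.\<close>
        let ?\<theta> = "a / c"
        have exp_eq: "exp (- (s N * ?\<theta> * a)) * exp (s N * (c * ?\<theta>\<^sup>2 / 2 + e / 2)) =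
          exp (s N * (- (a\<^sup>2 / (2 * c)) + e / 2))"
          using c by (simp add: exp_add[symmetric] power2_eq_square field_simps)
        have 1: "prob {\<omega> \<in> space (M N). s N * ?\<theta> * a \<le> t * s N * Y N \<omega>} \<le> exp (s N * (- (a\<^sup>2 / (2 * c)) + e / 2))"
          if "t = ?\<theta> \<or> t = - ?\<theta>" for t
        proof -
          have "prob {\<omega> \<in> space (M N). s N * ?\<theta> * a \<le> t * s N * Y N \<omega>} \<le> exp (- (s N * ?\<theta> * a)) * L N t"
            unfolding L_def by (rule exp_markov) (use int in auto)
          also have "\<dots> \<le> exp (- (s N * ?\<theta> * a)) * exp (s N * (c * ?\<theta>\<^sup>2 / 2 + e / 2))"
            using elim that by (intro mult_left_mono) auto
          finally show ?thesis by (simp only: exp_eq)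
        qed
        have "prob {\<omega> \<in> space (M N). Y N \<omega> \<in> A} \<le>
          prob ({\<omega> \<in> space (M N). s N * ?\<theta> * a \<le> ?\<theta> * s N * Y N \<omega>} \<union> {\<omega> \<in> space (M N). s N * ?\<theta> * a \<le> - ?\<theta> * s N * Y N \<omega>})"
        proof (rule finite_measure_mono)
          show "{\<omega> \<in> space (M N). Y N \<omega> \<in> A} \<subseteq> {\<omega> \<in> space (M N). s N * ?\<theta> * a \<le> ?\<theta> * s N * Y N \<omega>} \<union> {\<omega> \<in> space (M N). s N * ?\<theta> * a \<le> - ?\<theta> * s N * Y N \<omega>}"
          proof
            fix \<omega> assume w: "\<omega> \<in> {\<omega> \<in> space (M N). Y N \<omega> \<in> A}"
            then have "a \<le> Y N \<omega> \<or> a \<le> - Y N \<omega>" using a[of "Y N \<omega>"] by auto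
            moreover have "0 \<le> ?\<theta> * s N" using c elim by (simp add: a_def)
            ultimately show "\<omega> \<in> {\<omega> \<in> space (M N). s N * ?\<theta> * a \<le> ?\<theta> * s N * Y N \<omega>} \<union> {\<omega> \<in> space (M N). s N * ?\<theta> * a \<le> - ?\<theta> * s N * Y N \<omega>}"
              using w mult_left_mono[of a "Y N \<omega>" "?\<theta> * s N"] mult_left_mono[of a "- Y N \<omega>" "?\<theta> * s N"]
              by (auto simp: mult.commute)
          qed
        qed measurable
        also have "\<dots> \<le> prob {\<omega> \<in> space (M N). s N * ?\<theta> * a \<le> ?\<theta> * s N * Y N \<omega>} + prob {\<omega> \<in> space (M N). s N * ?\<theta> * a \<le> - ?\<theta> * s N * Y N \<omega>}"
          by (rule measure_subadditive) (simp_all add: emeasure_eq_measure)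
        also have "\<dots> \<le> 2 * exp (s N * (- (a\<^sup>2 / (2 * c)) + e / 2))"
          using 1[of ?\<theta>] 1[of "- ?\<theta>"] by simp
        also have "\<dots> \<le> exp (s N * (e / 2)) * exp (s N * (- (a\<^sup>2 / (2 * c)) + e / 2))"
          using elim by (intro mult_right_mono) auto
        also have "\<dots> = exp (s N * (- (a\<^sup>2 / (2 * c)) + e))"
          by (simp add: exp_add[symmetric] algebra_simps)
        finally show ?case .
      qed
    qed simp
    then have "limsup ?q \<le> ereal (- (a\<^sup>2 / (2 * c)))"
      by - (rule ereal_le_epsilon2, auto)
    also have "\<dots> = - ereal (x0\<^sup>2 / (2 * c))" by (simp add: a_def)
    also have "\<dots> \<le> - (INF x\<in>A. ereal (x\<^sup>2 / (2 * c)))"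
      unfolding ereal_minus_le_minus using x0(1) by (rule INF_lower)
    finally show ?thesis .
  qed
  have lower: "- (INF x\<in>G. ereal (x\<^sup>2 / (2 * c))) \<le>
      liminf (\<lambda>N. ereal (1 / s N) * log_prob (measure (M N) {\<omega> \<in> space (M N). Y N \<omega> \<in> G}))"
    (is "_ \<le> liminf ?q") if G: "open G" for G
  proof -
    have "- ereal (x\<^sup>2 / (2 * c)) \<le> liminf ?q" if x: "x \<in> G" for x
    proof -
      obtain r where r: "r > 0" "ball x r \<subseteq> G" using G x open_contains_ball by blast
      \<comment> \<open>Under this tilt the mass concentrates at
        \<open>c * \<theta> = x\<close>.\<close>
      define \<theta> where "\<theta> = x / c"
      have *: "ereal (- (x\<^sup>2 / (2 * c)) - e) \<le> liminf ?q" if e: "e > 0" for e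
      proof (rule liminf_log_prob_ge[OF s0])
        \<comment> \<open>The first bound keeps the window inside \<open>G\<close>; the second makes
          the oscillation \<open>\<bar>\<theta>\<bar> * \<delta>\<close> of the tilt smaller than
          \<open>e / 2\<close>, the summand 1 covering \<open>\<theta> = 0\<close>.\<close>
        define \<delta> where "\<delta> = min r (e / (2 * (\<bar>\<theta>\<bar> + 1)))"
        have \<delta>: "\<delta> > 0" "\<delta> \<le> r" using r e by (auto simp: \<delta>_def)
        have "\<delta> * (\<bar>\<theta>\<bar> + 1) \<le> e / (2 * (\<bar>\<theta>\<bar> + 1)) * (\<bar>\<theta>\<bar> + 1)" 
          by (intro mult_right_mono) (auto simp: \<delta>_def)
        also have "e / (2 * (\<bar>\<theta>\<bar> + 1)) * (\<bar>\<theta>\<bar> + 1) = e / 2"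
          using abs_ge_zero[of \<theta>] by (simp add: divide_simps)
        finally have "\<delta> * \<bar>\<theta>\<bar> + \<delta> \<le> e / 2" by (simp only: distrib_left mult_1_right)
        then have \<delta>e: "\<bar>\<theta>\<bar> * \<delta> < e / 2" using \<delta> by (simp only: mult.commute)
        \<comment> \<open>The additional tilt that maximises the gain
          \<open>\<eta> * \<delta> - c * \<eta>\<^sup>2 / 2\<close>, which then equals
          \<open>c * \<eta>\<^sup>2 / 2\<close>.\<close>
        define \<eta> where "\<eta> = \<delta> / c"
        have \<eta>: "\<eta> > 0" using \<delta> c by (simp add: \<eta>_def)
        have x_eq: "x = c * \<theta>" and \<delta>_eq: "\<delta> = c * \<eta>" using c by (simp_all add: \<theta>_def \<eta>_def)
        have alg1: "- (\<eta> * r * (x + \<delta>)) + r * (c * (\<theta> + \<eta>)\<^sup>2 / 2 + \<epsilon>)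
            = r * (c * \<theta>\<^sup>2 / 2 - c * \<eta>\<^sup>2 / 2 + \<epsilon>)" for r \<epsilon>
          unfolding x_eq \<delta>_eq by (simp add: power2_eq_square algebra_simps add_divide_distrib)
        have alg2: "\<eta> * r * (x - \<delta>) + r * (c * (\<theta> - \<eta>)\<^sup>2 / 2 + \<epsilon>)
            = r * (c * \<theta>\<^sup>2 / 2 - c * \<eta>\<^sup>2 / 2 + \<epsilon>)" for r \<epsilon>
          unfolding x_eq \<delta>_eq by (simp add: power2_eq_square algebra_simps add_divide_distrib diff_divide_distrib)
        \<comment> \<open>The error enters twice, in the upper and in the lower estimate of the
          transforms; \<open>2 * \<epsilon> \<le> c * \<eta>\<^sup>2 / 4\<close> leaves at least
          half of the gain.\<close>
        define \<epsilon> where "\<epsilon> = min (e / 4) (c * \<eta>\<^sup>2 / 8)"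
        have \<epsilon>: "\<epsilon> > 0" "\<epsilon> \<le> e / 4" "\<epsilon> \<le> c * \<eta>\<^sup>2 / 8" using e \<eta> c by (auto simp: \<epsilon>_def)
        have \<delta>4: "c * \<eta>\<^sup>2 / 4 > 0" and e4: "e / 4 > 0" using e \<eta> c by auto
        show "\<forall>\<^sub>F N in sequentially. exp (s N * (- (x\<^sup>2 / (2 * c)) - e)) \<le> measure (M N) {\<omega> \<in> space (M N). Y N \<omega> \<in> G}"
          using L_lower[OF \<epsilon>(1), of \<theta>] L_upper[OF \<epsilon>(1), of "\<theta> + \<eta>"] L_upper[OF \<epsilon>(1), of "\<theta> - \<eta>"]
            big[OF \<delta>4, of 4] big[OF e4, of 2] s0
        proof eventually_elim
          case (elim N)
          interpret prob_space "M N" by (rule prob)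
          let ?I = "\<lambda>\<omega>. indicator {\<omega> \<in> space (M N). Y N \<omega> \<in> G} \<omega> :: real"
          let ?E = "exp (s N * (c * \<theta>\<^sup>2 / 2 - \<epsilon>))"
          \<comment> \<open>Inside the window the weight is nearly constant; to its right and left
            it is dominated by the weights for \<open>\<theta> + \<eta>\<close> and
            \<open>\<theta> - \<eta>\<close>.\<close>
          have pw: "exp (\<theta> * s N * Y N \<omega>) \<le> exp (s N * (\<theta> * x + \<bar>\<theta>\<bar> * \<delta>)) * ?I \<omega>
              + exp (- (\<eta> * s N * (x + \<delta>))) * exp ((\<theta> + \<eta>) * s N * Y N \<omega>)
              + exp (\<eta> * s N * (x - \<delta>)) * exp ((\<theta> - \<eta>) * s N * Y N \<omega>)" if w: "\<omega> \<in> space (M N)" for \<omega>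
          proof -
            have \<eta>s: "\<eta> * s N > 0" using \<eta> elim by simp
            consider "\<bar>Y N \<omega> - x\<bar> < \<delta>" | "Y N \<omega> \<ge> x + \<delta>" | "Y N \<omega> \<le> x - \<delta>" by linarith
            then show ?thesis
            proof cases
              case 1
              then have "Y N \<omega> \<in> ball x r" using \<delta> by (simp add: dist_real_def)
              then have I: "?I \<omega> = 1" using r w by (auto simp: indicator_def)
              have "\<theta> * (Y N \<omega> - x) \<le> \<bar>\<theta>\<bar> * \<bar>Y N \<omega> - x\<bar>" by (metis abs_ge_self abs_mult)
              also have "\<dots> \<le> \<bar>\<theta>\<bar> * \<delta>" using 1 by (intro mult_left_mono) auto
              finally have "s N * (\<theta> * Y N \<omega>) \<le> s N * (\<theta> * x + \<bar>\<theta>\<bar> * \<delta>)" using elim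
                by (intro mult_left_mono) (auto simp: algebra_simps)
              then have "exp (\<theta> * s N * Y N \<omega>) \<le> exp (s N * (\<theta> * x + \<bar>\<theta>\<bar> * \<delta>)) * ?I \<omega>"
                using I by (simp add: algebra_simps)
              then show ?thesis by (simp add: add_increasing add_increasing2)
            next
              case 2
              have "exp (\<theta> * s N * Y N \<omega>) \<le> exp (- (\<eta> * s N * (x + \<delta>))) * exp ((\<theta> + \<eta>) * s N * Y N \<omega>)"
                using mult_left_mono[OF 2, of "\<eta> * s N"] \<eta>s by (simp add: exp_add[symmetric] algebra_simps)
              moreover have "0 \<le> exp (s N * (\<theta> * x + \<bar>\<theta>\<bar> * \<delta>)) * ?I \<omega>" by simp
              ultimately show ?thesis by (simp add: add_increasing add_increasing2)
            next
              case 3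
              have "exp (\<theta> * s N * Y N \<omega>) \<le> exp (\<eta> * s N * (x - \<delta>)) * exp ((\<theta> - \<eta>) * s N * Y N \<omega>)"
                using mult_left_mono[OF 3, of "\<eta> * s N"] \<eta>s by (simp add: exp_add[symmetric] algebra_simps)
              moreover have "0 \<le> exp (s N * (\<theta> * x + \<bar>\<theta>\<bar> * \<delta>)) * ?I \<omega>" by simp
              ultimately show ?thesis by (simp add: add_increasing add_increasing2)
            qed
          qed
          have [measurable]: "G \<in> sets borel" using G by simp
          have ev: "{\<omega> \<in> space (M N). Y N \<omega> \<in> G} \<in> events" by measurable
          have intI: "integrable (M N) ?I" using ev by (simp add: emeasure_eq_measure)
          have "L N \<theta> \<le> (\<integral>\<omega>. exp (s N * (\<theta> * x + \<bar>\<theta>\<bar> * \<delta>)) * ?I \<omega>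
              + exp (- (\<eta> * s N * (x + \<delta>))) * exp ((\<theta> + \<eta>) * s N * Y N \<omega>)
              + exp (\<eta> * s N * (x - \<delta>)) * exp ((\<theta> - \<eta>) * s N * Y N \<omega>) \<partial>M N)"
            unfolding L_def by (rule integral_mono) (use int pw intI in \<open>auto intro!: integrable_add integrable_mult_right\<close>)
          also have "\<dots> = exp (s N * (\<theta> * x + \<bar>\<theta>\<bar> * \<delta>)) * prob {\<omega> \<in> space (M N). Y N \<omega> \<in> G}
              + exp (- (\<eta> * s N * (x + \<delta>))) * L N (\<theta> + \<eta>) + exp (\<eta> * s N * (x - \<delta>)) * L N (\<theta> - \<eta>)"
            unfolding L_def using int intI by (simp add: integrable_add integrable_mult_right)
          also have "exp (- (\<eta> * s N * (x + \<delta>))) * L N (\<theta> + \<eta>) \<le> ?E / 4"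
          proof -
            have "exp (- (\<eta> * s N * (x + \<delta>))) * L N (\<theta> + \<eta>) \<le>
              exp (- (\<eta> * s N * (x + \<delta>))) * exp (s N * (c * (\<theta> + \<eta>)\<^sup>2 / 2 + \<epsilon>))"
              using elim by (intro mult_left_mono) auto
            also have "\<dots> = exp (s N * (c * \<theta>\<^sup>2 / 2 - c * \<eta>\<^sup>2 / 2 + \<epsilon>))"
              by (simp only: exp_add[symmetric] alg1)
            also have "\<dots> \<le> exp (s N * (c * \<theta>\<^sup>2 / 2 - \<epsilon>) - s N * (c * \<eta>\<^sup>2 / 4))"
              unfolding exp_le_cancel_iff right_diff_distrib[symmetric] using \<epsilon>(3) elim
              by (intro mult_left_mono) auto
            also have "\<dots> = ?E / exp (s N * (c * \<eta>\<^sup>2 / 4))" by (rule exp_diff)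
            also have "\<dots> \<le> ?E / 4" using elim by (intro divide_left_mono) auto
            finally show ?thesis .
          qed
          also have "exp (\<eta> * s N * (x - \<delta>)) * L N (\<theta> - \<eta>) \<le> ?E / 4"
          proof -
            have "exp (\<eta> * s N * (x - \<delta>)) * L N (\<theta> - \<eta>) \<le>
              exp (\<eta> * s N * (x - \<delta>)) * exp (s N * (c * (\<theta> - \<eta>)\<^sup>2 / 2 + \<epsilon>))"
              using elim by (intro mult_left_mono) auto
            also have "\<dots> = exp (s N * (c * \<theta>\<^sup>2 / 2 - c * \<eta>\<^sup>2 / 2 + \<epsilon>))"
              by (simp only: exp_add[symmetric] alg2)
            also have "\<dots> \<le> exp (s N * (c * \<theta>\<^sup>2 / 2 - \<epsilon>) - s N * (c * \<eta>\<^sup>2 / 4))"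
              unfolding exp_le_cancel_iff right_diff_distrib[symmetric] using \<epsilon>(3) elim
              by (intro mult_left_mono) auto
            also have "\<dots> = ?E / exp (s N * (c * \<eta>\<^sup>2 / 4))" by (rule exp_diff)
            also have "\<dots> \<le> ?E / 4" using elim by (intro divide_left_mono) auto
            finally show ?thesis .
          qed
          finally have "L N \<theta> \<le> exp (s N * (\<theta> * x + \<bar>\<theta>\<bar> * \<delta>)) * prob {\<omega> \<in> space (M N). Y N \<omega> \<in> G} + ?E / 4 + ?E / 4"
            by simp
          \<comment> \<open>The two outer parts take at most half of the total weight, so the window
            carries the other half.\<close>
          then have "?E / 2 \<le> exp (s N * (\<theta> * x + \<bar>\<theta>\<bar> * \<delta>)) * prob {\<omega> \<in> space (M N). Y N \<omega> \<in> G}"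
            using elim(1) by linarith
          then have "exp (- (s N * (\<theta> * x + \<bar>\<theta>\<bar> * \<delta>))) * (?E / 2) \<le> prob {\<omega> \<in> space (M N). Y N \<omega> \<in> G}"
            by (rule exp_uminus_mult_le)
          moreover have "exp (s N * (- (x\<^sup>2 / (2 * c)) - e)) \<le> exp (- (s N * (\<theta> * x + \<bar>\<theta>\<bar> * \<delta>))) * (?E / 2)"
          proof -
            have eq: "c * \<theta>\<^sup>2 / 2 - \<theta> * x = - (x\<^sup>2 / (2 * c))"
              using c by (simp add: \<theta>_def power2_eq_square field_simps)
            have "exp (s N * (- (x\<^sup>2 / (2 * c)) - e)) * 2 \<le> exp (s N * (- (x\<^sup>2 / (2 * c)) - e)) * exp (s N * (e / 4))"
              using elim by (intro mult_left_mono) auto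
            also have "\<dots> = exp (s N * (- (x\<^sup>2 / (2 * c)) - e * 3 / 4))"
              by (simp add: exp_add[symmetric] algebra_simps)
            also have "\<dots> \<le> exp (s N * (c * \<theta>\<^sup>2 / 2 - \<theta> * x - \<bar>\<theta>\<bar> * \<delta> - \<epsilon>))"
              unfolding eq exp_le_cancel_iff using \<delta>e \<epsilon> elim by (intro mult_left_mono) auto
            also have "\<dots> = exp (- (s N * (\<theta> * x + \<bar>\<theta>\<bar> * \<delta>))) * ?E"
              by (simp add: exp_add[symmetric] algebra_simps)
            finally show ?thesis by simp
          qed
          ultimately show ?case by linarith
        qed
      qed
      have "ereal (- (x\<^sup>2 / (2 * c))) \<le> liminf ?q"
      proof (rule ereal_le_epsilon2)
        fix e :: real assume "e > 0"
        then show "ereal (- (x\<^sup>2 / (2 * c))) \<le> liminf ?q + ereal e"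
          using *[of e] by (intro ereal_le_add) blast
      qed
      then show ?thesis by simp
    qed
    then have "- liminf ?q \<le> (INF x\<in>G. ereal (x\<^sup>2 / (2 * c)))"
      by - (rule INF_greatest, rule iffD1[OF ereal_uminus_le_reorder])
    then show ?thesis by (rule iffD1[OF ereal_uminus_le_reorder])
  qed
  have compact: "compact {x. ereal (x\<^sup>2 / (2 * c)) \<le> ereal l}" if "0 \<le> l" for l
  proof -
    have iff: "x\<^sup>2 / (2 * c) \<le> l \<longleftrightarrow> \<bar>x\<bar> \<le> sqrt (2 * c * l)" for x
    proof -
      have "x\<^sup>2 / (2 * c) \<le> l \<longleftrightarrow> sqrt (x\<^sup>2) \<le> sqrt (2 * c * l)"
        unfolding real_sqrt_le_iff using c by (simp add: field_simps)
      then show ?thesis by simp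
    qed
    have "{x. ereal (x\<^sup>2 / (2 * c)) \<le> ereal l} = {- sqrt (2 * c * l)..sqrt (2 * c * l)}"
      by (intro set_eqI) (simp only: mem_Collect_eq ereal_less_eq iff atLeastAtMost_iff abs_le_iff, linarith)
    then show ?thesis by (simp only: compact_Icc)
  qed
  have nonneg: "0 \<le> ereal (x\<^sup>2 / (2 * c))" for x using c by simp
  show ?thesis unfolding moderate_deviation_principle_def
    by (intro conjI allI impI prob meas nonneg compact lower upper)
qed

section \<open>Resampling the unexplored hyperedges\<close>

lemma finite_d_subsets [simp]: "finite (d_subsets d N)"
  unfolding d_subsets_def by (rule finite_subset[of _ "Pow {1..N}"]) auto

lemma set_random_hypergraph: "H \<in> set_pmf (random_hypergraph d N p) \<Longrightarrow> H \<subseteq> d_subsets d N"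
  by (auto simp: random_hypergraph_def)

lemma integrable_random_hypergraph [simp]:
  "integrable (measure_pmf (random_hypergraph d N p)) (f :: _ \<Rightarrow> real)"
  by (rule integrable_measure_pmf_finite, rule finite_subset[of _ "Pow (d_subsets d N)"])
    (auto dest: set_random_hypergraph)

abbreviation hexp :: "nat \<Rightarrow> nat \<Rightarrow> real \<Rightarrow> (nat set set \<Rightarrow> real) \<Rightarrow> real" where
  "hexp d N p f \<equiv> measure_pmf.expectation (random_hypergraph d N p) f"

lemma hexp_cong: "(\<And>H. H \<subseteq> d_subsets d N \<Longrightarrow> f H = g H) \<Longrightarrow> hexp d N p f = hexp d N p g"
  by (rule integral_cong_AE) (auto simp: AE_measure_pmf_iff dest: set_random_hypergraph)

lemma hexp_mono: "(\<And>H. H \<subseteq> d_subsets d N \<Longrightarrow> f H \<le> g H) \<Longrightarrow> hexp d N p f \<le> hexp d N p g"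
  by (rule integral_mono_AE) (auto simp: AE_measure_pmf_iff dest: set_random_hypergraph)

lemma hexp_sum: "hexp d N p (\<lambda>H. \<Sum>i\<in>I. f i H) = (\<Sum>i\<in>I. hexp d N p (f i))"
  by (rule Bochner_Integration.integral_sum) simp

lemma hexp_eq_sum: "hexp d N p f = (\<Sum>H\<in>Pow (d_subsets d N). f H * pmf (random_hypergraph d N p) H)"
  by (rule integral_measure_pmf_real) (auto dest: set_random_hypergraph)

text \<open>The preimage of \<open>H\<close> under \<open>f \<mapsto> {e. f e}\<close> is a product
  set that prescribes one value for each possible hyperedge.\<close>

lemma pmf_random_hypergraph:
  assumes "H \<subseteq> d_subsets d N"
  shows "pmf (random_hypergraph d N p) H = (\<Prod>e\<in>d_subsets d N. pmf (bernoulli_pmf p) (e \<in> H))"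
proof -
  have "(\<lambda>f. {e \<in> d_subsets d N. f e}) -` {H} = Pi (d_subsets d N) (\<lambda>e. {e \<in> H})"
    using assms by (auto simp: Pi_def)
  then show ?thesis
    by (simp add: random_hypergraph_def pmf_map measure_Pi_pmf_Pi measure_pmf_single)
qed

text \<open>The generating function of a binomial variable. At \<open>z = 0\<close> the convention
  \<open>0 ^ 0 = 1\<close> makes the integrand the indicator that no hyperedge of \<open>E\<close>
  is present, which is how missed vertices are treated; a large \<open>z\<close> serves the
  exponential moments.\<close>

lemma hexp_power_card:
  assumes "0 \<le> p" "p \<le> 1" "E \<subseteq> d_subsets d N" "0 \<le> z"
  shows "hexp d N p (\<lambda>H. z ^ card (H \<inter> E)) = (1 - p + p * z) ^ card E"
proof -
  let ?D = "d_subsets d N"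
  let ?g = "\<lambda>e b. if b \<and> e \<in> E then z else 1 :: real"
  have finE: "finite E" using assms(3) by (rule finite_subset) simp
  have "hexp d N p (\<lambda>H. z ^ card (H \<inter> E)) =
      measure_pmf.expectation (Pi_pmf ?D False (\<lambda>_. bernoulli_pmf p)) (\<lambda>f. z ^ card ({e \<in> ?D. f e} \<inter> E))"
    unfolding random_hypergraph_def by simp
  also have "\<dots> = measure_pmf.expectation (Pi_pmf ?D False (\<lambda>_. bernoulli_pmf p)) (\<lambda>f. \<Prod>e\<in>?D. ?g e (f e))"
  proof (rule Bochner_Integration.integral_cong)
    fix f :: "nat set \<Rightarrow> bool"
    have "(\<Prod>e\<in>?D. ?g e (f e)) = z ^ card {e \<in> ?D. f e \<and> e \<in> E}"
      by (simp add: prod.If_cases Int_def)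
    also have "{e \<in> ?D. f e \<and> e \<in> E} = {e \<in> ?D. f e} \<inter> E" by auto
    finally show "z ^ card ({e \<in> ?D. f e} \<inter> E) = (\<Prod>e\<in>?D. ?g e (f e))" by simp
  qed simp
  also have "\<dots> = (\<Prod>e\<in>?D. measure_pmf.expectation (bernoulli_pmf p) (?g e))"
    using assms by (intro expectation_prod_Pi_pmf) (auto intro: integrable_measure_pmf_finite)
  also have "\<dots> = (\<Prod>e\<in>?D. if e \<in> E then 1 - p + p * z else 1)"
    using assms by (intro prod.cong refl) (simp add: algebra_simps)
  also have "\<dots> = (1 - p + p * z) ^ card E"
    using assms(3) by (simp add: prod.If_cases Int_absorb1)
  finally show ?thesis .
qed

text \<open>Exchanging the hyperedges outside \<open>T H\<close> between two independent copies is an involution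
  preserving the product weight.\<close>

lemma hexp_resample:
  fixes T :: "nat set set \<Rightarrow> nat set set"
  assumes T: "\<And>H H'. H \<inter> T H = H' \<inter> T H \<Longrightarrow> T H' = T H"
  shows "hexp d N p f = hexp d N p (\<lambda>H. hexp d N p (\<lambda>H'. f (H \<inter> T H \<union> (H' - T H))))"
proof -
  let ?P = "Pow (d_subsets d N)" and ?w = "pmf (random_hypergraph d N p)"
  \<comment> \<open>The hypothesis on \<open>T\<close> says that \<open>T H\<close> is found by
    inspecting only hyperedges in \<open>T H\<close>, as for a stopping time. Hence
    \<open>\<sigma>\<close> leaves \<open>T\<close> unchanged and undoes itself.\<close>
  define \<sigma> where "\<sigma> = (\<lambda>(H, H'). (H \<inter> T H \<union> (H' - T H), H' \<inter> T H \<union> (H - T H)))"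
  have T\<sigma>: "T (fst (\<sigma> x)) = T (fst x)" for x
    by (rule T) (auto simp: \<sigma>_def split: prod.split)
  have inv: "\<sigma> (\<sigma> x) = x" for x
    using T\<sigma>[of x] by (cases x) (auto simp: \<sigma>_def)
  have maps: "\<sigma> x \<in> ?P \<times> ?P" if "x \<in> ?P \<times> ?P" for x
    using that by (auto simp: \<sigma>_def)
  have weight: "?w (fst (\<sigma> x)) * ?w (snd (\<sigma> x)) = ?w (fst x) * ?w (snd x)" if "x \<in> ?P \<times> ?P" for x
  proof -
    have sub: "fst (\<sigma> x) \<subseteq> d_subsets d N" "snd (\<sigma> x) \<subseteq> d_subsets d N" "fst x \<subseteq> d_subsets d N" "snd x \<subseteq> d_subsets d N"
      using maps[OF that] that by (auto simp: mem_Times_iff)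
    show ?thesis unfolding pmf_random_hypergraph[OF sub(1)] pmf_random_hypergraph[OF sub(2)]
        pmf_random_hypergraph[OF sub(3)] pmf_random_hypergraph[OF sub(4)] prod.distrib[symmetric]
    proof (intro prod.cong refl)
      fix e show "pmf (bernoulli_pmf p) (e \<in> fst (\<sigma> x)) * pmf (bernoulli_pmf p) (e \<in> snd (\<sigma> x)) =
        pmf (bernoulli_pmf p) (e \<in> fst x) * pmf (bernoulli_pmf p) (e \<in> snd x)"
        by (cases "e \<in> T (fst x)") (auto simp: \<sigma>_def mult.commute split: prod.split)
    qed
  qed
  have total: "(\<Sum>H\<in>?P. ?w H) = 1"
    by (rule sum_pmf_eq_1) (auto dest: set_random_hypergraph)
  have "hexp d N p (\<lambda>H. hexp d N p (\<lambda>H'. f (H \<inter> T H \<union> (H' - T H)))) =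
     (\<Sum>(H, H')\<in>?P \<times> ?P. f (H \<inter> T H \<union> (H' - T H)) * ?w H' * ?w H)"
    unfolding hexp_eq_sum sum_distrib_right by (rule sum.cartesian_product)
  also have "\<dots> = (\<Sum>x\<in>?P \<times> ?P. f (fst (\<sigma> x)) * (?w (fst x) * ?w (snd x)))"
    by (intro sum.cong) (auto simp: \<sigma>_def)
  also have "\<dots> = (\<Sum>x\<in>?P \<times> ?P. f (fst x) * (?w (fst x) * ?w (snd x)))"
    by (rule sum.reindex_bij_witness[of _ \<sigma> \<sigma>]) (use inv maps weight in auto)
  also have "\<dots> = (\<Sum>(H, H')\<in>?P \<times> ?P. f H * ?w H * ?w H')"
    by (intro sum.cong) auto
  also have "\<dots> = (\<Sum>H\<in>?P. \<Sum>H'\<in>?P. f H * ?w H * ?w H')"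
    by (rule sum.cartesian_product[symmetric])
  also have "\<dots> = hexp d N p f"
    unfolding hexp_eq_sum by (simp add: sum_distrib_left[symmetric] total)
  finally show ?thesis by simp
qed

section \<open>Which hyperedges the exploration has read\<close>

lemma explore_snd_mono: "s \<le> t \<Longrightarrow> snd (explore N k H s) \<subseteq> snd (explore N k H t)"
  by (induction t rule: dec_induct) (auto simp: explore_step_def split: prod.splits)

text \<open>A step reads only hyperedges through its selected vertex, and that vertex is explored
  from then on. So the hyperedges meeting the explored set at time \<open>t\<close> determine
  everything up to \<open>t\<close>.\<close>

lemma explore_cong:
  assumes eq: "H \<inter> {e. e \<inter> snd (explore N k H t) \<noteq> {}} = H' \<inter> {e. e \<inter> snd (explore N k H t) \<noteq> {}}"
    and "s \<le> t"
  shows "explore N k H' s = explore N k H s"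
  using assms(2)
proof (induction s)
  case (Suc s)
  let ?st = "explore N k H s"
  have "next_vertex N ?st \<in> snd (explore N k H (Suc s))"
    by (auto simp: explore_step_def split: prod.splits)
  then have "next_vertex N ?st \<in> snd (explore N k H t)"
    using explore_snd_mono[OF Suc.prems] by blast
  then have iff: "e \<in> H' \<longleftrightarrow> e \<in> H" if "next_vertex N ?st \<in> e" for e using eq that by blast
  have "(\<exists>e\<in>H'. next_vertex N ?st \<in> e \<and> Q e) \<longleftrightarrow> (\<exists>e\<in>H. next_vertex N ?st \<in> e \<and> Q e)" for Q
    using iff by blast
  then have "newly_active N H' ?st = newly_active N H ?st"
    by (cases ?st) (simp only: newly_active_def prod.case)
  then show ?case using Suc.IH Suc.prems by (simp add: explore_step_def split_beta)
qed simp

text \<open>The next step looks only at hyperedges disjoint from the explored set, exactly those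
  taken from \<open>H'\<close>.\<close>

lemma newly_active_resample:
  "newly_active N (H \<inter> {e. e \<inter> snd st \<noteq> {}} \<union> (H' - {e. e \<inter> snd st \<noteq> {}})) st = newly_active N H' st"
  by (auto simp: newly_active_def split: prod.splits)

text \<open>The Markov property in the form used throughout: \<open>g\<close> may use the whole
  trajectory up to \<open>t\<close>, while the set activated in the next step may be drawn from an
  independent hypergraph.\<close>

lemma hexp_explore_step:
  fixes g :: "nat set set \<Rightarrow> nat set \<Rightarrow> real"
  assumes g: "\<And>H H' B. (\<And>s. s \<le> t \<Longrightarrow> explore N k H s = explore N k H' s) \<Longrightarrow> g H B = g H' B"
  shows "hexp d N p (\<lambda>H. g H (newly_active N H (explore N k H t))) =
    hexp d N p (\<lambda>H. hexp d N p (\<lambda>H'. g H (newly_active N H' (explore N k H t))))"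
proof -
  \<comment> \<open>The hyperedges already read; \<open>explore_cong\<close> shows that this set
    satisfies the hypothesis of \<open>hexp_resample\<close>.\<close>
  define T where "T H = {e. e \<inter> snd (explore N k H t) \<noteq> {}}" for H
  have same: "explore N k H' s = explore N k H s" if "H \<inter> T H = H' \<inter> T H" "s \<le> t" for H H' s
    using explore_cong[of H N k t H' s] that by (simp add: T_def)
  have same': "explore N k (H \<inter> T H \<union> (H' - T H)) s = explore N k H s" if "s \<le> t" for H H' s
    using that by (intro same) auto
  have "hexp d N p (\<lambda>H. g H (newly_active N H (explore N k H t))) =
    hexp d N p (\<lambda>H. hexp d N p (\<lambda>H'. g (H \<inter> T H \<union> (H' - T H))
      (newly_active N (H \<inter> T H \<union> (H' - T H)) (explore N k (H \<inter> T H \<union> (H' - T H)) t))))"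
  proof (rule hexp_resample[where T = T and f = "\<lambda>H. g H (newly_active N H (explore N k H t))"])
    fix H H' assume "H \<inter> T H = H' \<inter> T H"
    from same[OF this order_refl] show "T H' = T H" by (simp add: T_def)
  qed
  also have "\<dots> = hexp d N p (\<lambda>H. hexp d N p (\<lambda>H'. g H (newly_active N H' (explore N k H t))))"
  proof (intro hexp_cong)
    fix H H'
    have 1: "newly_active N (H \<inter> T H \<union> (H' - T H)) (explore N k H t) = newly_active N H' (explore N k H t)"
      unfolding T_def by (rule newly_active_resample)
    have 2: "explore N k (H \<inter> T H \<union> (H' - T H)) t = explore N k H t"
      by (rule same') simp
    have 3: "g (H \<inter> T H \<union> (H' - T H)) B = g H B" for B
      by (rule g) (rule same')
    show "g (H \<inter> T H \<union> (H' - T H)) (newly_active N (H \<inter> T H \<union> (H' - T H)) (explore N k (H \<inter> T H \<union> (H' - T H)) t))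
      = g H (newly_active N H' (explore N k H t))"
      by (simp only: 1 2 3)
  qed
  finally show ?thesis .
qed

section \<open>One exploration step\<close>

definition valid_state :: "nat \<Rightarrow> nat \<Rightarrow> nat set \<times> nat set \<Rightarrow> bool" where
  "valid_state N t st \<longleftrightarrow> fst st \<subseteq> {1..N} \<and> snd st \<subseteq> {1..N} \<and> fst st \<inter> snd st = {} \<and> card (snd st) = t"

definition candidates :: "nat \<Rightarrow> nat set \<times> nat set \<Rightarrow> nat set" where
  "candidates N st = unseen N st - {next_vertex N st}"

lemma unseen_eq: "unseen N st = {1..N} - fst st - snd st"
  by (simp add: unseen_def split_beta)

lemma newly_active_eq: "newly_active N H st =
    {w \<in> candidates N st. \<exists>e\<in>H. next_vertex N st \<in> e \<and> w \<in> e \<and> e \<inter> snd st = {}}"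
  by (simp add: newly_active_def candidates_def split_beta)

lemma explore_step_eq: "explore_step N H st =
    ((fst st - {next_vertex N st}) \<union> newly_active N H st, insert (next_vertex N st) (snd st))"
  by (simp add: explore_step_def split_beta)

lemma finite_candidates [simp]: "finite (candidates N st)"
  by (simp add: candidates_def unseen_eq)

lemma candidates_subset: "candidates N st \<subseteq> {1..N} - snd st - {next_vertex N st}"
  by (auto simp: candidates_def unseen_eq)

lemma newly_active_subset: "newly_active N H st \<subseteq> candidates N st"
  by (auto simp: newly_active_eq)

lemma next_vertex_active: "valid_state N t st \<Longrightarrow> fst st \<noteq> {} \<Longrightarrow> next_vertex N st \<in> fst st"
  by (auto simp: next_vertex_def valid_state_def split_beta intro!: Min_in intro: finite_subset)

lemma valid_state_card: 
  assumes "valid_state N t st"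
  shows "card (fst st) + card (unseen N st) + t = N"
proof -
  have fin: "finite (fst st)" "finite (snd st)"
    using assms by (auto simp: valid_state_def intro: finite_subset)
  have "{1..N} = fst st \<union> (unseen N st \<union> snd st)" using assms by (auto simp: valid_state_def unseen_eq)
  then have "card {1..N} = card (fst st \<union> (unseen N st \<union> snd st))" by simp
  also have "\<dots> = card (fst st) + card (unseen N st \<union> snd st)"
    using assms fin by (intro card_Un_disjoint) (auto simp: valid_state_def unseen_eq)
  also have "card (unseen N st \<union> snd st) = card (unseen N st) + card (snd st)"
    using fin by (intro card_Un_disjoint) (auto simp: unseen_eq)
  finally show ?thesis using assms by (simp add: valid_state_def)
qed

lemma next_vertex_unseen:
  assumes "valid_state N t st" "t < N" "fst st = {}"
  shows "next_vertex N st \<in> unseen N st"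
proof -
  have "unseen N st \<noteq> {}" using valid_state_card[OF assms(1)] assms(2,3) by auto
  then have "Min (unseen N st) \<in> unseen N st" by (intro Min_in) (simp_all add: unseen_eq)
  then show ?thesis using assms(3) by (cases st) (simp add: next_vertex_def)
qed

lemma next_vertex_in:
  assumes "valid_state N t st" "t < N"
  shows "next_vertex N st \<in> {1..N} - snd st"
proof (cases "fst st = {}")
  case True
  then show ?thesis using next_vertex_unseen[OF assms] by (auto simp: unseen_eq)
next
  case False
  then show ?thesis using next_vertex_active[OF assms(1)] assms(1) by (auto simp: valid_state_def)
qed

lemma valid_state_step:
  assumes "valid_state N t st" "t < N"
  shows "valid_state N (Suc t) (explore_step N H st)"
proof -
  have "finite (snd st)" using assms by (auto simp: valid_state_def intro: finite_subset)
  then show ?thesis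
    using assms(1) next_vertex_in[OF assms] newly_active_subset[of N H st] candidates_subset[of N st]
    unfolding valid_state_def explore_step_eq by auto
qed

lemma valid_explore: "k \<le> N \<Longrightarrow> t \<le> N \<Longrightarrow> valid_state N t (explore N k H t)"
  by (induction t) (auto simp: valid_state_def[of N 0] intro!: valid_state_step)

text \<open>With an active vertex available no unseen vertex is selected; without one, the restart
  itself uses up an unseen vertex.\<close>

lemma card_candidates:
  assumes "valid_state N t st" "t < N"
  shows "card (candidates N st) + (if fst st = {} then 1 else 0) = card (unseen N st)"
proof (cases "fst st = {}")
  case True
  have "card (unseen N st) = Suc (card (candidates N st))"
    unfolding candidates_def using next_vertex_unseen[OF assms True] 
    by (intro card.remove) (auto simp: unseen_eq)
  then show ?thesis using True by simp
next
  case False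
  then have "next_vertex N st \<notin> unseen N st" using next_vertex_active[OF assms(1)] by (auto simp: unseen_eq)
  then show ?thesis using False by (simp add: candidates_def)
qed

lemma unseen_step:
  assumes "valid_state N t st" "t < N"
  shows "unseen N (explore_step N H st) = candidates N st - newly_active N H st"
  using next_vertex_in[OF assms]
  unfolding explore_step_eq unseen_eq candidates_def by auto

lemma card_candidates_le: "card (candidates N st) \<le> N"
  using card_mono[of "{1..N}" "candidates N st"] candidates_subset[of N st] by auto

section \<open>Hyperedge counts and the first two moments of a step\<close>

lemma card_supersets:
  assumes "finite Z" "S \<subseteq> Z" "card S \<le> d"
  shows "card {e. S \<subseteq> e \<and> e \<subseteq> Z \<and> card e = d} = (card Z - card S) choose (d - card S)"
proof -
  have finS: "finite S" using assms finite_subset by blast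
  have "bij_betw (\<lambda>e. e - S) {e. S \<subseteq> e \<and> e \<subseteq> Z \<and> card e = d} {B. B \<subseteq> Z - S \<and> card B = d - card S}"
  proof (rule bij_betw_byWitness[where f' = "\<lambda>B. B \<union> S"])
    show "(\<lambda>B. B \<union> S) ` {B. B \<subseteq> Z - S \<and> card B = d - card S} \<subseteq> {e. S \<subseteq> e \<and> e \<subseteq> Z \<and> card e = d}"
    proof clarify
      fix B assume B: "B \<subseteq> Z - S" "card B = d - card S"
      have "finite B" using B assms(1) by (meson finite_Diff finite_subset)
      then have "card (B \<union> S) = card B + card S" using B finS by (intro card_Un_disjoint) auto
      then show "S \<subseteq> B \<union> S \<and> B \<union> S \<subseteq> Z \<and> card (B \<union> S) = d" using B assms by auto
    qed
  qed (auto simp: card_Diff_subset[OF finS])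
  then have "card {e. S \<subseteq> e \<and> e \<subseteq> Z \<and> card e = d} = card {B. B \<subseteq> Z - S \<and> card B = d - card S}"
    by (rule bij_betw_same_card)
  also have "\<dots> = (card Z - card S) choose (d - card S)"
    using assms finS by (simp add: n_subsets card_Diff_subset)
  finally show ?thesis .
qed

text \<open>The probability that in step \<open>t\<close> a given unseen vertex is not activated.\<close>

definition miss :: "nat \<Rightarrow> nat \<Rightarrow> real \<Rightarrow> nat \<Rightarrow> real" where
  "miss d N p t = (1 - p) ^ ((N - t - 1) choose (d - 2))"

text \<open>The centred increment, with the activated set as a separate argument \<open>B\<close> so
  that it can be evaluated on a fresh hypergraph while the state \<open>st\<close> stays
  fixed.\<close>

definition inc :: "nat \<Rightarrow> nat \<Rightarrow> real \<Rightarrow> nat \<Rightarrow> nat set \<times> nat set \<Rightarrow> nat set \<Rightarrow> real" where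
  "inc d N p t st B = real (card B) - real (card (candidates N st)) * (1 - miss d N p t)"

text \<open>The variance of the number of missed candidates, diagonal plus pairs. Two candidates are
  both missed with probability \<open>miss t * miss (Suc t)\<close>: the hyperedges to the second
  one that avoid the first are those on a ground set with one vertex less.\<close>

definition step_var :: "nat \<Rightarrow> nat \<Rightarrow> real \<Rightarrow> nat \<Rightarrow> real \<Rightarrow> real" where
  "step_var d N p t m = m * miss d N p t * (1 - miss d N p t)
     + m * (m - 1) * (miss d N p t * miss d N p (Suc t) - (miss d N p t)\<^sup>2)"

definition edges_at :: "nat \<Rightarrow> nat \<Rightarrow> nat set \<times> nat set \<Rightarrow> nat set set" where
  "edges_at d N st = {e \<in> d_subsets d N. next_vertex N st \<in> e \<and> e \<inter> snd st = {}}"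

definition edges_to :: "nat \<Rightarrow> nat \<Rightarrow> nat set \<times> nat set \<Rightarrow> nat \<Rightarrow> nat set set" where
  "edges_to d N st w = {e \<in> edges_at d N st. w \<in> e}"

lemma edges_to_subset: "edges_to d N st w \<subseteq> d_subsets d N"
  by (auto simp: edges_to_def edges_at_def)

lemma finite_edges [simp]: "finite (edges_at d N st)" "finite (edges_to d N st w)"
  by (auto simp: edges_to_def edges_at_def intro: finite_subset)

lemma newly_active_iff:
  "H \<subseteq> d_subsets d N \<Longrightarrow> w \<in> newly_active N H st \<longleftrightarrow> w \<in> candidates N st \<and> H \<inter> edges_to d N st w \<noteq> {}"
  by (auto simp: newly_active_eq edges_to_def edges_at_def)

context
  fixes d N t :: nat and p :: real and st :: "nat set \<times> nat set"
  assumes d: "2 \<le> d" and p: "0 \<le> p" "p \<le> 1" and valid: "valid_state N t st" and t: "Suc t < N"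
begin

lemma next_in: "next_vertex N st \<in> {1..N} - snd st"
  using next_vertex_in[OF valid] t by simp

lemma card_unexplored: "card ({1..N} - snd st) = N - t"
  using valid by (subst card_Diff_subset) (auto simp: valid_state_def intro: finite_subset)

lemma card_edges_at: "card (edges_at d N st) = (N - t - 1) choose (d - 1)"
proof -
  have "edges_at d N st = {e. {next_vertex N st} \<subseteq> e \<and> e \<subseteq> {1..N} - snd st \<and> card e = d}"
    by (auto simp: edges_at_def d_subsets_def)
  then show ?thesis using card_supersets[of "{1..N} - snd st" "{next_vertex N st}" d] next_in d card_unexplored by simp
qed

text \<open>The state after \<open>t\<close> steps is used in step \<open>Suc t\<close>: besides the
  \<open>t\<close> explored vertices, the selected vertex and \<open>w\<close> are fixed, and
  \<open>d - 2\<close> vertices remain to be chosen from the rest.\<close>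

lemma card_edges_to:
  assumes "w \<in> candidates N st"
  shows "card (edges_to d N st w) = (N - Suc t - 1) choose (d - 2)"
proof -
  have w: "w \<in> {1..N} - snd st" "w \<noteq> next_vertex N st" using assms candidates_subset[of N st] by auto
  have "edges_to d N st w = {e. {next_vertex N st, w} \<subseteq> e \<and> e \<subseteq> {1..N} - snd st \<and> card e = d}"
    by (auto simp: edges_to_def edges_at_def d_subsets_def)
  moreover have "card {next_vertex N st, w} = 2" using w by simp
  ultimately show ?thesis
    using card_supersets[of "{1..N} - snd st" "{next_vertex N st, w}" d] next_in w d card_unexplored by (simp add: numeral_2_eq_2)
qed

text \<open>The union is made disjoint by counting for \<open>w'\<close> only the hyperedges that
  avoid \<open>w\<close>, that is, after deleting \<open>w\<close> from the ground set.\<close>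

lemma card_edges_to_two:
  assumes "w \<in> candidates N st" "w' \<in> candidates N st" "w \<noteq> w'"
  shows "card (edges_to d N st w \<union> edges_to d N st w')
    = ((N - Suc t - 1) choose (d - 2)) + ((N - Suc (Suc t) - 1) choose (d - 2))"
proof -
  have w: "w \<in> {1..N} - snd st" "w \<noteq> next_vertex N st" "w' \<in> {1..N} - snd st" "w' \<noteq> next_vertex N st"
    using assms candidates_subset[of N st] by auto
  let ?F = "{e. {next_vertex N st, w'} \<subseteq> e \<and> e \<subseteq> {1..N} - snd st - {w} \<and> card e = d}"
  have "edges_to d N st w \<union> edges_to d N st w' = edges_to d N st w \<union> ?F"
    by (auto simp: edges_to_def edges_at_def d_subsets_def)
  moreover have "?F \<subseteq> edges_to d N st w'" by (auto simp: edges_to_def edges_at_def d_subsets_def)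
  then have "finite ?F" by (rule finite_subset) simp
  then have "card (edges_to d N st w \<union> ?F) = card (edges_to d N st w) + card ?F"
    by (intro card_Un_disjoint) (auto simp: edges_to_def)
  moreover have "card ({1..N} - snd st - {w}) = N - t - 1"
    using w(1) card_unexplored by (subst card_Diff_singleton) auto
  moreover have "card {next_vertex N st, w'} = 2" using w by simp
  ultimately show ?thesis
    using card_supersets[of "{1..N} - snd st - {w}" "{next_vertex N st, w'}" d] next_in w assms(3) d
      card_edges_to[OF assms(1)] by (simp add: numeral_2_eq_2)
qed

text \<open>Missed vertices are easier to handle than activated ones: being missed is the absence of
  a fixed family of hyperedges, so products of indicators again concern one such family.\<close>

lemma inc_eq_missed:
  assumes "H \<subseteq> d_subsets d N"
  shows "inc d N p (Suc t) st (newly_active N H st)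
    = card (candidates N st) * miss d N p (Suc t) - (\<Sum>w\<in>candidates N st. 0 ^ card (H \<inter> edges_to d N st w))"
proof -
  have "(\<Sum>w\<in>candidates N st. 0 ^ card (H \<inter> edges_to d N st w) :: real)
      = (\<Sum>w\<in>candidates N st. if w \<in> newly_active N H st then 0 else 1)"
    using newly_active_iff[OF assms] by (intro sum.cong) (auto simp: power_0_left card_eq_0_iff)
  also have "\<dots> = real (card (candidates N st - newly_active N H st))"
    by (simp add: sum.If_cases Diff_eq)
  also have "\<dots> = real (card (candidates N st)) - real (card (newly_active N H st))"
    using card_Diff_subset[OF finite_subset[OF newly_active_subset[of N H st]] newly_active_subset]
      card_mono[OF _ newly_active_subset[of N H st]] by (simp add: of_nat_diff)
  finally show ?thesis by (simp add: inc_def algebra_simps)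
qed

lemma hexp_missed:
  assumes "w \<in> candidates N st"
  shows "hexp d N p (\<lambda>H. 0 ^ card (H \<inter> edges_to d N st w)) = miss d N p (Suc t)"
  using hexp_power_card[OF p, of "edges_to d N st w" d N 0] card_edges_to[OF assms]
  by (simp add: miss_def edges_to_subset)

lemma hexp_missed_two:
  assumes "w \<in> candidates N st" "w' \<in> candidates N st" "w \<noteq> w'"
  shows "hexp d N p (\<lambda>H. 0 ^ card (H \<inter> edges_to d N st w) * 0 ^ card (H \<inter> edges_to d N st w'))
    = miss d N p (Suc t) * miss d N p (Suc (Suc t))"
proof -
  have "hexp d N p (\<lambda>H. 0 ^ card (H \<inter> edges_to d N st w) * 0 ^ card (H \<inter> edges_to d N st w'))
    = hexp d N p (\<lambda>H. 0 ^ card (H \<inter> (edges_to d N st w \<union> edges_to d N st w')))"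
    by (intro hexp_cong) (auto simp: power_0_left card_eq_0_iff)
  also have "\<dots> = (1 - p) ^ card (edges_to d N st w \<union> edges_to d N st w')"
    using hexp_power_card[OF p, of "edges_to d N st w \<union> edges_to d N st w'" d N 0] by (simp add: edges_to_subset)
  finally show ?thesis by (simp add: card_edges_to_two[OF assms] miss_def power_add)
qed

lemma hexp_inc: "hexp d N p (\<lambda>H. inc d N p (Suc t) st (newly_active N H st)) = 0"
proof -
  have "hexp d N p (\<lambda>H. inc d N p (Suc t) st (newly_active N H st)) =
    hexp d N p (\<lambda>H. card (candidates N st) * miss d N p (Suc t) - (\<Sum>w\<in>candidates N st. 0 ^ card (H \<inter> edges_to d N st w)))"
    by (intro hexp_cong inc_eq_missed)
  also have "\<dots> = card (candidates N st) * miss d N p (Suc t) - (\<Sum>w\<in>candidates N st. miss d N p (Suc t))"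
    by (simp add: hexp_sum hexp_missed)
  finally show ?thesis by simp
qed

lemma hexp_inc_square:
  "hexp d N p (\<lambda>H. (inc d N p (Suc t) st (newly_active N H st))\<^sup>2) = step_var d N p (Suc t) (card (candidates N st))"
proof -
  let ?C = "candidates N st" and ?q = "miss d N p (Suc t)" and ?q' = "miss d N p (Suc (Suc t))"
  let ?J = "\<lambda>w H. 0 ^ card (H \<inter> edges_to d N st w) :: real"
  define m where "m = real (card ?C)"
  have sq: "hexp d N p (\<lambda>H. ?J w H * ?J w H) = ?q" if "w \<in> ?C" for w
  proof -
    have "hexp d N p (\<lambda>H. ?J w H * ?J w H) = hexp d N p (?J w)"
      by (intro hexp_cong) (simp add: power_0_left)
    then show ?thesis using hexp_missed[OF that] by simp
  qed
  have second: "(\<Sum>w'\<in>?C. hexp d N p (\<lambda>H. ?J w H * ?J w' H)) = ?q + (m - 1) * (?q * ?q')" if "w \<in> ?C" for w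
  proof -
    have "(\<Sum>w'\<in>?C. hexp d N p (\<lambda>H. ?J w H * ?J w' H)) =
      hexp d N p (\<lambda>H. ?J w H * ?J w H) + (\<Sum>w'\<in>?C - {w}. hexp d N p (\<lambda>H. ?J w H * ?J w' H))"
      by (rule sum.remove) (use that in auto)
    also have "(\<Sum>w'\<in>?C - {w}. hexp d N p (\<lambda>H. ?J w H * ?J w' H)) = (\<Sum>w'\<in>?C - {w}. ?q * ?q')"
      using that by (intro sum.cong refl hexp_missed_two) auto
    also have "\<dots> = (m - 1) * (?q * ?q')"
    proof -
      have "card ?C > 0" using that card_gt_0_iff by fastforce
      then show ?thesis using that by (simp add: m_def of_nat_diff Suc_leI)
    qed
    finally show ?thesis using sq[OF that] by simp
  qed
  have "hexp d N p (\<lambda>H. (inc d N p (Suc t) st (newly_active N H st))\<^sup>2) =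
    hexp d N p (\<lambda>H. (m * ?q)\<^sup>2 - 2 * (m * ?q) * (\<Sum>w\<in>?C. ?J w H) + (\<Sum>w\<in>?C. \<Sum>w'\<in>?C. ?J w H * ?J w' H))"
  proof (intro hexp_cong)
    fix H assume H: "H \<subseteq> d_subsets d N"
    have "(\<Sum>w\<in>?C. \<Sum>w'\<in>?C. ?J w H * ?J w' H) = (\<Sum>w\<in>?C. ?J w H)\<^sup>2"
      by (simp only: power2_eq_square sum_product)
    then show "(inc d N p (Suc t) st (newly_active N H st))\<^sup>2 = (m * ?q)\<^sup>2 - 2 * (m * ?q) * (\<Sum>w\<in>?C. ?J w H)
        + (\<Sum>w\<in>?C. \<Sum>w'\<in>?C. ?J w H * ?J w' H)"
      by (simp only: inc_eq_missed[OF H] m_def[symmetric] power2_diff)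
  qed
  also have "\<dots> = (m * ?q)\<^sup>2 - 2 * (m * ?q) * (\<Sum>w\<in>?C. hexp d N p (?J w)) + (\<Sum>w\<in>?C. \<Sum>w'\<in>?C. hexp d N p (\<lambda>H. ?J w H * ?J w' H))"
    by (simp add: hexp_sum)
  also have "\<dots> = (m * ?q)\<^sup>2 - 2 * (m * ?q) * (m * ?q) + m * (?q + (m - 1) * (?q * ?q'))"
    by (simp add: hexp_missed second m_def)
  finally show ?thesis unfolding m_def[symmetric] by (simp add: step_var_def power2_eq_square algebra_simps)
qed

lemma card_newly_active_le: 
  assumes "H \<subseteq> d_subsets d N"
  shows "card (newly_active N H st) \<le> (d - 1) * card (H \<inter> edges_at d N st)"
proof -
  have "newly_active N H st \<subseteq> (\<Union>e\<in>H \<inter> edges_at d N st. e - {next_vertex N st})"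
    using assms candidates_subset[of N st] by (auto simp: newly_active_eq edges_at_def)
  then have "card (newly_active N H st) \<le> card (\<Union>e\<in>H \<inter> edges_at d N st. e - {next_vertex N st})"
    by (intro card_mono) (auto simp: edges_at_def d_subsets_def intro: finite_subset)
  also have "\<dots> \<le> (\<Sum>e\<in>H \<inter> edges_at d N st. card (e - {next_vertex N st}))"
    by (rule card_UN_le) simp
  also have "\<dots> = (\<Sum>e\<in>H \<inter> edges_at d N st. d - 1)"
    by (intro sum.cong) (auto simp: edges_at_def d_subsets_def)
  finally show ?thesis by (simp add: mult.commute)
qed

text \<open>Each hyperedge present at the selected vertex activates at most \<open>d - 1\<close>
  vertices. This reduces the claim to a binomial generating function, bounded by
  \<open>1 + x \<le> exp x\<close>.\<close>

lemma hexp_exp_newly_active: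
  fixes c :: real
  assumes "0 \<le> c"
  shows "hexp d N p (\<lambda>H. exp (c * card (newly_active N H st)))
    \<le> exp (p * ((N - t - 1) choose (d - 1)) * exp (c * (d - 1)))"
proof -
  define z where "z = exp (c * real (d - 1))"
  have "hexp d N p (\<lambda>H. exp (c * card (newly_active N H st))) \<le> hexp d N p (\<lambda>H. z ^ card (H \<inter> edges_at d N st))"
  proof (rule hexp_mono)
    fix H assume "H \<subseteq> d_subsets d N"
    then have "real (card (newly_active N H st)) \<le> real ((d - 1) * card (H \<inter> edges_at d N st))"
      using card_newly_active_le by (simp only: of_nat_le_iff)
    then have "c * card (newly_active N H st) \<le> c * (real (d - 1) * card (H \<inter> edges_at d N st))"
      using assms by (intro mult_left_mono) auto
    also have "\<dots> = card (H \<inter> edges_at d N st) * (c * real (d - 1))" by simp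
    finally have "exp (c * card (newly_active N H st)) \<le> exp (card (H \<inter> edges_at d N st) * (c * real (d - 1)))" 
      by (simp only: exp_le_cancel_iff)
    then show "exp (c * card (newly_active N H st)) \<le> z ^ card (H \<inter> edges_at d N st)" 
      unfolding z_def by (simp only: exp_of_nat_mult)
  qed
  also have "\<dots> = (1 - p + p * z) ^ card (edges_at d N st)"
    using hexp_power_card[OF p, of "edges_at d N st" d N z] by (simp add: z_def edges_at_def)
  also have "\<dots> \<le> exp (p * z) ^ card (edges_at d N st)"
  proof (rule power_mono)
    have "0 \<le> p * z" using p by (simp add: z_def)
    then show "0 \<le> 1 - p + p * z" using p by linarith
    show "1 - p + p * z \<le> exp (p * z)" using exp_ge_add_one_self[of "p * z"] p by linarith
  qed
  also have "\<dots> = exp (p * ((N - t - 1) choose (d - 1)) * z)"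
    by (simp add: exp_of_nat_mult[symmetric] card_edges_at mult_ac)
  finally show ?thesis by (simp add: z_def)
qed

end

section \<open>Conditional expectation of the increments\<close>

text \<open>Recovers the activated set from two consecutive states, so that equal trajectories have
  equal \<open>eta\<close> without any reference to the hyperedges.\<close>

lemma newly_active_explore_step: "newly_active N H st = fst (explore_step N H st) - fst st"
  by (auto simp: explore_step_eq newly_active_eq candidates_def unseen_eq)

lemma newly_active_cong:
  assumes "\<And>s. s \<le> t \<Longrightarrow> explore N k H s = explore N k H' s" "i < t"
  shows "newly_active N H (explore N k H i) = newly_active N H' (explore N k H' i)"
proof -
  have "explore N k H (Suc i) = explore N k H' (Suc i)" "explore N k H i = explore N k H' i"
    using assms(2) by (auto intro!: assms(1) simp del: explore.simps)
  then show ?thesis by (metis explore.simps(2) newly_active_explore_step)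
qed

text \<open>Agreement on the generating variables is preserved by complements and countable unions,
  so no event of the algebra separates the two hypergraphs.\<close>

lemma eta_algebra_cong:
  assumes "A \<in> sets (eta_algebra N k t)" "\<And>i. i \<in> {1..t} \<Longrightarrow> eta N k i H = eta N k i H'"
  shows "H \<in> A \<longleftrightarrow> H' \<in> A"
proof -
  have "A \<in> sigma_sets UNIV {eta N k i -` B | i B. i \<in> {1..t}}"
    using assms(1) by (simp add: eta_algebra_def)
  then show ?thesis
    by induction (use assms(2) in auto)
qed

lemma space_eta_algebra [simp]: "space (eta_algebra N k t) = UNIV"
  by (simp add: eta_algebra_def space_measure_of_conv)

lemma eta_measurable: 
  assumes "i \<in> {1..t}"
  shows "(\<lambda>H. real (eta N k i H)) \<in> borel_measurable (eta_algebra N k t)"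
proof (rule measurableI)
  fix A :: "real set"
  have "(\<lambda>H. real (eta N k i H)) -` A \<inter> space (eta_algebra N k t) = eta N k i -` (real -` A)" by auto
  also have "\<dots> \<in> sets (eta_algebra N k t)"
    using assms by (auto simp: eta_algebra_def)
  finally show "(\<lambda>H. real (eta N k i H)) -` A \<inter> space (eta_algebra N k t) \<in> sets (eta_algebra N k t)" .
qed simp

section \<open>Counts that are determined by the numbers \<open>eta\<close> alone\<close>

definition num_unseen :: "nat \<Rightarrow> nat \<Rightarrow> nat \<Rightarrow> nat set set \<Rightarrow> nat" where
  "num_unseen N k t H = card (unseen N (explore N k H t))"

definition num_cand :: "nat \<Rightarrow> nat \<Rightarrow> nat \<Rightarrow> nat set set \<Rightarrow> nat" where
  "num_cand N k t H = card (candidates N (explore N k H t))"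

lemma num_unseen_le: "k \<le> N \<Longrightarrow> t \<le> N \<Longrightarrow> num_unseen N k t H \<le> N - t"
  using valid_state_card[OF valid_explore[of k N t H]] by (simp add: num_unseen_def)

lemma num_cand_eq:
  assumes "k \<le> N" "t < N"
  shows "real (num_cand N k t H) = real (num_unseen N k t H) - (if num_unseen N k t H + t = N then 1 else 0)"
proof -
  let ?st = "explore N k H t"
  have valid: "valid_state N t ?st" using assms by (intro valid_explore) auto
  have "finite (fst ?st)" using valid by (auto simp: valid_state_def intro: finite_subset)
  then have "fst ?st = {} \<longleftrightarrow> num_unseen N k t H + t = N"
    using valid_state_card[OF valid] card_0_eq[of "fst ?st"] unfolding num_unseen_def by linarith
  then show ?thesis using card_candidates[OF valid assms(2)]
    by (auto simp: num_cand_def num_unseen_def split: if_splits)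
qed

lemma num_unseen_Suc:
  assumes "k \<le> N" "t < N"
  shows "real (num_unseen N k (Suc t) H) = real (num_cand N k t H) - real (eta N k (Suc t) H)"
proof -
  let ?st = "explore N k H t"
  have valid: "valid_state N t ?st" using assms by (intro valid_explore) auto
  have "card (candidates N ?st - newly_active N H ?st) = card (candidates N ?st) - card (newly_active N H ?st)"
    by (rule card_Diff_subset) (auto intro: finite_subset[OF newly_active_subset] newly_active_subset[THEN subsetD])
  moreover have "card (newly_active N H ?st) \<le> card (candidates N ?st)"
    by (intro card_mono newly_active_subset) simp
  ultimately show ?thesis
    using unseen_step[OF valid assms(2)] by (simp add: num_unseen_def num_cand_def eta_def of_nat_diff)
qed

text \<open>The numbers \<open>eta\<close> need not determine which vertices are active, but they
  determine how many: whether a restart occurs can be read off from the count itself, so the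
  recursion closes on counts.\<close>

lemma num_unseen_measurable:
  assumes "k \<le> N" "t < N" "s \<le> t"
  shows "(\<lambda>H. real (num_unseen N k s H)) \<in> borel_measurable (eta_algebra N k t)"
  using assms(3)
proof (induction s)
  case (Suc s)
  have eq: "(\<lambda>H. real (num_unseen N k (Suc s) H)) =
    (\<lambda>H. real (num_unseen N k s H) - (if real (num_unseen N k s H) + real s = real N then 1 else 0) - real (eta N k (Suc s) H))"
    using num_unseen_Suc[of k N s] num_cand_eq[of k N s] assms Suc.prems by (auto simp flip: of_nat_add)
  have [measurable]: "(\<lambda>H. real (num_unseen N k s H)) \<in> borel_measurable (eta_algebra N k t)"
    using Suc by simp
  have [measurable]: "(\<lambda>H. real (eta N k (Suc s) H)) \<in> borel_measurable (eta_algebra N k t)"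
    using Suc.prems by (intro eta_measurable) auto
  show ?case unfolding eq by measurable
qed (simp add: num_unseen_def)

lemma num_cand_measurable:
  assumes "k \<le> N" "t < N"
  shows "(\<lambda>H. real (num_cand N k t H)) \<in> borel_measurable (eta_algebra N k t)"
proof -
  have eq: "(\<lambda>H. real (num_cand N k t H)) =
    (\<lambda>H. real (num_unseen N k t H) - (if real (num_unseen N k t H) + real t = real N then 1 else 0))"
    using num_cand_eq[OF assms] by (auto simp flip: of_nat_add)
  note [measurable] = num_unseen_measurable[OF assms order_refl]
  show ?thesis unfolding eq by measurable
qed

text \<open>\<open>incr t\<close> is the increment \<open>\<Delta>\<close> of step \<open>t + 1\<close>.\<close>

definition incr :: "nat \<Rightarrow> nat \<Rightarrow> real \<Rightarrow> nat \<Rightarrow> nat \<Rightarrow> nat set set \<Rightarrow> real" where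
  "incr d N p k t H = inc d N p (Suc t) (explore N k H t) (newly_active N H (explore N k H t))"

lemma incr_eq: "incr d N p k t H = real (eta N k (Suc t) H) - real (num_cand N k t H) * (1 - miss d N p (Suc t))"
  by (simp add: incr_def inc_def eta_def num_cand_def)

lemma incr_cong:
  assumes "\<And>s. s \<le> t \<Longrightarrow> explore N k H s = explore N k H' s" "i < t"
  shows "incr d N p k i H = incr d N p k i H'"
  using newly_active_cong[OF assms] assms(1)[of i] assms(2) by (simp add: incr_def)

text \<open>Given the whole trajectory, the mean of \<open>eta\<close> is
  \<open>num_cand * (1 - miss)\<close>. This is already measurable for the coarser algebra of
  counts, hence it is the conditional expectation there too, up to a null set.\<close>

lemma Delta_eq_incr:
  assumes "2 \<le> d" "0 \<le> p" "p \<le> 1" "k \<le> N" "Suc t < N"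
  shows "AE H in measure_pmf (random_hypergraph d N p). Delta d N p k (Suc t) H = incr d N p k t H"
proof -
  let ?M = "measure_pmf (random_hypergraph d N p)" and ?F = "eta_algebra N k t"
  have "finite_measure_subalgebra ?M ?F"
    by unfold_locales (auto simp: subalgebra_def)
  then interpret finite_measure_subalgebra ?M ?F .
  let ?g = "\<lambda>H. real (num_cand N k t H) * (1 - miss d N p (Suc t))"
  have "AE H in ?M. real_cond_exp ?M ?F (\<lambda>H'. real (eta N k (Suc t) H')) H = ?g H"
  proof (rule real_cond_exp_charact)
    fix A assume A: "A \<in> sets ?F"
    \<comment> \<open>Membership in \<open>A\<close> depends only on the counts up to
      \<open>t\<close>, hence on the trajectory up to \<open>t\<close>; averaging over a fresh
      hypergraph then gives 0 by \<open>hexp_inc\<close>.\<close>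
    have "hexp d N p (\<lambda>H. indicator A H * incr d N p k t H) =
      hexp d N p (\<lambda>H. hexp d N p (\<lambda>H'. indicator A H * inc d N p (Suc t) (explore N k H t) (newly_active N H' (explore N k H t))))"
      unfolding incr_def
    proof (rule hexp_explore_step[where g = "\<lambda>H B. indicator A H * inc d N p (Suc t) (explore N k H t) B"])
      fix H H' B assume eq: "\<And>s. s \<le> t \<Longrightarrow> explore N k H s = explore N k H' s"
      have "H \<in> A \<longleftrightarrow> H' \<in> A"
      proof (rule eta_algebra_cong[OF A])
        fix i assume i: "i \<in> {1..t}"
        then have "i - 1 < t" by auto
        show "eta N k i H = eta N k i H'"
          unfolding eta_def using newly_active_cong[OF eq \<open>i - 1 < t\<close>] by simp
      qed
      then show "indicator A H * inc d N p (Suc t) (explore N k H t) B = indicator A H' * inc d N p (Suc t) (explore N k H' t) B"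
        using eq[of t] by (simp add: indicator_def)
    qed
    also have "\<dots> = 0"
      using assms valid_explore[of k N t] by (simp add: hexp_inc)
    finally have "hexp d N p (\<lambda>H. indicator A H * real (eta N k (Suc t) H) - indicator A H * ?g H) = 0"
      by (simp add: incr_eq algebra_simps)
    then have "hexp d N p (\<lambda>H. indicator A H * real (eta N k (Suc t) H)) = hexp d N p (\<lambda>H. indicator A H * ?g H)"
      by (subst (asm) Bochner_Integration.integral_diff) simp_all
    then show "(\<integral>H\<in>A. real (eta N k (Suc t) H) \<partial>?M) = (\<integral>H\<in>A. ?g H \<partial>?M)"
      by (simp only: set_lebesgue_integral_def real_scaleR_def)
  next
    show "?g \<in> borel_measurable ?F"
      using num_cand_measurable[of k N t] assms by (intro borel_measurable_times) auto
  qed simp_all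
  then show ?thesis
    by (rule AE_mp) (auto simp: Delta_def incr_eq)
qed

lemma S_mart_eq_incr:
  assumes "2 \<le> d" "0 \<le> p" "p \<le> 1" "k \<le> N" "t < N"
  shows "AE H in measure_pmf (random_hypergraph d N p).
    S_mart d N p k t H = (\<Sum>i<t. incr d N p k i H / beta d N p (Suc i))"
proof -
  have "AE H in measure_pmf (random_hypergraph d N p). \<forall>i\<in>{..<t}. Delta d N p k (Suc i) H = incr d N p k i H"
    using assms by (intro AE_finite_allI Delta_eq_incr) auto
  then show ?thesis
    by (rule AE_mp) (auto simp: S_mart_def sum.atLeast1_atMost_eq intro!: AE_I2 sum.cong)
qed

section \<open>Exponential moments\<close>

lemma choose_le_power_div_fact: "real (n choose j) \<le> real n ^ j / fact j"
proof -
  have "(n choose j) * fact j \<le> n ^ j" by (metis binomial_fact_pow)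
  then have "real ((n choose j) * fact j) \<le> real (n ^ j)" by (rule of_nat_mono)
  then show ?thesis by (simp add: field_simps)
qed

lemma exp_minus_taylor3: "\<bar>exp x - 1 - x - x\<^sup>2 / 2\<bar> \<le> \<bar>x\<bar> ^ 3 * exp \<bar>x\<bar>" for x :: real
proof -
  obtain t where t: "\<bar>t\<bar> \<le> \<bar>x\<bar>" "exp x = (\<Sum>m<3. x ^ m / fact m) + exp t / fact 3 * x ^ 3"
    using Maclaurin_exp_le[of x 3] by auto
  have "\<bar>exp x - 1 - x - x\<^sup>2 / 2\<bar> = \<bar>x\<bar> ^ 3 * (exp t / 6)"
    unfolding t(2) by (simp add: numeral_3_eq_3 abs_mult power_abs power2_eq_square fact_numeral)
  also have "\<dots> \<le> \<bar>x\<bar> ^ 3 * exp \<bar>x\<bar>"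
  proof -
    have "exp t \<le> exp \<bar>x\<bar>" using t(1) by simp
    then show ?thesis using exp_gt_zero[of t] by (intro mult_left_mono zero_le_power abs_ge_zero) linarith
  qed
  finally show ?thesis .
qed

lemma power_le_exp: 
  fixes y :: real 
  assumes "0 \<le> y" 
  shows "y ^ j \<le> fact j * exp y"
proof -
  have "y ^ j / fact j = (\<Sum>m\<in>{j}. y ^ m / fact m)" by simp
  also have "\<dots> \<le> (\<Sum>m. y ^ m / fact m)"
    using assms summable_exp[of y] by (intro sum_le_suminf) (auto simp: field_simps)
  also have "\<dots> = exp y" by (simp add: exp_def field_simps)
  finally show ?thesis by (simp add: field_simps)
qed

text \<open>The first bound is Bernoulli's inequality. The second follows from \<open>(1 - p) ^ n
  \<le> exp (- a) \<le> 1 / (1 + a) \<le> 1 - a + a\<^sup>2\<close> with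
  \<open>a = p * n\<close>.\<close>

lemma one_minus_power_bounds:
  fixes p :: real
  assumes "0 \<le> p" "p \<le> 1"
  shows "1 - (1 - p) ^ n \<le> p * n" and "p * n - (p * n)\<^sup>2 \<le> 1 - (1 - p) ^ n"
proof -
  show "1 - (1 - p) ^ n \<le> p * n"
    using Bernoulli_inequality[of "- p" n] assms by (simp add: mult.commute)
  let ?a = "p * n"
  have a: "0 \<le> ?a" using assms by simp
  have "1 - p \<le> exp (- p)" using exp_ge_add_one_self[of "- p"] by simp
  then have "(1 - p) ^ n \<le> exp (- p) ^ n"
    using assms by (intro power_mono) auto
  also have "\<dots> = exp (- ?a)"
    by (simp add: exp_of_nat_mult[symmetric] mult.commute)
  also have "\<dots> = 1 / exp ?a" by (simp add: exp_minus field_simps)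
  also have "\<dots> \<le> 1 / (1 + ?a)"
    using a by (intro divide_left_mono exp_ge_add_one_self) (auto intro: add_pos_nonneg)
  also have "\<dots> \<le> 1 - ?a + ?a\<^sup>2"
  proof -
    have "(1 - ?a + ?a\<^sup>2) * (1 + ?a) = 1 + ?a ^ 3" by (simp add: power2_eq_square power3_eq_cube algebra_simps)
    then have "1 \<le> (1 - ?a + ?a\<^sup>2) * (1 + ?a)" using a by simp
    then show ?thesis using a by (simp add: divide_le_eq)
  qed
  finally show "?a - ?a\<^sup>2 \<le> 1 - (1 - p) ^ n" by simp
qed

text \<open>A bound, uniform in \<open>N\<close> and in the state, for the expectation of
  \<open>exp (2 * \<bar>x\<bar>)\<close> of an increment \<open>x\<close>:
  \<open>exp (2 * lam)\<close> pays for the centring, the rest for \<open>d - 1\<close> vertices per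
  hyperedge with at most \<open>lam\<close> hyperedges expected.\<close>

definition mgf_bound :: "nat \<Rightarrow> real \<Rightarrow> real" where
  "mgf_bound d lam = exp (2 * lam + lam * exp (2 * real (d - 1)))"

text \<open>The conditional moment generating function: it depends on \<open>H\<close> only through
  the state at time \<open>t\<close>, while the next step is drawn from \<open>H'\<close>.\<close>

definition step_mgf :: "nat \<Rightarrow> nat \<Rightarrow> real \<Rightarrow> nat \<Rightarrow> real \<Rightarrow> nat \<Rightarrow> nat set set \<Rightarrow> real" where
  "step_mgf d N p k h t H = hexp d N p (\<lambda>H'. exp (h * inc d N p (Suc t) (explore N k H t) (newly_active N H' (explore N k H t))))"

text \<open>One fixed, sufficiently large \<open>N\<close>. The bound
  \<open>2 * lam \<le> real N\<close> yields \<open>a_coeff \<le> 1 / 2\<close>, hence positive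
  \<open>beta\<close>, and together with \<open>d \<le> N\<close> also
  \<open>p \<le> 1\<close>.\<close>

locale exploration =
  fixes d N k :: nat and lam p :: real
  assumes d2: "2 \<le> d" and dN: "d \<le> N" and lam0: "0 < lam" and lamN: "2 * lam \<le> real N"
    and kN: "k \<le> N" and p_eq: "p = lam * fact (d - 2) / real N ^ (d - 1)"
begin

abbreviation "K \<equiv> mgf_bound d lam"

lemma K_ge1: "1 \<le> K"
  using lam0 by (simp add: mgf_bound_def)

lemma N_pos: "0 < real N"
  using d2 dN by simp

lemma N_power: "real N ^ (d - 1) = real N * real N ^ (d - 2)"
proof -
  have "d - 1 = Suc (d - 2)" using d2 by simp
  then show ?thesis by (simp only: power_Suc)
qed

lemma p_nonneg: "0 \<le> p"
  using lam0 by (simp add: p_eq)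

lemma p_choose_le:
  assumes "n \<le> N"
  shows "p * real (n choose j) \<le> lam * fact (d - 2) / fact j * (real N ^ j / real N ^ (d - 1))"
proof -
  have "real (n choose j) \<le> real n ^ j / fact j" by (rule choose_le_power_div_fact)
  also have "\<dots> \<le> real N ^ j / fact j" using assms by (intro divide_right_mono power_mono) auto
  finally have "p * real (n choose j) \<le> p * (real N ^ j / fact j)" using p_nonneg by (rule mult_left_mono)
  then show ?thesis by (simp add: p_eq mult_ac)
qed

lemma a_le: "a_coeff d N p t \<le> lam / N"
  using p_choose_le[of "N - t - 1" "d - 2"] N_pos unfolding a_coeff_def N_power by simp

lemma a_nonneg: "0 \<le> a_coeff d N p t"
  using p_nonneg by (simp add: a_coeff_def)

lemma lam_N_le: "lam / N \<le> 1 / 2"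
  using lamN N_pos by (simp add: field_simps)

lemma a_le_half: "a_coeff d N p t \<le> 1 / 2"
  using a_le[of t] lam_N_le by linarith

lemma p_edges_le: "p * real ((N - t - 1) choose (d - 1)) \<le> lam"
proof -
  have "p * real ((N - t - 1) choose (d - 1)) \<le> lam * (fact (d - 2) / fact (d - 1))"
    using p_choose_le[of "N - t - 1" "d - 1"] N_pos by simp
  also have "\<dots> \<le> lam * 1"
    using lam0 fact_mono[of "d - 2" "d - 1", where 'a = real] by (intro mult_left_mono) (auto simp: field_simps)
  finally show ?thesis by simp
qed

lemma p_le_1: "p \<le> 1"
proof -
  have "fact (d - 2) \<le> (real (d - 2)) ^ (d - 2)" by (metis fact_le_power le_refl of_nat_power)
  also have "\<dots> \<le> real N ^ (d - 2)" using dN by (intro power_mono) auto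
  finally have "p \<le> lam * real N ^ (d - 2) / real N ^ (d - 1)"
    unfolding p_eq using lam0 by (intro divide_right_mono mult_left_mono) auto
  also have "\<dots> = lam / N" unfolding N_power using N_pos by simp
  finally show ?thesis using lam_N_le by linarith
qed

lemma miss_nonneg: "0 \<le> miss d N p t"
  using p_le_1 by (simp add: miss_def)

lemma miss_le_1: "miss d N p t \<le> 1"
  using p_nonneg p_le_1 by (simp add: miss_def power_le_one)

lemma miss_ge: "1 - a_coeff d N p t \<le> miss d N p t"
  using one_minus_power_bounds(1)[OF p_nonneg p_le_1, of "(N - t - 1) choose (d - 2)"]
  by (simp add: miss_def a_coeff_def)

lemma miss_le: "miss d N p t \<le> 1 - a_coeff d N p t + (a_coeff d N p t)\<^sup>2"
  using one_minus_power_bounds(2)[OF p_nonneg p_le_1, of "(N - t - 1) choose (d - 2)"]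
  by (simp add: miss_def a_coeff_def)

context
  fixes t :: nat and st :: "nat set \<times> nat set"
  assumes valid: "valid_state N t st" and t: "Suc t < N"
begin

abbreviation "\<xi> H \<equiv> inc d N p (Suc t) st (newly_active N H st)"
abbreviation "v \<equiv> step_var d N p (Suc t) (card (candidates N st))"

lemma cand_mean_le: "real (card (candidates N st)) * (1 - miss d N p (Suc t)) \<le> lam"
proof -
  have "1 - miss d N p (Suc t) \<le> lam / N" using miss_ge[of "Suc t"] a_le[of "Suc t"] by linarith
  then have "real (card (candidates N st)) * (1 - miss d N p (Suc t)) \<le> N * (lam / N)"
    using card_candidates_le[of N st] miss_le_1[of "Suc t"] by (intro mult_mono) auto
  then show ?thesis using N_pos by simp
qed

text \<open>The centring term is at most \<open>lam\<close>, because a candidate is hit with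
  probability at most \<open>lam / N\<close>. The factor 2 in the exponent is reserved for
  \<open>mgf_expansion\<close>: one \<open>exp\<close> for the power, one for the tilt.\<close>

lemma hexp_exp_abs_inc: "hexp d N p (\<lambda>H. exp (2 * \<bar>\<xi> H\<bar>)) \<le> K"
proof -
  have "hexp d N p (\<lambda>H. exp (2 * \<bar>\<xi> H\<bar>)) \<le> hexp d N p (\<lambda>H. exp (2 * lam) * exp (2 * real (card (newly_active N H st))))"
  proof (rule hexp_mono)
    fix H
    have "0 \<le> real (card (candidates N st)) * (1 - miss d N p (Suc t))" using miss_le_1[of "Suc t"] by simp
    then have "\<bar>\<xi> H\<bar> \<le> lam + real (card (newly_active N H st))"
      using cand_mean_le unfolding inc_def by linarith
    then show "exp (2 * \<bar>\<xi> H\<bar>) \<le> exp (2 * lam) * exp (2 * real (card (newly_active N H st)))"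
      by (simp flip: exp_add)
  qed
  also have "\<dots> = exp (2 * lam) * hexp d N p (\<lambda>H. exp (2 * real (card (newly_active N H st))))"
    by simp
  also have "hexp d N p (\<lambda>H. exp (2 * real (card (newly_active N H st)))) \<le> exp (lam * exp (2 * real (d - 1)))"
  proof -
    have "hexp d N p (\<lambda>H. exp (2 * real (card (newly_active N H st))))
      \<le> exp (p * real ((N - t - 1) choose (d - 1)) * exp (2 * real (d - 1)))"
      by (rule hexp_exp_newly_active[OF d2 p_nonneg p_le_1 valid t]) simp
    also have "\<dots> \<le> exp (lam * exp (2 * real (d - 1)))"
      using p_edges_le[of t] by (simp add: mult_right_mono)
    finally show ?thesis .
  qed
  finally show ?thesis by (simp add: mgf_bound_def exp_add)
qed

text \<open>The linear term vanishes as the increment is centred, the quadratic one is the explicit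
  variance, and the cubic Taylor remainder is integrated against the uniform exponential
  moment.\<close>

lemma mgf_expansion:
  assumes "\<bar>h\<bar> \<le> 1"
  shows "\<bar>hexp d N p (\<lambda>H. exp (h * \<xi> H)) - 1 - h\<^sup>2 * v / 2\<bar> \<le> 6 * K * \<bar>h\<bar> ^ 3"
proof -
  have "hexp d N p (\<lambda>H. exp (h * \<xi> H) - 1 - h * \<xi> H - (h * \<xi> H)\<^sup>2 / 2) =
    hexp d N p (\<lambda>H. exp (h * \<xi> H)) - 1 - h * hexp d N p \<xi> - h\<^sup>2 * hexp d N p (\<lambda>H. (\<xi> H)\<^sup>2) / 2"
    by (simp add: power_mult_distrib)
  also have "\<dots> = hexp d N p (\<lambda>H. exp (h * \<xi> H)) - 1 - h\<^sup>2 * v / 2"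
    using hexp_inc[OF d2 p_nonneg p_le_1 valid t] hexp_inc_square[OF d2 p_nonneg p_le_1 valid t] by simp
  finally have eq: "hexp d N p (\<lambda>H. exp (h * \<xi> H)) - 1 - h\<^sup>2 * v / 2 =
    hexp d N p (\<lambda>H. exp (h * \<xi> H) - 1 - h * \<xi> H - (h * \<xi> H)\<^sup>2 / 2)" ..
  have "\<bar>hexp d N p (\<lambda>H. exp (h * \<xi> H) - 1 - h * \<xi> H - (h * \<xi> H)\<^sup>2 / 2)\<bar>
      \<le> hexp d N p (\<lambda>H. \<bar>exp (h * \<xi> H) - 1 - h * \<xi> H - (h * \<xi> H)\<^sup>2 / 2\<bar>)"
    by (rule integral_abs_bound)
  also have "\<dots> \<le> hexp d N p (\<lambda>H. (6 * \<bar>h\<bar> ^ 3) * exp (2 * \<bar>\<xi> H\<bar>))"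
  proof (rule hexp_mono)
    fix H
    define y where "y = \<bar>\<xi> H\<bar>"
    have y: "0 \<le> y" by (simp add: y_def)
    have "\<bar>exp (h * \<xi> H) - 1 - h * \<xi> H - (h * \<xi> H)\<^sup>2 / 2\<bar> \<le> \<bar>h * \<xi> H\<bar> ^ 3 * exp \<bar>h * \<xi> H\<bar>"
      by (rule exp_minus_taylor3)
    also have "\<dots> = \<bar>h\<bar> ^ 3 * (y ^ 3 * exp (\<bar>h\<bar> * y))" by (simp add: abs_mult power_mult_distrib y_def)
    \<comment> \<open>Here \<open>6 = 3!\<close> comes from the exponential series, and
      \<open>\<bar>h\<bar> \<le> 1\<close> bounds the second factor.\<close>
    also have "\<dots> \<le> \<bar>h\<bar> ^ 3 * ((6 * exp y) * exp y)"
    proof -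
      have 1: "y ^ 3 \<le> 6 * exp y" using power_le_exp[OF y, of 3] by (simp add: fact_numeral)
      have 2: "exp (\<bar>h\<bar> * y) \<le> exp y"
        using mult_right_mono[OF assms y] by (simp only: exp_le_cancel_iff mult_1_left)
      have "0 \<le> 6 * exp y" using exp_ge_zero[of y] by linarith
      from mult_mono[OF 1 2 this exp_ge_zero] show ?thesis
        by (rule mult_left_mono) (rule zero_le_power, rule abs_ge_zero)
    qed
    also have "\<dots> = (6 * \<bar>h\<bar> ^ 3) * exp (2 * y)" by (simp add: exp_double power2_eq_square)
    finally show "\<bar>exp (h * \<xi> H) - 1 - h * \<xi> H - (h * \<xi> H)\<^sup>2 / 2\<bar> \<le> (6 * \<bar>h\<bar> ^ 3) * exp (2 * \<bar>\<xi> H\<bar>)"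
      by (simp add: y_def)
  qed
  also have "\<dots> = (6 * \<bar>h\<bar> ^ 3) * hexp d N p (\<lambda>H. exp (2 * \<bar>\<xi> H\<bar>))" by simp
  also have "\<dots> \<le> (6 * \<bar>h\<bar> ^ 3) * K" by (intro mult_left_mono hexp_exp_abs_inc) simp
  finally show ?thesis unfolding eq by (simp add: mult_ac)
qed

lemma step_var_bounds: "0 \<le> v" "v \<le> 2 * K"
proof -
  have v: "v = hexp d N p (\<lambda>H. (\<xi> H)\<^sup>2)"
    using hexp_inc_square[OF d2 p_nonneg p_le_1 valid t] by simp
  show "0 \<le> v" unfolding v by simp
  have "v \<le> hexp d N p (\<lambda>H. 2 * exp (2 * \<bar>\<xi> H\<bar>))" unfolding v
  proof (rule hexp_mono)
    fix H
    have "\<bar>\<xi> H\<bar>\<^sup>2 \<le> 2 * exp \<bar>\<xi> H\<bar>" using power_le_exp[of "\<bar>\<xi> H\<bar>" 2] by (simp add: fact_numeral)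
    also have "\<dots> \<le> 2 * exp (2 * \<bar>\<xi> H\<bar>)" by simp
    finally show "(\<xi> H)\<^sup>2 \<le> 2 * exp (2 * \<bar>\<xi> H\<bar>)" by simp
  qed
  also have "\<dots> \<le> 2 * K" using hexp_exp_abs_inc by simp
  finally show "v \<le> 2 * K" .
qed

text \<open>Jensen's inequality for a centred variable. It makes all logarithms of these functions
  nonnegative, which controls the bad event in \<open>hexp_exp_sandwich\<close>.\<close>

lemma mgf_ge_1: "1 \<le> hexp d N p (\<lambda>H. exp (h * \<xi> H))"
proof -
  have "1 = hexp d N p (\<lambda>H. 1 + h * \<xi> H)"
    using hexp_inc[OF d2 p_nonneg p_le_1 valid t] by simp
  also have "\<dots> \<le> hexp d N p (\<lambda>H. exp (h * \<xi> H))"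
    by (intro hexp_mono exp_ge_add_one_self)
  finally show ?thesis .
qed

lemma mgf_le_add:
  assumes "\<bar>h\<bar> \<le> 1"
  shows "hexp d N p (\<lambda>H. exp (h * \<xi> H)) \<le> 1 + 7 * K * h\<^sup>2"
proof -
  have "hexp d N p (\<lambda>H. exp (h * \<xi> H)) \<le> 1 + h\<^sup>2 * v / 2 + 6 * K * \<bar>h\<bar> ^ 3"
    using mgf_expansion[OF assms] by linarith
  moreover have "h\<^sup>2 * v \<le> h\<^sup>2 * (2 * K)" using step_var_bounds by (intro mult_left_mono) auto
  moreover have "6 * K * \<bar>h\<bar> ^ 3 \<le> 6 * K * h\<^sup>2"
    using assms K_ge1 power_decreasing[of 2 3 "\<bar>h\<bar>"] by (intro mult_left_mono) auto
  ultimately show ?thesis by (simp add: algebra_simps)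
qed

lemma mgf_le:
  assumes "\<bar>h\<bar> \<le> 1"
  shows "hexp d N p (\<lambda>H. exp (h * \<xi> H)) \<le> exp (7 * K * h\<^sup>2)"
  using mgf_le_add[OF assms] exp_ge_add_one_self[of "7 * K * h\<^sup>2"] by linarith

text \<open>The constant is \<open>55 = 7\<^sup>2 + 6\<close>: the square of the bound
  \<open>7 * K * h\<^sup>2\<close> from expanding the logarithm, and the error of
  \<open>mgf_expansion\<close>. The second hypothesis keeps the argument of
  \<open>ln (1 + z)\<close> within \<open>z \<le> 1\<close>.\<close>

lemma ln_mgf_approx:
  assumes h: "\<bar>h\<bar> \<le> 1" "7 * K * h\<^sup>2 \<le> 1"
  shows "\<bar>ln (hexp d N p (\<lambda>H. exp (h * \<xi> H))) - h\<^sup>2 * v / 2\<bar> \<le> 55 * K\<^sup>2 * \<bar>h\<bar> ^ 3"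
proof -
  define z where "z = hexp d N p (\<lambda>H. exp (h * \<xi> H)) - 1"
  have z: "0 \<le> z" "z \<le> 7 * K * h\<^sup>2" using mgf_ge_1[of h] mgf_le_add[OF h(1)] by (simp_all add: z_def)
  have "\<bar>ln (1 + z) - z\<bar> \<le> z\<^sup>2"
    using z h by (intro abs_ln_one_plus_x_minus_x_bound_nonneg) auto
  also have "\<dots> \<le> (7 * K * h\<^sup>2)\<^sup>2" using z by (intro power_mono)
  also have "\<dots> = 49 * K\<^sup>2 * \<bar>h\<bar> ^ 4" by (simp add: power_mult_distrib flip: power_mult)
  also have "\<dots> \<le> 49 * K\<^sup>2 * \<bar>h\<bar> ^ 3"
    using h power_decreasing[of 3 4 "\<bar>h\<bar>"] by (intro mult_left_mono) auto
  finally have 1: "\<bar>ln (1 + z) - z\<bar> \<le> 49 * K\<^sup>2 * \<bar>h\<bar> ^ 3" .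
  have "\<bar>z - h\<^sup>2 * v / 2\<bar> \<le> 6 * K * \<bar>h\<bar> ^ 3" using mgf_expansion[OF h(1)] by (simp add: z_def)
  also have "\<dots> \<le> 6 * K\<^sup>2 * \<bar>h\<bar> ^ 3"
    using K_ge1 self_le_power[of K 2] by (intro mult_right_mono mult_left_mono) auto
  finally have "\<bar>ln (1 + z) - h\<^sup>2 * v / 2\<bar> \<le> 49 * K\<^sup>2 * \<bar>h\<bar> ^ 3 + 6 * K\<^sup>2 * \<bar>h\<bar> ^ 3"
    using 1 by linarith
  then show ?thesis by (simp add: z_def algebra_simps)
qed

end

abbreviation "mgf \<equiv> step_mgf d N p k"

lemma valid_explore': "Suc t < N \<Longrightarrow> valid_state N t (explore N k H t)"
  using kN by (intro valid_explore) auto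

lemma step_mgf_cong: "explore N k H t = explore N k H' t \<Longrightarrow> mgf h t H = mgf h t H'"
  by (simp add: step_mgf_def)

text \<open>The last step is averaged over a fresh hypergraph, its moment generating function is
  bounded uniformly in the state, and the remaining sum is treated by induction.\<close>

lemma hexp_exp_sum_le:
  assumes "n < N" "\<And>i. i < n \<Longrightarrow> \<bar>w i\<bar> \<le> 1"
  shows "hexp d N p (\<lambda>H. exp (\<Sum>i<n. w i * incr d N p k i H)) \<le> exp (7 * K * (\<Sum>i<n. (w i)\<^sup>2))"
  using assms
proof (induction n)
  case (Suc n)
  let ?S = "\<lambda>H. exp (\<Sum>i<n. w i * incr d N p k i H)"
  have "hexp d N p (\<lambda>H. exp (\<Sum>i<Suc n. w i * incr d N p k i H)) =
    hexp d N p (\<lambda>H. ?S H * exp (w n * inc d N p (Suc n) (explore N k H n) (newly_active N H (explore N k H n))))"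
    by (simp add: exp_add incr_def)
  also have "\<dots> = hexp d N p (\<lambda>H. hexp d N p (\<lambda>H'. ?S H * exp (w n * inc d N p (Suc n) (explore N k H n) (newly_active N H' (explore N k H n)))))"
  proof (rule hexp_explore_step[where g = "\<lambda>H B. ?S H * exp (w n * inc d N p (Suc n) (explore N k H n) B)"])
    fix H H' B assume eq: "\<And>s. s \<le> n \<Longrightarrow> explore N k H s = explore N k H' s"
    have "(\<Sum>i<n. w i * incr d N p k i H) = (\<Sum>i<n. w i * incr d N p k i H')"
      using incr_cong[of n N k H H'] eq by (intro sum.cong) auto
    then show "?S H * exp (w n * inc d N p (Suc n) (explore N k H n) B) = ?S H' * exp (w n * inc d N p (Suc n) (explore N k H' n) B)"
      using eq[of n] by simp
  qed
  also have "\<dots> = hexp d N p (\<lambda>H. ?S H * mgf (w n) n H)"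
    by (simp add: step_mgf_def)
  also have "\<dots> \<le> hexp d N p (\<lambda>H. ?S H * exp (7 * K * (w n)\<^sup>2))"
    unfolding step_mgf_def using Suc.prems by (intro hexp_mono mult_left_mono mgf_le valid_explore') auto
  also have "\<dots> = hexp d N p ?S * exp (7 * K * (w n)\<^sup>2)" by simp
  also have "\<dots> \<le> exp (7 * K * (\<Sum>i<n. (w i)\<^sup>2)) * exp (7 * K * (w n)\<^sup>2)"
    using Suc by (intro mult_right_mono) auto
  also have "\<dots> = exp (7 * K * (\<Sum>i<Suc n. (w i)\<^sup>2))"
    by (simp add: distrib_left flip: exp_add)
  finally show ?case .
qed simp

text \<open>Each compensator depends only on the trajectory before its step, so averaging the last
  factor over a fresh hypergraph cancels it exactly.\<close>

lemma hexp_exp_martingale: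
  assumes "n < N"
  shows "hexp d N p (\<lambda>H. exp ((\<Sum>i<n. w i * incr d N p k i H) - (\<Sum>i<n. ln (mgf (w i) i H)))) = 1"
  using assms
proof (induction n)
  case (Suc n)
  let ?S = "\<lambda>H. exp ((\<Sum>i<n. w i * incr d N p k i H) - (\<Sum>i<n. ln (mgf (w i) i H)))"
  have pos: "0 < mgf (w n) n H" for H
    unfolding step_mgf_def using Suc.prems less_le_trans[OF zero_less_one mgf_ge_1[OF valid_explore']] by auto
  have "hexp d N p (\<lambda>H. exp ((\<Sum>i<Suc n. w i * incr d N p k i H) - (\<Sum>i<Suc n. ln (mgf (w i) i H)))) =
    hexp d N p (\<lambda>H. ?S H / mgf (w n) n H * exp (w n * inc d N p (Suc n) (explore N k H n) (newly_active N H (explore N k H n))))"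
    by (intro hexp_cong) (simp add: exp_add exp_diff incr_def pos)
  also have "\<dots> = hexp d N p (\<lambda>H. hexp d N p (\<lambda>H'. ?S H / mgf (w n) n H * exp (w n * inc d N p (Suc n) (explore N k H n) (newly_active N H' (explore N k H n)))))"
  proof (rule hexp_explore_step[where g = "\<lambda>H B. ?S H / mgf (w n) n H * exp (w n * inc d N p (Suc n) (explore N k H n) B)"])
    fix H H' B assume eq: "\<And>s. s \<le> n \<Longrightarrow> explore N k H s = explore N k H' s"
    have 1: "(\<Sum>i<n. w i * incr d N p k i H) = (\<Sum>i<n. w i * incr d N p k i H')"
      using incr_cong[of n N k H H'] eq by (intro sum.cong) auto
    have 2: "(\<Sum>i<n. ln (mgf (w i) i H)) = (\<Sum>i<n. ln (mgf (w i) i H'))"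
    proof (intro sum.cong refl)
      fix i assume "i \<in> {..<n}"
      then have "mgf (w i) i H = mgf (w i) i H'" by (intro step_mgf_cong eq) simp
      then show "ln (mgf (w i) i H) = ln (mgf (w i) i H')" by simp
    qed
    show "?S H / mgf (w n) n H * exp (w n * inc d N p (Suc n) (explore N k H n) B) = ?S H' / mgf (w n) n H' * exp (w n * inc d N p (Suc n) (explore N k H' n) B)"
      unfolding 1 2 using eq[of n] step_mgf_cong[OF eq[of n]] by simp
  qed
  also have "\<dots> = hexp d N p (\<lambda>H. ?S H / mgf (w n) n H * mgf (w n) n H)"
    by (simp add: step_mgf_def)
  also have "\<dots> = hexp d N p ?S" using pos by (intro hexp_cong) (simp add: less_imp_neq[symmetric])
  finally show ?case using Suc by simp
qed simp

end

section \<open>The fluid limit\<close>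

text \<open>The solution of \<open>u' = - lam * (1 - x) ^ (d - 2) * u\<close>, \<open>u 0 = 1\<close>.\<close>

definition fluid :: "nat \<Rightarrow> real \<Rightarrow> real \<Rightarrow> real" where
  "fluid d lam x = exp (- (lam / real (d - 1)) * (1 - (1 - x) ^ (d - 1)))"

text \<open>The limiting fraction of active vertices after \<open>x * N\<close> steps: what is not
  explored minus what is unseen. Its positive root is \<open>rho\<close>.\<close>

definition gap :: "nat \<Rightarrow> real \<Rightarrow> real \<Rightarrow> real" where
  "gap d lam x = 1 - x - fluid d lam x"

context
  fixes d :: nat and lam :: real
  assumes d2: "2 \<le> d" and lam1: "1 < lam"
begin

lemma fluid_deriv: "(fluid d lam has_real_derivative - (lam * (1 - x) ^ (d - 2) * fluid d lam x)) (at x)"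
proof -
  have "real (d - 1) \<noteq> 0" "d - 1 - Suc 0 = d - 2" using d2 by auto
  then show ?thesis unfolding fluid_def
    by (auto intro!: derivative_eq_intros)
qed

lemma fluid_antimono: "x \<le> y \<Longrightarrow> y \<le> 1 \<Longrightarrow> fluid d lam y \<le> fluid d lam x"
  unfolding fluid_def exp_le_cancel_iff using d2 lam1
  by (intro mult_left_mono_neg diff_left_mono power_mono) auto

lemma fluid_convex: "convex_on {0..1} (fluid d lam)"
proof (rule convex_on_realI)
  fix x y :: real assume xy: "x \<in> {0..1}" "y \<in> {0..1}" "x \<le> y"
  have "lam * (1 - y) ^ (d - 2) * fluid d lam y \<le> lam * (1 - x) ^ (d - 2) * fluid d lam x"
    using xy lam1 by (intro mult_mono fluid_antimono power_mono mult_left_mono) (auto simp: fluid_def)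
  then show "- (lam * (1 - x) ^ (d - 2) * fluid d lam x) \<le> - (lam * (1 - y) ^ (d - 2) * fluid d lam y)"
    by simp
qed (use fluid_deriv in auto)

text \<open>Convexity of \<open>fluid\<close> makes \<open>gap\<close> concave, so on a segment it
  lies above the chord between its end values.\<close>

lemma gap_pos_between:
  assumes "0 \<le> y" "y < x" "x < r" "r \<le> 1" "0 < gap d lam y" "0 \<le> gap d lam r"
  shows "0 < gap d lam x"
proof -
  define s where "s = (x - y) / (r - y)"
  have s: "0 < s" "s < 1" using assms by (auto simp: s_def divide_simps)
  have x: "x = (1 - s) * y + s * r"
  proof -
    have "s * (r - y) = x - y" using assms by (simp add: s_def)
    then show ?thesis by (simp add: algebra_simps)
  qed
  have "fluid d lam ((1 - s) *\<^sub>R y + s *\<^sub>R r) \<le> (1 - s) * fluid d lam y + s * fluid d lam r"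
    using assms s by (intro convex_onD[OF fluid_convex]) auto
  then have "gap d lam x \<ge> 1 - x - ((1 - s) * fluid d lam y + s * fluid d lam r)"
    by (simp add: gap_def x)
  also have "1 - x - ((1 - s) * fluid d lam y + s * fluid d lam r) = (1 - s) * gap d lam y + s * gap d lam r"
    unfolding x gap_def by (simp add: algebra_simps)
  finally have "(1 - s) * gap d lam y + s * gap d lam r \<le> gap d lam x" .
  moreover have "0 < (1 - s) * gap d lam y" "0 \<le> s * gap d lam r" using s assms by auto
  ultimately show ?thesis by linarith
qed

lemma gap_pos_near_0: "\<exists>e>0. \<forall>y. 0 < y \<and> y < e \<longrightarrow> 0 < gap d lam y"
proof -
  have "(gap d lam has_real_derivative lam - 1) (at 0)"
    unfolding gap_def[abs_def] by (rule derivative_eq_intros fluid_deriv refl | simp add: fluid_def)+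
  then obtain e where "e > 0" "\<And>h. 0 < h \<Longrightarrow> h < e \<Longrightarrow> gap d lam 0 < gap d lam (0 + h)"
    using DERIV_pos_inc_right[of "gap d lam" "lam - 1" 0] lam1 by auto
  moreover have "gap d lam 0 = 0" by (simp add: gap_def fluid_def)
  ultimately show ?thesis by auto
qed

lemma continuous_gap: "continuous_on A (gap d lam)"
  unfolding gap_def[abs_def] fluid_def by (intro continuous_intros)

lemma gap_pos_before_root:
  assumes "0 < x" "x < r" "r \<le> 1" "0 \<le> gap d lam r"
  shows "0 < gap d lam x"
proof -
  obtain e where e: "e > 0" "\<And>y. 0 < y \<Longrightarrow> y < e \<Longrightarrow> 0 < gap d lam y" using gap_pos_near_0 by blast
  have "0 < gap d lam (min (e / 2) (x / 2))" using e assms by (intro e(2)) auto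
  then show ?thesis using assms e(1) by (intro gap_pos_between[of "min (e / 2) (x / 2)" x r]) auto
qed

text \<open>Existence follows from the sign change between a small argument and 1. For uniqueness,
  \<open>gap\<close> is strictly positive before any root, so no root precedes another.\<close>

lemma ex1_gap_root: "\<exists>!r. 0 < r \<and> r < 1 \<and> gap d lam r = 0"
proof -
  obtain e where e: "e > 0" "\<And>y. 0 < y \<Longrightarrow> y < e \<Longrightarrow> 0 < gap d lam y" using gap_pos_near_0 by blast
  define y where "y = min (e / 2) (1 / 2)"
  have y: "0 < y" "y < 1" "0 < gap d lam y" using e by (auto simp: y_def)
  have g1: "gap d lam 1 < 0" by (simp add: gap_def fluid_def)
  then obtain r where r: "y \<le> r" "r \<le> 1" "gap d lam r = 0"
    using IVT2'[of "gap d lam" 1 0 y] y continuous_gap by auto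
  have "r \<noteq> 1" using r g1 by auto
  then have ex: "0 < r \<and> r < 1 \<and> gap d lam r = 0" using r y by auto
  have "\<not> x < z" if "0 < x \<and> x < 1 \<and> gap d lam x = 0" "0 < z \<and> z < 1 \<and> gap d lam z = 0" for x z
    using gap_pos_before_root[of x z] that by auto
  then show ?thesis using ex by (metis linorder_neqE_linordered_idom)
qed

lemma rho_root: "0 < rho d lam" "rho d lam < 1" "gap d lam (rho d lam) = 0"
proof -
  have "rho d lam = (THE r. 0 < r \<and> r < 1 \<and> gap d lam r = 0)"
    by (simp add: rho_def gap_def fluid_def)
  then show "0 < rho d lam" "rho d lam < 1" "gap d lam (rho d lam) = 0"
    using theI'[OF ex1_gap_root] by auto
qed

lemma fluid_rho: "fluid d lam (rho d lam) = 1 - rho d lam"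
  using rho_root by (simp add: gap_def)

lemma gap_bounded_below:
  assumes "0 < e"
  shows "\<exists>\<delta>>0. \<forall>x. e \<le> x \<and> x \<le> rho d lam - e \<longrightarrow> \<delta> \<le> gap d lam x"
proof (cases "e \<le> rho d lam - e")
  case True
  then obtain x where x: "x \<in> {e..rho d lam - e}" "\<And>y. y \<in> {e..rho d lam - e} \<Longrightarrow> gap d lam x \<le> gap d lam y"
    using continuous_attains_inf[of "{e..rho d lam - e}" "gap d lam"] continuous_gap by auto
  have "0 < gap d lam x" using x(1) assms rho_root by (intro gap_pos_before_root[of x "rho d lam"]) auto
  then show ?thesis using x(2) by auto
qed (auto intro!: exI[of _ 1])

text \<open>The form in which the constant arises: the squared limit of \<open>beta\<close>, times
  the telescoped diagonal part \<open>1 / beta - 1\<close> plus the telescoped covariance part, the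
  limit of \<open>N * (a_coeff 1 - a_coeff (Suc n))\<close>.\<close>

lemma c_const_eq:
  "c_const d lam = (1 - rho d lam)\<^sup>2 * (1 / (1 - rho d lam) - 1 + (lam - lam * (1 - rho d lam) ^ (d - 2)))"
proof -
  define w where "w = 1 - rho d lam"
  have w: "0 < w" using rho_root by (simp add: w_def)
  have "d - 1 = Suc (d - 2)" using d2 by simp
  then have "c_const d lam = lam * w\<^sup>2 - lam * (w * w ^ (d - 2)) * w + (1 - w) * w"
    by (simp add: c_const_def lam_star_def w_def)
  also have "\<dots> = w\<^sup>2 * (1 / w - 1 + (lam - lam * w ^ (d - 2)))"
    using w by (simp add: field_simps power2_eq_square)
  finally show ?thesis by (simp add: w_def)
qed

lemma c_const_pos: "0 < c_const d lam"
proof -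
  have "0 \<le> lam - lam * (1 - rho d lam) ^ (d - 2)"
    using rho_root lam1 power_le_one[of "1 - rho d lam" "d - 2"] by (simp add: mult_left_le)
  moreover have "0 < 1 / (1 - rho d lam) - 1" using rho_root by (simp add: field_simps)
  ultimately have "0 < 1 / (1 - rho d lam) - 1 + (lam - lam * (1 - rho d lam) ^ (d - 2))" by linarith
  then show ?thesis unfolding c_const_eq using rho_root by (intro mult_pos_pos) auto
qed

end

lemma fact_choose_ge: "j \<le> n \<Longrightarrow> (real n - real j) ^ j \<le> fact j * real (n choose j)"
proof (induction j)
  case (Suc j)
  have "(n - j) * (n choose j) = Suc j * (n choose Suc j)"
    by (metis binomial_absorb_comp binomial_absorption)
  then have "real (n - j) * real (n choose j) = real (Suc j) * real (n choose Suc j)"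
    by (metis of_nat_mult)
  then have eq: "fact (Suc j) * real (n choose Suc j) = (real n - real j) * (fact j * real (n choose j))"
    using Suc.prems by (simp add: of_nat_diff algebra_simps)
  have le: "(real n - real (Suc j)) * (real n - real (Suc j)) ^ j \<le> (real n - real j) * (fact j * real (n choose j))"
  proof (rule mult_mono)
    have "(real n - real (Suc j)) ^ j \<le> (real n - real j) ^ j" using Suc.prems by (intro power_mono) auto
    then show "(real n - real (Suc j)) ^ j \<le> fact j * real (n choose j)" using Suc by simp
  qed (use Suc.prems in auto)
  show ?case by (simp only: power_Suc eq le)
qed simp

section \<open>The weights \<open>beta\<close> compared with the fluid limit\<close>

context exploration
begin

lemma p_fact: "p / fact (d - 1) = lam / real (d - 1) / real N ^ (d - 1)"
proof -
  have "d - 1 = Suc (d - 2)" using d2 by simp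
  then have "fact (d - 1) = real (d - 1) * fact (d - 2)" by (simp add: fact_Suc)
  then show ?thesis by (simp add: p_eq)
qed

text \<open>By Pascal's rule each \<open>a_coeff\<close> is \<open>p\<close> times the decrease of a
  binomial coefficient, so the sum telescopes.\<close>

lemma sum_a: "t < N \<Longrightarrow> (\<Sum>i<t. a_coeff d N p (Suc i)) = p * real ((N - 1) choose (d - 1)) - p * real ((N - 1 - t) choose (d - 1))"
proof (induction t)
  case (Suc t)
  have "N - 1 - t = Suc (N - Suc t - 1)" "d - 1 = Suc (d - 2)" using Suc.prems d2 by auto
  then have "(N - 1 - t) choose (d - 1) = ((N - Suc t - 1) choose (d - 2)) + ((N - 1 - Suc t) choose (d - 1))"
    by simp
  then show ?case using Suc by (simp add: a_coeff_def algebra_simps)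
qed simp

lemma p_choose_bounds:
  assumes "n \<le> N"
  shows "p * real (n choose (d - 1)) \<le> lam / real (d - 1) * (real n / real N) ^ (d - 1)"
    and "d - 1 \<le> n \<Longrightarrow> lam / real (d - 1) * ((real n - real (d - 1)) / real N) ^ (d - 1) \<le> p * real (n choose (d - 1))"
proof -
  have *: "p * (y / fact (d - 1)) = lam / real (d - 1) * (y / real N ^ (d - 1))" for y
    using p_fact by (simp add: field_simps)
  have "p * real (n choose (d - 1)) \<le> p * (real n ^ (d - 1) / fact (d - 1))"
    by (intro mult_left_mono choose_le_power_div_fact p_nonneg)
  then show "p * real (n choose (d - 1)) \<le> lam / real (d - 1) * (real n / real N) ^ (d - 1)"
    unfolding * by (simp add: power_divide)
  assume "d - 1 \<le> n"
  then have "(real n - real (d - 1)) ^ (d - 1) / fact (d - 1) \<le> real (n choose (d - 1))"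
    using fact_choose_ge[of "d - 1" n] by (simp add: field_simps)
  then have "p * ((real n - real (d - 1)) ^ (d - 1) / fact (d - 1)) \<le> p * real (n choose (d - 1))"
    using p_nonneg by (rule mult_left_mono)
  then show "lam / real (d - 1) * ((real n - real (d - 1)) / real N) ^ (d - 1) \<le> p * real (n choose (d - 1))"
    unfolding * by (simp add: power_divide)
qed

text \<open>The telescoped value is the discrete counterpart of the integral of
  \<open>lam * (1 - x) ^ (d - 2)\<close>; the shift \<open>d / N\<close> covers the difference
  between falling factorials and powers.\<close>

lemma sum_a_ge:
  assumes "t < N"
  shows "lam / real (d - 1) * ((1 - real d / real N) ^ (d - 1) - (1 - real t / real N) ^ (d - 1))
    \<le> (\<Sum>i<t. a_coeff d N p (Suc i))"
proof -
  have "lam / real (d - 1) * (1 - real d / real N) ^ (d - 1) \<le> p * real ((N - 1) choose (d - 1))"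
    using p_choose_bounds(2)[of "N - 1"] dN d2 N_pos by (simp add: of_nat_diff diff_divide_distrib)
  moreover have "p * real ((N - 1 - t) choose (d - 1)) \<le> lam / real (d - 1) * (1 - real t / real N) ^ (d - 1)"
  proof -
    have "p * real ((N - 1 - t) choose (d - 1)) \<le> lam / real (d - 1) * (real (N - 1 - t) / real N) ^ (d - 1)"
      by (rule p_choose_bounds(1)) simp
    also have "\<dots> \<le> lam / real (d - 1) * (1 - real t / real N) ^ (d - 1)"
      using assms lam0 N_pos by (intro mult_left_mono power_mono) (auto simp: field_simps of_nat_diff)
    finally show ?thesis .
  qed
  ultimately show ?thesis unfolding sum_a[OF assms] right_diff_distrib by linarith
qed

lemma sum_a_le:
  assumes "t + d \<le> N"
  shows "(\<Sum>i<t. a_coeff d N p (Suc i)) \<le> lam / real (d - 1) * (1 - (1 - real t / real N - real d / real N) ^ (d - 1))"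
proof -
  have "p * real ((N - 1) choose (d - 1)) \<le> lam / real (d - 1) * 1"
  proof -
    have "p * real ((N - 1) choose (d - 1)) \<le> lam / real (d - 1) * (real (N - 1) / real N) ^ (d - 1)"
      by (rule p_choose_bounds(1)) simp
    also have "\<dots> \<le> lam / real (d - 1) * 1"
      using lam0 N_pos by (intro mult_left_mono power_le_one) (auto simp: field_simps of_nat_diff)
    finally show ?thesis .
  qed
  moreover have "lam / real (d - 1) * (1 - real t / real N - real d / real N) ^ (d - 1) \<le> p * real ((N - 1 - t) choose (d - 1))"
  proof -
    have "(real (N - 1 - t) - real (d - 1)) / real N = 1 - real t / real N - real d / real N"
      using assms d2 N_pos by (simp add: of_nat_diff field_simps)
    then show ?thesis using p_choose_bounds(2)[of "N - 1 - t"] assms d2 by auto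
  qed
  moreover have "t < N" using assms d2 by simp
  ultimately show ?thesis unfolding sum_a[OF \<open>t < N\<close>] right_diff_distrib by linarith
qed

lemma beta_altdef: "beta d N p t = (\<Prod>i<t. 1 - a_coeff d N p (Suc i))"
  by (simp add: beta_def prod.atLeast1_atMost_eq)

lemma beta_0 [simp]: "beta d N p 0 = 1"
  by (simp add: beta_def)

lemma beta_Suc: "beta d N p (Suc t) = beta d N p t * (1 - a_coeff d N p (Suc t))"
  by (simp add: beta_altdef)

lemma beta_le_exp: "beta d N p t \<le> exp (- (\<Sum>i<t. a_coeff d N p (Suc i)))"
proof -
  have "1 - x \<le> exp (- x)" for x :: real using exp_ge_add_one_self[of "- x"] by simp
  then have "beta d N p t \<le> (\<Prod>i<t. exp (- a_coeff d N p (Suc i)))"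
    unfolding beta_altdef using a_le_half by (intro prod_mono) (auto intro: order_trans[of _ "1/2"])
  then show ?thesis by (simp add: exp_sum sum_negf flip: sum_negf)
qed

text \<open>Uses \<open>ln (1 - a) \<ge> - a - 2 * a\<^sup>2\<close> for
  \<open>a \<le> 1 / 2\<close>; over at most \<open>N\<close> steps the quadratic loss is of order
  \<open>1 / N\<close>.\<close>

lemma beta_ge_exp: "exp (- (\<Sum>i<t. a_coeff d N p (Suc i)) - real t * (2 * (lam / N)\<^sup>2)) \<le> beta d N p t"
proof -
  have "exp (- a_coeff d N p i - 2 * (lam / N)\<^sup>2) \<le> 1 - a_coeff d N p i" for i
  proof -
    let ?a = "a_coeff d N p i"
    have "?a\<^sup>2 \<le> (lam / N)\<^sup>2" using a_nonneg a_le by (intro power_mono)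
    then have "- ?a - 2 * (lam / N)\<^sup>2 \<le> - ?a - 2 * ?a\<^sup>2" by simp
    also have "\<dots> \<le> ln (1 - ?a)" by (rule ln_one_minus_pos_lower_bound[OF a_nonneg a_le_half])
    finally show ?thesis using a_le_half[of i] by (subst ln_ge_iff[symmetric]) auto
  qed
  then have "(\<Prod>i<t. exp (- a_coeff d N p (Suc i) - 2 * (lam / N)\<^sup>2)) \<le> beta d N p t"
    unfolding beta_altdef by (intro prod_mono) auto
  also have "(\<Prod>i<t. exp (- a_coeff d N p (Suc i) - 2 * (lam / N)\<^sup>2)) = exp (\<Sum>i<t. - a_coeff d N p (Suc i) - 2 * (lam / N)\<^sup>2)"
    by (simp add: exp_sum)
  also have "(\<Sum>i<t. - a_coeff d N p (Suc i) - 2 * (lam / N)\<^sup>2) = - (\<Sum>i<t. a_coeff d N p (Suc i)) - real t * (2 * (lam / N)\<^sup>2)"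
    by (simp add: sum_subtractf sum_negf)
  finally show ?thesis .
qed

lemma beta_pos: "0 < beta d N p t"
  by (rule less_le_trans[OF exp_gt_zero beta_ge_exp])

lemma beta_antimono: "s \<le> t \<Longrightarrow> beta d N p t \<le> beta d N p s"
proof (induction t rule: dec_induct)
  case (step n)
  have "beta d N p (Suc n) \<le> beta d N p n * 1"
    unfolding beta_Suc using beta_pos[of n] a_nonneg by (intro mult_left_mono) auto
  then show ?case using step by simp
qed simp

lemma beta_le_1: "beta d N p t \<le> 1"
  using beta_antimono[of 0 t] by simp

text \<open>Both the sum of the \<open>a_coeff\<close> and the quadratic loss are at most
  \<open>lam\<close>. This bound on \<open>beta\<close> is the source of the factors
  \<open>exp (2 * lam)\<close> below.\<close>

lemma beta_ge:
  assumes "t \<le> N"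
  shows "exp (- 2 * lam) \<le> beta d N p t"
proof -
  have "(\<Sum>i<t. a_coeff d N p (Suc i)) \<le> (\<Sum>i<t. lam / N)" by (intro sum_mono a_le)
  also have "\<dots> = real t * (lam / N)" by simp
  also have "\<dots> \<le> N * (lam / N)" using assms lam0 by (intro mult_right_mono) auto
  finally have 1: "(\<Sum>i<t. a_coeff d N p (Suc i)) \<le> lam" using N_pos by simp
  have "(lam / N)\<^sup>2 \<le> lam / N * (1 / 2)" unfolding power2_eq_square
    using lam0 lam_N_le by (intro mult_left_mono) auto
  then have "real t * (2 * (lam / N)\<^sup>2) \<le> N * (2 * (lam / N * (1 / 2)))"
    using assms lam0 by (intro mult_mono) auto
  also have "\<dots> = lam" using N_pos by simp
  finally have "exp (- 2 * lam) \<le> exp (- (\<Sum>i<t. a_coeff d N p (Suc i)) - real t * (2 * (lam / N)\<^sup>2))"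
    using 1 unfolding exp_le_cancel_iff by linarith
  then show ?thesis using beta_ge_exp by (rule order_trans)
qed

lemma beta_le_fluid:
  assumes "t < N"
  shows "beta d N p t \<le> fluid d lam (real t / real N) * exp (lam / real (d - 1) * (1 - (1 - real d / real N) ^ (d - 1)))"
proof -
  have "beta d N p t \<le> exp (- (\<Sum>i<t. a_coeff d N p (Suc i)))" by (rule beta_le_exp)
  also have "\<dots> \<le> exp (- (lam / real (d - 1) * ((1 - real d / real N) ^ (d - 1) - (1 - real t / real N) ^ (d - 1))))"
    using sum_a_ge[OF assms] by simp
  also have "\<dots> = fluid d lam (real t / real N) * exp (lam / real (d - 1) * (1 - (1 - real d / real N) ^ (d - 1)))"
    unfolding fluid_def exp_add[symmetric] by (simp add: algebra_simps)
  finally show ?thesis .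
qed

lemma beta_ge_fluid:
  assumes "t + d \<le> N"
  shows "fluid d lam (real t / real N + real d / real N) * exp (- (2 * lam\<^sup>2 / N)) \<le> beta d N p t"
proof -
  have "real t * (2 * (lam / N)\<^sup>2) \<le> N * (2 * (lam / N)\<^sup>2)" using assms by (intro mult_right_mono) auto
  also have "\<dots> = 2 * lam\<^sup>2 / N" using N_pos by (simp add: power2_eq_square)
  finally have "fluid d lam (real t / real N + real d / real N) * exp (- (2 * lam\<^sup>2 / N))
    \<le> exp (- (\<Sum>i<t. a_coeff d N p (Suc i)) - real t * (2 * (lam / N)\<^sup>2))"
    using sum_a_le[OF assms] unfolding fluid_def exp_add[symmetric] exp_le_cancel_iff
    by (simp add: diff_diff_eq)
  then show ?thesis using beta_ge_exp by (rule order_trans)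
qed

lemma N_a_bounds:
  assumes "t + d \<le> N"
  shows "lam * (1 - real t / real N - real d / real N) ^ (d - 2) \<le> N * a_coeff d N p t"
    and "N * a_coeff d N p t \<le> lam * (1 - real t / real N) ^ (d - 2)"
proof -
  have eq: "N * a_coeff d N p t = lam * (fact (d - 2) * real ((N - t - 1) choose (d - 2)) / real N ^ (d - 2))"
    unfolding a_coeff_def p_eq N_power using N_pos by simp
  have "(1 - real t / real N - real d / real N) ^ (d - 2) = (real N - real t - real d) ^ (d - 2) / real N ^ (d - 2)"
    using N_pos by (simp add: diff_divide_distrib flip: power_divide)
  also have "\<dots> \<le> (real (N - t - 1) - real (d - 2)) ^ (d - 2) / real N ^ (d - 2)"
    using assms d2 by (intro divide_right_mono power_mono) (auto simp: of_nat_diff)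
  also have "\<dots> \<le> fact (d - 2) * real ((N - t - 1) choose (d - 2)) / real N ^ (d - 2)"
    using assms d2 by (intro divide_right_mono fact_choose_ge) auto
  finally show "lam * (1 - real t / real N - real d / real N) ^ (d - 2) \<le> N * a_coeff d N p t"
    unfolding eq using lam0 by (intro mult_left_mono) auto
  have "fact (d - 2) * real ((N - t - 1) choose (d - 2)) / real N ^ (d - 2) \<le> real (N - t - 1) ^ (d - 2) / real N ^ (d - 2)"
    using choose_le_power_div_fact[of "N - t - 1" "d - 2"] by (intro divide_right_mono) (auto simp: field_simps)
  also have "\<dots> \<le> (1 - real t / real N) ^ (d - 2)"
    unfolding power_divide[symmetric] using assms N_pos by (intro power_mono) (auto simp: field_simps of_nat_diff)
  finally show "N * a_coeff d N p t \<le> lam * (1 - real t / real N) ^ (d - 2)"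
    unfolding eq using lam0 by (intro mult_left_mono) auto
qed

end

section \<open>Trajectories on the good event\<close>

definition mart :: "nat \<Rightarrow> nat \<Rightarrow> real \<Rightarrow> nat \<Rightarrow> nat \<Rightarrow> nat set set \<Rightarrow> real" where
  "mart d N p k t H = (\<Sum>i<t. incr d N p k i H / beta d N p (Suc i))"

text \<open>Real-valued, to be summed. The equation in the body says that no vertex is active, since
  \<open>t\<close> vertices are explored at time \<open>t\<close>.\<close>

definition restart :: "nat \<Rightarrow> nat \<Rightarrow> nat \<Rightarrow> nat set set \<Rightarrow> real" where
  "restart N k t H = (if num_unseen N k t H + t = N then 1 else 0)"

lemma num_cand_eq_restart: "k \<le> N \<Longrightarrow> t < N \<Longrightarrow> real (num_cand N k t H) = real (num_unseen N k t H) - restart N k t H"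
  by (simp add: num_cand_eq restart_def)

lemma num_unseen_0: "k \<le> N \<Longrightarrow> num_unseen N k 0 H = N - k"
  using valid_state_card[OF valid_explore[of k N 0 H]] by (simp add: num_unseen_def)

lemma card_nat_less_real: "0 \<le> y \<Longrightarrow> real (card {i::nat. real i < y}) \<le> y + 1"
proof -
  assume y: "0 \<le> y"
  have "{i::nat. real i < y} \<subseteq> {..<nat \<lceil>y\<rceil>}" by (auto simp: less_ceiling_iff zless_nat_eq_int_zless)
  then have "card {i::nat. real i < y} \<le> nat \<lceil>y\<rceil>" using card_mono[of "{..<nat \<lceil>y\<rceil>}"] by fastforce
  then have "real (card {i::nat. real i < y}) \<le> real (nat \<lceil>y\<rceil>)" by (simp only: of_nat_le_iff)
  also have "\<dots> \<le> y + 1" using y by (simp add: ceiling_correct le_of_int_ceiling)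
  finally show ?thesis .
qed

lemma card_nat_between_real: 
  assumes "real t - y \<le> z" "0 \<le> z"
  shows "real (card {i::nat. y < real i \<and> i < t}) \<le> z"
proof -
  have "{i::nat. y < real i \<and> i < t} \<subseteq> {nat \<lceil>y\<rceil>..<t}" by (auto simp: ceiling_le_iff nat_le_iff)
  then have "card {i::nat. y < real i \<and> i < t} \<le> t - nat \<lceil>y\<rceil>" using card_mono[of "{nat \<lceil>y\<rceil>..<t}"] by fastforce
  then have 1: "real (card {i::nat. y < real i \<and> i < t}) \<le> real (t - nat \<lceil>y\<rceil>)" by (simp only: of_nat_le_iff)
  have "y \<le> real (nat \<lceil>y\<rceil>)" by (rule real_nat_ceiling_ge)
  have "real (t - nat \<lceil>y\<rceil>) \<le> z"
  proof (cases "nat \<lceil>y\<rceil> \<le> t")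
    case True
    then show ?thesis using assms \<open>y \<le> real (nat \<lceil>y\<rceil>)\<close> of_nat_diff[OF True, where 'a = real] by linarith
  next
    case False
    then have "t - nat \<lceil>y\<rceil> = 0" by linarith
    then show ?thesis using assms by simp
  qed
  then show ?thesis using 1 by linarith
qed

text \<open>Collects the error constants of \<open>step_var_approx\<close>; the factor
  \<open>exp (2 * lam) ^ 2\<close> comes from dividing by \<open>beta\<^sup>2\<close>.\<close>

definition var_err :: "nat \<Rightarrow> real \<Rightarrow> real" where
  "var_err d lam = exp (2 * lam) ^ 2 * (2 * lam\<^sup>2 + lam + 3 * (lam * d) + 3 * (lam\<^sup>2 * d))"

context exploration
begin

section \<open>The recursion for the unseen vertices, normalised by \<open>beta\<close>\<close>

lemma num_unseen_rec:
  assumes "Suc t < N"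
  shows "real (num_unseen N k (Suc t) H) = real (num_cand N k t H) * miss d N p (Suc t) - incr d N p k t H"
  using num_unseen_Suc[OF kN, of t H] assms by (simp add: incr_eq algebra_simps)

lemma num_cand_le: "real (num_cand N k t H) \<le> real N"
  using card_candidates_le by (simp add: num_cand_def)

lemma inverse_beta_le: "t \<le> N \<Longrightarrow> 1 / beta d N p t \<le> exp (2 * lam)"
  using divide_left_mono[OF beta_ge, of t 1] beta_pos[of t] by (simp add: exp_minus field_simps)

lemma a_square_le: "(a_coeff d N p t)\<^sup>2 \<le> lam\<^sup>2 / N / N"
  using power_mono[OF a_le[of t] a_nonneg, of 2] by (simp add: power2_eq_square)

text \<open>Dividing by \<open>beta\<close> cancels the factor \<open>1 - a_coeff\<close> exactly
  and turns the increments into \<open>mart\<close>. Only the quadratic term of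
  \<open>miss_le\<close> leaves an error; restarts lower the count and may be dropped.\<close>

lemma unseen_upper:
  assumes "t < N"
  shows "real (num_unseen N k t H) / beta d N p t \<le> N + lam\<^sup>2 * exp (2 * lam) / N * t - mart d N p k t H"
  using assms
proof (induction t)
  case 0
  then show ?case using num_unseen_le[OF kN, of 0 H] by (simp add: mart_def)
next
  case (Suc t)
  let ?m = "real (num_cand N k t H)" and ?a = "a_coeff d N p (Suc t)" and ?b = "beta d N p (Suc t)"
  have m: "0 \<le> ?m" "?m \<le> N" by (simp, rule num_cand_le)
  have mU: "?m \<le> real (num_unseen N k t H)"
    using num_cand_eq_restart[OF kN, of t H] Suc.prems by (simp add: restart_def)
  have b: "0 < ?b" "0 < beta d N p t" by (rule beta_pos)+
  have eq: "?m * (1 - ?a) / ?b = ?m / beta d N p t"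
    unfolding beta_Suc using b a_le_half[of "Suc t"] by simp
  have "?m * miss d N p (Suc t) \<le> ?m * (1 - ?a + ?a\<^sup>2)"
    using m miss_le by (intro mult_left_mono) auto
  also have "\<dots> = ?m * (1 - ?a) + ?m * ?a\<^sup>2" by (simp add: algebra_simps)
  also have "?m * ?a\<^sup>2 \<le> N * (lam\<^sup>2 / N / N)" using m a_square_le by (intro mult_mono) auto
  also have "N * (lam\<^sup>2 / N / N) = lam\<^sup>2 / N" using N_pos by simp
  finally have "?m * miss d N p (Suc t) / ?b \<le> (?m * (1 - ?a) + lam\<^sup>2 / N) / ?b"
    using b by (intro divide_right_mono) auto
  also have "\<dots> = ?m / beta d N p t + lam\<^sup>2 / N * (1 / ?b)"
    by (simp add: add_divide_distrib eq)
  also have "\<dots> \<le> real (num_unseen N k t H) / beta d N p t + lam\<^sup>2 / N * exp (2 * lam)"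
    using mU b inverse_beta_le[of "Suc t"] Suc.prems by (intro add_mono divide_right_mono mult_left_mono) auto
  also have "\<dots> \<le> N + lam\<^sup>2 * exp (2 * lam) / N * t - mart d N p k t H + lam\<^sup>2 / N * exp (2 * lam)"
    using Suc by simp
  finally have "?m * miss d N p (Suc t) / ?b \<le> N + lam\<^sup>2 * exp (2 * lam) / N * Suc t - mart d N p k t H"
    by (simp add: algebra_simps add_divide_distrib)
  then show ?case unfolding num_unseen_rec[OF Suc.prems] diff_divide_distrib by (simp add: mart_def)
qed

text \<open>In this direction \<open>miss \<ge> 1 - a_coeff\<close> leaves no quadratic error, but
  each restart removes a vertex, at a normalised cost of at most
  \<open>exp (2 * lam)\<close>.\<close>

lemma unseen_lower:
  assumes "t < N"
  shows "N - k - exp (2 * lam) * (\<Sum>i<t. restart N k i H) - mart d N p k t H \<le> real (num_unseen N k t H) / beta d N p t"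
  using assms
proof (induction t)
  case 0
  then show ?case using num_unseen_0[OF kN] kN by (simp add: mart_def)
next
  case (Suc t)
  let ?m = "real (num_cand N k t H)" and ?a = "a_coeff d N p (Suc t)" and ?b = "beta d N p (Suc t)"
  have b: "0 < ?b" "0 < beta d N p t" by (rule beta_pos)+
  have eq: "?m * (1 - ?a) / ?b = ?m / beta d N p t"
    unfolding beta_Suc using b a_le_half[of "Suc t"] by simp
  have m: "?m = real (num_unseen N k t H) - restart N k t H"
    using Suc.prems by (intro num_cand_eq_restart[OF kN]) auto
  have "restart N k t H * (1 / beta d N p t) \<le> restart N k t H * exp (2 * lam)"
    using inverse_beta_le[of t] Suc.prems by (intro mult_left_mono) (auto simp: restart_def)
  then have "N - k - exp (2 * lam) * (\<Sum>i<Suc t. restart N k i H) - mart d N p k t H \<le> ?m / beta d N p t"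
    using Suc unfolding m diff_divide_distrib by (simp add: algebra_simps)
  also have "?m / beta d N p t = ?m * (1 - ?a) / ?b" by (rule eq[symmetric])
  also have "\<dots> \<le> ?m * miss d N p (Suc t) / ?b"
    using b miss_ge by (intro divide_right_mono mult_left_mono) auto
  finally show ?case unfolding num_unseen_rec[OF Suc.prems] diff_divide_distrib by (simp add: mart_def)
qed

lemma unseen_upper':
  fixes \<delta> :: real
  assumes "t < N" "\<bar>mart d N p k t H\<bar> \<le> \<delta> * N"
  shows "real (num_unseen N k t H) \<le> N * beta d N p t + lam\<^sup>2 * exp (2 * lam) + \<delta> * N"
proof -
  have b: "0 < beta d N p t" "beta d N p t \<le> 1" by (rule beta_pos beta_le_1)+
  have "lam\<^sup>2 * exp (2 * lam) / N * t \<le> lam\<^sup>2 * exp (2 * lam) / N * N"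
    using assms by (intro mult_left_mono) auto
  then have "real (num_unseen N k t H) / beta d N p t \<le> N + (lam\<^sup>2 * exp (2 * lam) + \<delta> * N)"
    using unseen_upper[OF assms(1), of H] assms(2) N_pos by simp
  then have "real (num_unseen N k t H) \<le> (N + (lam\<^sup>2 * exp (2 * lam) + \<delta> * N)) * beta d N p t"
    using b by (simp add: divide_le_eq)
  also have "\<dots> = N * beta d N p t + (lam\<^sup>2 * exp (2 * lam) + \<delta> * N) * beta d N p t" by (simp add: algebra_simps)
  also have "(lam\<^sup>2 * exp (2 * lam) + \<delta> * N) * beta d N p t \<le> (lam\<^sup>2 * exp (2 * lam) + \<delta> * N) * 1"
  proof (rule mult_left_mono[OF b(2)])
    have "0 \<le> \<delta> * N" using assms(2) abs_ge_zero by (rule order_trans[rotated])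
    then show "0 \<le> lam\<^sup>2 * exp (2 * lam) + \<delta> * N" by simp
  qed
  finally show ?thesis by simp
qed

text \<open>At a restart all unexplored vertices are unseen, so \<open>1 - t / N\<close> is at most
  about \<open>beta\<close>, which in turn is at most about \<open>fluid\<close>.\<close>

lemma restart_gap:
  fixes \<delta> :: real
  assumes "t < N" "\<bar>mart d N p k t H\<bar> \<le> \<delta> * N" "restart N k t H \<noteq> 0"
  shows "gap d lam (t / N) \<le> \<delta> + (lam\<^sup>2 * exp (2 * lam) / N
    + (exp (lam / real (d - 1) * (1 - (1 - real d / real N) ^ (d - 1))) - 1))"
proof -
  define z where "z = exp (lam / real (d - 1) * (1 - (1 - real d / real N) ^ (d - 1)))"
  have "d / N \<le> 1" using dN N_pos by simp
  then have "1 \<le> z" using lam0 unfolding z_def one_le_exp_iff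
    by (intro mult_nonneg_nonneg) (auto intro!: power_le_one)
  have "0 \<le> lam / real (d - 1) * (1 - (1 - t / N) ^ (d - 1))"
    using lam0 assms(1) N_pos by (intro mult_nonneg_nonneg) (auto intro!: power_le_one)
  then have "fluid d lam (t / N) \<le> 1" unfolding fluid_def by (simp only: exp_le_one_iff mult_minus_left neg_le_0_iff_le)
  then have "fluid d lam (t / N) * (z - 1) \<le> 1 * (z - 1)" using \<open>1 \<le> z\<close> by (intro mult_right_mono) auto
  then have bz: "beta d N p t \<le> fluid d lam (t / N) + (z - 1)"
    using beta_le_fluid[OF assms(1)] by (simp add: z_def algebra_simps)
  have "real N - real t = real (num_unseen N k t H)"
    using assms(3) by (auto simp: restart_def split: if_splits)
  also have "\<dots> \<le> N * beta d N p t + lam\<^sup>2 * exp (2 * lam) + \<delta> * N" by (rule unseen_upper'[OF assms(1,2)])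
  finally have "(real N - real t) / N \<le> (N * beta d N p t + lam\<^sup>2 * exp (2 * lam) + \<delta> * N) / N"
    using N_pos by (intro divide_right_mono) auto
  then have "1 - t / N \<le> beta d N p t + lam\<^sup>2 * exp (2 * lam) / N + \<delta>"
    using N_pos by (simp add: add_divide_distrib diff_divide_distrib)
  then show ?thesis using bz by (simp add: gap_def z_def)
qed

text \<open>About \<open>e * N\<close> times lie before the excluded range and
  \<open>2 * e * N\<close> after it, the latter between \<open>r - e\<close> and
  \<open>r + e\<close> on the scale of \<open>N\<close>.\<close>

lemma sum_restart_le:
  fixes e r :: real
  assumes "0 < e" "t \<le> (r + e) * N"
    and no: "\<And>i. i < t \<Longrightarrow> restart N k i H \<noteq> 0 \<Longrightarrow> \<not> (e \<le> i / N \<and> i / N \<le> r - e)"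
  shows "(\<Sum>i<t. restart N k i H) \<le> 3 * e * N + 1"
proof -
  let ?A = "{i::nat. real i < e * N}" and ?B = "{i::nat. (r - e) * N < real i \<and> i < t}"
  have fin: "finite ?B" "finite ?A"
    by (auto intro: finite_subset[of _ "{..<t}"] finite_subset[of _ "{..nat \<lceil>e * N\<rceil>}"] simp: le_nat_iff less_imp_le le_ceiling_iff)
  have "(\<Sum>i<t. restart N k i H) = (\<Sum>i\<in>{i. i < t \<and> restart N k i H \<noteq> 0}. restart N k i H)"
    by (rule sum.mono_neutral_right) auto
  also have "\<dots> = real (card {i. i < t \<and> restart N k i H \<noteq> 0})"
    by (simp add: restart_def)
  also have "\<dots> \<le> real (card (?A \<union> ?B))"
  proof -
    have "{i. i < t \<and> restart N k i H \<noteq> 0} \<subseteq> ?A \<union> ?B"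
      using no N_pos by (auto simp: field_simps not_le)
    then show ?thesis using fin by (intro of_nat_mono card_mono) auto
  qed
  also have "\<dots> \<le> real (card ?A) + real (card ?B)"
    by (simp only: of_nat_add[symmetric] of_nat_le_iff card_Un_le)
  also have "real (card ?A) \<le> e * N + 1"
    using assms(1) by (intro card_nat_less_real) auto
  also have "real (card ?B) \<le> 2 * e * N"
    using assms by (intro card_nat_between_real) (auto simp: algebra_simps)
  finally show ?thesis by simp
qed

text \<open>Combines both one-sided recursions. The comparison is with \<open>beta (Suc t)\<close>,
  the weight attached to the increment of this step; shifting the index costs
  \<open>lam / N\<close>.\<close>

lemma num_cand_near_beta:
  fixes \<delta> e :: real
  assumes t: "Suc t < N" and mart: "\<bar>mart d N p k t H\<bar> \<le> \<delta> * N"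
    and restarts: "(\<Sum>i<t. restart N k i H) \<le> 3 * e * N + 1" and e: "0 \<le> e"
  shows "\<bar>num_cand N k t H / N - beta d N p (Suc t)\<bar>
    \<le> \<delta> + 3 * exp (2 * lam) * e + (lam\<^sup>2 * exp (2 * lam) + lam + exp (2 * lam) + 1 + k) / N"
proof -
  let ?m = "real (num_cand N k t H)" and ?U = "real (num_unseen N k t H)"
  let ?b = "beta d N p t" and ?b' = "beta d N p (Suc t)"
  have b: "0 < ?b" "?b \<le> 1" "?b' \<le> ?b" by (auto intro: beta_pos beta_le_1 beta_antimono)
  have "?b * a_coeff d N p (Suc t) \<le> 1 * (lam / N)"
    using b a_le a_nonneg by (intro mult_mono) auto
  then have b': "?b \<le> ?b' + lam / N" unfolding beta_Suc by (simp add: algebra_simps)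
  have m: "?m = ?U - restart N k t H" using t by (intro num_cand_eq_restart[OF kN]) auto
  have \<delta>: "0 \<le> \<delta> * N" using mart abs_ge_zero by (rule order_trans[rotated])
  have "?m \<le> N * ?b + lam\<^sup>2 * exp (2 * lam) + \<delta> * N"
    using unseen_upper'[OF _ mart] t m by (simp add: restart_def split: if_splits)
  also have "N * ?b \<le> N * (?b' + lam / N)" using b' by (intro mult_left_mono) auto
  finally have "?m \<le> N * ?b' + (\<delta> * N + lam\<^sup>2 * exp (2 * lam) + lam)"
    using N_pos by (simp add: distrib_left)
  then have "?m / N \<le> (N * ?b' + (\<delta> * N + lam\<^sup>2 * exp (2 * lam) + lam)) / N"
    using N_pos by (intro divide_right_mono) auto
  then have upper: "?m / N \<le> ?b' + \<delta> + (lam\<^sup>2 * exp (2 * lam) + lam) / N"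
    using N_pos by (simp add: add_divide_distrib)
  let ?R = "k + exp (2 * lam) * (3 * e * N + 1) + \<delta> * N"
  have "exp (2 * lam) * (\<Sum>i<t. restart N k i H) \<le> exp (2 * lam) * (3 * e * N + 1)"
    using restarts by (intro mult_left_mono) auto
  then have "N - ?R \<le> ?U / ?b"
    using unseen_lower[of t H] mart t by linarith
  then have "(N - ?R) * ?b \<le> ?U" using b by (simp add: pos_le_divide_eq)
  moreover have "?R * ?b \<le> ?R * 1" using b e \<delta> N_pos by (intro mult_left_mono) auto
  ultimately have "N * ?b - ?R \<le> ?U" by (simp add: left_diff_distrib)
  moreover have "N * ?b' \<le> N * ?b" using b by (intro mult_left_mono) auto
  moreover have "?U - 1 \<le> ?m" unfolding m by (simp add: restart_def)
  ultimately have "N * ?b' - ?R - 1 \<le> ?m" by linarith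
  then have "(N * ?b' - ?R - 1) / N \<le> ?m / N" using N_pos by (intro divide_right_mono) auto
  moreover have "(N * ?b' - ?R - 1) / N = ?b' - \<delta> - 3 * exp (2 * lam) * e - (exp (2 * lam) + 1 + k) / N"
    using N_pos by (simp add: field_simps)
  ultimately have lower: "?b' - \<delta> - 3 * exp (2 * lam) * e - (exp (2 * lam) + 1 + k) / N \<le> ?m / N" by simp
  have split: "(lam\<^sup>2 * exp (2 * lam) + lam + exp (2 * lam) + 1 + k) / N = (lam\<^sup>2 * exp (2 * lam) + lam) / N + (exp (2 * lam) + 1 + k) / N"
    by (simp add: add_divide_distrib)
  have "0 \<le> (lam\<^sup>2 * exp (2 * lam) + lam) / N" "0 \<le> (exp (2 * lam) + 1 + k) / N" "0 \<le> 3 * exp (2 * lam) * e"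
    using lam0 e by auto
  then show ?thesis using upper lower unfolding split abs_le_iff by linarith
qed

text \<open>The covariance is \<open>q * q' * (1 - (1 - p) ^ n)\<close>, where \<open>n\<close>
  counts the possible hyperedges through the selected vertex and both candidates. To first order it
  is \<open>p * n\<close>, the decrease of \<open>a_coeff\<close>, which is of order
  \<open>1 / N\<^sup>2\<close>.\<close>

lemma miss_cov:
  assumes "t + 2 \<le> N"
  shows "\<bar>N\<^sup>2 * (miss d N p t * miss d N p (Suc t) - (miss d N p t)\<^sup>2) - N\<^sup>2 * (a_coeff d N p t - a_coeff d N p (Suc t))\<bar>
      \<le> 3 * lam\<^sup>2 * d / N" (is ?approx)
    and "0 \<le> N\<^sup>2 * (miss d N p t * miss d N p (Suc t) - (miss d N p t)\<^sup>2)"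
    and "N\<^sup>2 * (miss d N p t * miss d N p (Suc t) - (miss d N p t)\<^sup>2) \<le> lam * d"
proof -
  let ?A = "(N - t - 1) choose (d - 2)" and ?A' = "(N - Suc t - 1) choose (d - 2)"
  let ?q = "miss d N p t" and ?q' = "miss d N p (Suc t)"
  define n where "n = ?A - ?A'"
  have A: "?A' \<le> ?A" by (rule binomial_right_mono) simp
  define B where "B = a_coeff d N p t - a_coeff d N p (Suc t)"
  have B: "B = p * n" using A by (simp add: B_def a_coeff_def n_def of_nat_diff right_diff_distrib)
  have B0: "0 \<le> B" unfolding B using p_nonneg by simp
  have B1: "B \<le> lam / N" using a_le[of t] a_nonneg[of "Suc t"] unfolding B_def by linarith
  have NB: "N\<^sup>2 * B \<le> lam * d"
  proof (cases "d = 2")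
    \<comment> \<open>For graphs no edge contains three vertices, so \<open>n = 0\<close> and the
      indicators are uncorrelated.\<close>
    case True
    then show ?thesis using lam0 by (simp add: B n_def)
  next
    case False
    then have d: "d - 2 = Suc (d - 3)" "d - 1 = Suc (Suc (d - 3))" using d2 by auto
    have "N - t - 1 = Suc (N - Suc t - 1)" using assms by simp
    then have "n = (N - Suc t - 1) choose (d - 3)" unfolding n_def d by simp
    then have "B \<le> lam * fact (d - 2) / fact (d - 3) * (real N ^ (d - 3) / real N ^ (d - 1))"
      unfolding B using p_choose_le[of "N - Suc t - 1" "d - 3"] by simp
    also have "\<dots> = lam * (d - 2) / N\<^sup>2"
      using N_pos unfolding d by (simp add: power2_eq_square field_simps)
    finally have "N\<^sup>2 * B \<le> lam * (d - 2)" using N_pos by (simp add: field_simps)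
    also have "\<dots> \<le> lam * d" using lam0 by simp
    finally show ?thesis .
  qed
  have "?q = ?q' * (1 - p) ^ n" unfolding miss_def n_def using A by (simp flip: power_add)
  then have cov: "?q * ?q' - ?q\<^sup>2 = ?q * ?q' * (1 - (1 - p) ^ n)" by (simp add: power2_eq_square algebra_simps)
  have q: "0 \<le> ?q * ?q'" "?q * ?q' \<le> 1" using miss_nonneg miss_le_1 by (auto intro: mult_le_one)
  have n: "1 - (1 - p) ^ n \<le> B" "B - B\<^sup>2 \<le> 1 - (1 - p) ^ n"
    unfolding B using one_minus_power_bounds[OF p_nonneg p_le_1] by blast+
  have n0: "0 \<le> 1 - (1 - p) ^ n" using p_nonneg p_le_1 by (simp add: power_le_one)
  have up: "?q * ?q' - ?q\<^sup>2 \<le> B" unfolding cov using mult_mono[OF q(2) n(1)] q n0 by simp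
  show nonneg: "0 \<le> N\<^sup>2 * (?q * ?q' - ?q\<^sup>2)" unfolding cov using miss_nonneg n0 by (intro mult_nonneg_nonneg) auto
  have up': "N\<^sup>2 * (?q * ?q' - ?q\<^sup>2) \<le> N\<^sup>2 * B" using up by (intro mult_left_mono) auto
  then show "N\<^sup>2 * (?q * ?q' - ?q\<^sup>2) \<le> lam * d" using NB by linarith
  have "(1 - 2 * (lam / N)) \<le> ?q * ?q'"
  proof -
    let ?l = "lam / N"
    have l: "0 \<le> ?l" "?l \<le> 1/2" using lam0 lam_N_le by auto
    have "(1 - ?l) * (1 - ?l) \<le> ?q * ?q'"
      using miss_ge[of t] miss_ge[of "Suc t"] a_le[of t] a_le[of "Suc t"] l miss_nonneg by (intro mult_mono) linarith+
    moreover have "(1 - ?l) * (1 - ?l) = 1 - 2 * ?l + ?l * ?l" by (simp add: algebra_simps)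
    moreover have "0 \<le> ?l * ?l" by simp
    ultimately show ?thesis by linarith
  qed
  then have "(1 - ?q * ?q') * (1 - (1 - p) ^ n) \<le> 2 * (lam / N) * B"
    using n n0 lam0 q by (intro mult_mono) auto
  then have "(1 - (1 - p) ^ n) - ?q * ?q' * (1 - (1 - p) ^ n) \<le> 2 * (lam / N * B)"
    by (simp only: left_diff_distrib mult_1_left mult.assoc)
  moreover have "B\<^sup>2 \<le> lam / N * B" unfolding power2_eq_square using B0 B1 by (intro mult_right_mono)
  ultimately have "B - 3 * (lam / N * B) \<le> ?q * ?q' - ?q\<^sup>2"
    unfolding cov using n(2) by linarith
  then have "B - 3 * (lam / N) * B \<le> ?q * ?q' - ?q\<^sup>2" by (simp only: mult.assoc)
  then have "N\<^sup>2 * (B - 3 * (lam / N) * B) \<le> N\<^sup>2 * (?q * ?q' - ?q\<^sup>2)" by (intro mult_left_mono) auto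
  moreover have "3 * (lam / N) * (N\<^sup>2 * B) \<le> 3 * (lam / N) * (lam * d)"
    using NB lam0 by (intro mult_left_mono) auto
  ultimately have "N\<^sup>2 * B - N\<^sup>2 * (?q * ?q' - ?q\<^sup>2) \<le> 3 * lam\<^sup>2 * d / N"
    by (simp add: algebra_simps power2_eq_square)
  moreover have "0 \<le> 3 * lam\<^sup>2 * d / N" by simp
  ultimately show ?approx using up' unfolding B_def[symmetric] abs_le_iff by linarith
qed

text \<open>With \<open>m\<close> close to \<open>N * beta\<close>, the diagonal part is about
  \<open>N * beta * a_coeff\<close> and the pairs contribute about \<open>beta\<^sup>2\<close> times
  \<open>N\<^sup>2\<close> times the decrease of \<open>a_coeff\<close>. Division by
  \<open>beta\<^sup>2\<close> produces two terms that both telescope.\<close>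

lemma step_var_approx:
  assumes t: "t + 2 \<le> N" and m: "0 \<le> m" "m \<le> N" and near: "\<bar>m / N - beta d N p t\<bar> \<le> e"
  shows "\<bar>step_var d N p t m / (beta d N p t)\<^sup>2
      - N * (a_coeff d N p t / beta d N p t + N * (a_coeff d N p t - a_coeff d N p (Suc t)))\<bar> \<le> var_err d lam * (e + 1 / N)"
proof -
  \<comment> \<open>Rescaling by \<open>N\<close> makes \<open>M\<close>, \<open>b\<close>,
    \<open>N * a\<close>, \<open>B\<close> and \<open>C\<close> bounded uniformly in
    \<open>N\<close>.\<close>
  define M b q a where "M = m / N" and "b = beta d N p t" and "q = miss d N p t" and "a = a_coeff d N p t"
  define C where "C = N\<^sup>2 * (miss d N p t * miss d N p (Suc t) - (miss d N p t)\<^sup>2)"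
  define B where "B = N\<^sup>2 * (a_coeff d N p t - a_coeff d N p (Suc t))"
  have e: "0 \<le> e" using near abs_ge_zero by (rule order_trans[rotated])
  have M: "0 \<le> M" "M \<le> 1" "m = M * N" using m N_pos by (auto simp: M_def)
  have b: "0 < b" "b \<le> 1" by (simp_all add: b_def beta_pos beta_le_1)
  have Mb: "\<bar>M - b\<bar> \<le> e" using near by (simp add: M_def b_def)
  have q: "0 \<le> q" "q \<le> 1" "1 - a \<le> q" "q \<le> 1 - a + a\<^sup>2"
    unfolding q_def a_def by (rule miss_nonneg miss_le_1 miss_ge miss_le)+
  have a: "0 \<le> N * a" "N * a \<le> lam" "N * a\<^sup>2 \<le> lam\<^sup>2 / N"
    using a_nonneg a_le[of t] N_pos mult_left_mono[OF a_square_le[of t], of "real N"] by (auto simp: a_def field_simps)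
  have C: "\<bar>C - B\<bar> \<le> 3 * lam\<^sup>2 * d / N" "0 \<le> C" "C \<le> lam * d"
    unfolding C_def B_def by (rule miss_cov[OF t])+
  have v: "step_var d N p t m = M * (N * (1 - q)) * q + (M\<^sup>2 - M / N) * C"
    using N_pos unfolding step_var_def C_def M q_def by (simp add: field_simps power2_eq_square)
  have P: "0 \<le> N * (1 - q)" "N * (1 - q) \<le> N * a" "\<bar>N * (1 - q) - N * a\<bar> \<le> lam\<^sup>2 / N"
  proof -
    show "0 \<le> N * (1 - q)" using q by simp
    show le: "N * (1 - q) \<le> N * a" using q by (intro mult_left_mono) auto
    have "N * (a - a\<^sup>2) \<le> N * (1 - q)" using q by (intro mult_left_mono) auto
    then show "\<bar>N * (1 - q) - N * a\<bar> \<le> lam\<^sup>2 / N" using le a by (simp add: right_diff_distrib abs_le_iff)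
  qed
  have t1: "\<bar>M * (N * (1 - q)) * q - b * (N * a)\<bar> \<le> lam * e + 2 * lam\<^sup>2 / N"
  proof -
    have "(1 - q) * (N * (1 - q)) \<le> (lam / N) * lam"
      using P a q a_le[of t] lam0 by (intro mult_mono) (auto simp: a_def)
    then have 1: "(1 - q) * (N * (1 - q)) \<le> lam\<^sup>2 / N" "0 \<le> (1 - q) * (N * (1 - q))"
      using P q by (auto simp: power2_eq_square)
    have "M * (N * (1 - q)) * q - b * (N * a) = (M - b) * (N * a) + M * ((N * (1 - q) - N * a) - (1 - q) * (N * (1 - q)))"
      by (simp add: algebra_simps)
    also have "\<bar>\<dots>\<bar> \<le> \<bar>(M - b) * (N * a)\<bar> + \<bar>M * ((N * (1 - q) - N * a) - (1 - q) * (N * (1 - q)))\<bar>"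
      by (rule abs_triangle_ineq)
    also have "\<bar>(M - b) * (N * a)\<bar> \<le> e * lam"
      unfolding abs_mult using Mb a e by (intro mult_mono) auto
    also have "\<bar>M * ((N * (1 - q) - N * a) - (1 - q) * (N * (1 - q)))\<bar> \<le> 1 * (2 * lam\<^sup>2 / N)"
      unfolding abs_mult
    proof (rule mult_mono)
      show "\<bar>N * (1 - q) - N * a - (1 - q) * (N * (1 - q))\<bar> \<le> 2 * lam\<^sup>2 / N"
        using P(3) 1 unfolding abs_le_iff by simp
    qed (use M in auto)
    finally show ?thesis by (simp add: mult.commute)
  qed
  have t2: "\<bar>(M\<^sup>2 - M / N) * C - b\<^sup>2 * B\<bar> \<le> (2 * e + 1 / N) * (lam * d) + 3 * lam\<^sup>2 * d / N"
  proof -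
    have "\<bar>(M + b) * (M - b)\<bar> \<le> 2 * e" unfolding abs_mult using Mb M b by (intro mult_mono) auto
    moreover have "0 \<le> M / N" "M / N \<le> 1 / N" using M N_pos by (auto intro: divide_right_mono)
    ultimately have 1: "\<bar>(M + b) * (M - b) - M / N\<bar> \<le> 2 * e + 1 / N" unfolding abs_le_iff by linarith
    have "(M\<^sup>2 - M / N) * C - b\<^sup>2 * B = ((M + b) * (M - b) - M / N) * C + b\<^sup>2 * (C - B)"
      by (simp add: algebra_simps power2_eq_square)
    also have "\<bar>\<dots>\<bar> \<le> \<bar>((M + b) * (M - b) - M / N) * C\<bar> + \<bar>b\<^sup>2 * (C - B)\<bar>" by (rule abs_triangle_ineq)
    also have "\<bar>((M + b) * (M - b) - M / N) * C\<bar> \<le> (2 * e + 1 / N) * (lam * d)"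
      unfolding abs_mult using 1 C e by (intro mult_mono) auto
    also have "\<bar>b\<^sup>2 * (C - B)\<bar> \<le> 1 * (3 * lam\<^sup>2 * d / N)"
      unfolding abs_mult using C b by (intro mult_mono) (auto simp: power_le_one)
    finally show ?thesis by simp
  qed
  define Q where "Q = 2 * lam\<^sup>2 + lam + 3 * (lam * d) + 3 * (lam\<^sup>2 * d)"
  have eN: "0 \<le> 1 / real N" by simp
  have bound: "\<bar>step_var d N p t m - (b * (N * a) + b\<^sup>2 * B)\<bar> \<le> Q * (e + 1 / N)"
  proof -
    have "\<bar>step_var d N p t m - (b * (N * a) + b\<^sup>2 * B)\<bar> \<le> (lam * e + 2 * lam\<^sup>2 / N) + ((2 * e + 1 / N) * (lam * d) + 3 * lam\<^sup>2 * d / N)"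
      using t1 t2 unfolding v abs_le_iff by linarith
    also have "\<dots> = (lam + 2 * (lam * d)) * e + (2 * lam\<^sup>2 + lam * d + 3 * (lam\<^sup>2 * d)) * (1 / N)"
      by (simp add: algebra_simps add_divide_distrib)
    also have "\<dots> \<le> Q * e + Q * (1 / N)"
    proof -
      have nn: "0 \<le> lam * d" "0 \<le> lam\<^sup>2 * d" "0 \<le> lam\<^sup>2" using lam0 by auto
      then have "lam + 2 * (lam * d) \<le> Q" "2 * lam\<^sup>2 + lam * d + 3 * (lam\<^sup>2 * d) \<le> Q"
        unfolding Q_def using lam0 by linarith+
      then show ?thesis using e eN by (intro add_mono mult_right_mono) auto
    qed
    finally show ?thesis by (simp add: distrib_left)
  qed
  have "step_var d N p t m / b\<^sup>2 - N * (a / b + N * (a_coeff d N p t - a_coeff d N p (Suc t)))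
    = (step_var d N p t m - (b * (N * a) + b\<^sup>2 * B)) * (1 / b)\<^sup>2"
    using b by (simp add: B_def field_simps power2_eq_square)
  also have "\<bar>\<dots>\<bar> \<le> Q * (e + 1 / N) * (exp (2 * lam)) ^ 2"
    unfolding abs_mult
  proof (rule mult_mono[OF bound])
    have "1 / b \<le> exp (2 * lam)" unfolding b_def using t by (intro inverse_beta_le) auto
    then have "(1 / b)\<^sup>2 \<le> (exp (2 * lam))\<^sup>2" using b by (intro power_mono) auto
    then show "\<bar>(1 / b)\<^sup>2\<bar> \<le> (exp (2 * lam))\<^sup>2" by simp
    show "0 \<le> Q * (e + 1 / N)" unfolding Q_def using lam0 e by (intro mult_nonneg_nonneg) auto
  qed simp
  finally show ?thesis by (simp add: var_err_def Q_def b_def a_def mult_ac)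
qed

text \<open>Since \<open>beta (Suc i) = beta i * (1 - a_coeff (Suc i))\<close>, each summand is
  \<open>1 / beta (Suc i) - 1 / beta i\<close>.\<close>

lemma sum_a_div_beta: "(\<Sum>i<n. a_coeff d N p (Suc i) / beta d N p (Suc i)) = 1 / beta d N p n - 1"
proof (induction n)
  case (Suc n)
  have "beta d N p (Suc n) \<noteq> 0" "beta d N p n \<noteq> 0" using beta_pos less_irrefl by metis+
  moreover have "1 - a_coeff d N p (Suc n) \<noteq> 0" using a_le_half[of "Suc n"] by simp
  ultimately have "1 / beta d N p n + a_coeff d N p (Suc n) / beta d N p (Suc n) = 1 / beta d N p (Suc n)"
    unfolding beta_Suc by (simp add: field_simps)
  then show ?case using Suc by simp
qed simp

lemma sum_var_approx:
  assumes n: "n + 1 < N" and near: "\<And>i. i < n \<Longrightarrow> \<bar>num_cand N k i H / N - beta d N p (Suc i)\<bar> \<le> e" and e: "0 \<le> e"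
  shows "\<bar>(\<Sum>i<n. step_var d N p (Suc i) (num_cand N k i H) / (beta d N p (Suc i))\<^sup>2) / N
    - ((1 / beta d N p n - 1) + N * (a_coeff d N p 1 - a_coeff d N p (Suc n)))\<bar> \<le> var_err d lam * (e + 1 / N)"
proof -
  let ?v = "\<lambda>i. step_var d N p (Suc i) (num_cand N k i H) / (beta d N p (Suc i))\<^sup>2"
  let ?w = "\<lambda>i. a_coeff d N p (Suc i) / beta d N p (Suc i) + N * (a_coeff d N p (Suc i) - a_coeff d N p (Suc (Suc i)))"
  have ve: "0 \<le> var_err d lam * (e + 1 / N)" unfolding var_err_def using lam0 e by (intro mult_nonneg_nonneg) auto
  have "(\<Sum>i<n. a_coeff d N p (Suc i) - a_coeff d N p (Suc (Suc i))) = a_coeff d N p 1 - a_coeff d N p (Suc n)"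
    by (induction n) auto
  then have w: "(\<Sum>i<n. ?w i) = (1 / beta d N p n - 1) + N * (a_coeff d N p 1 - a_coeff d N p (Suc n))"
    by (simp add: sum.distrib sum_a_div_beta flip: sum_distrib_left)
  have "\<bar>(\<Sum>i<n. ?v i) - N * (\<Sum>i<n. ?w i)\<bar> = \<bar>\<Sum>i<n. ?v i - N * ?w i\<bar>"
    by (simp add: sum_subtractf sum_distrib_left)
  also have "\<dots> \<le> (\<Sum>i<n. \<bar>?v i - N * ?w i\<bar>)" by (rule sum_abs)
  also have "\<dots> \<le> (\<Sum>i<n. var_err d lam * (e + 1 / N))"
    using n near num_cand_le by (intro sum_mono step_var_approx) auto
  also have "\<dots> = n * (var_err d lam * (e + 1 / N))" by simp
  also have "\<dots> \<le> N * (var_err d lam * (e + 1 / N))" using n ve by (intro mult_right_mono) auto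
  finally have "\<bar>(\<Sum>i<n. ?v i) - N * (\<Sum>i<n. ?w i)\<bar> / N \<le> var_err d lam * (e + 1 / N)"
    using N_pos by (simp add: divide_le_eq mult.commute)
  moreover have "(\<Sum>i<n. ?v i) / N - (\<Sum>i<n. ?w i) = ((\<Sum>i<n. ?v i) - N * (\<Sum>i<n. ?w i)) / N"
    using N_pos by (simp only: diff_divide_distrib nonzero_mult_div_cancel_left[OF less_imp_neq[OF N_pos, symmetric]])
  ultimately show ?thesis unfolding w[symmetric] by (simp only: abs_divide abs_of_nat)
qed

end

section \<open>The bad event\<close>

context exploration
begin

text \<open>Chernoff's bound under the exponential weight: the exponent that dominates the indicator
  is again a weighted sum of increments, so one application of \<open>hexp_exp_sum_le\<close> treats
  both. The weights at most double, whence \<open>28 = 7 * 2\<^sup>2\<close>.\<close>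

lemma hexp_exp_bad_one:
  fixes w :: "nat \<Rightarrow> real" and \<tau> \<delta> \<sigma> :: real
  assumes n: "n < N" and t: "t \<le> n" and \<tau>: "0 \<le> \<tau>" "2 * \<tau> * exp (2 * lam) \<le> 1"
    and w: "\<And>i. i < n \<Longrightarrow> \<bar>w i\<bar> \<le> \<tau> * exp (2 * lam)" and \<sigma>: "\<bar>\<sigma>\<bar> = 1"
  shows "hexp d N p (\<lambda>H. exp (\<Sum>i<n. w i * incr d N p k i H) * of_bool (\<delta> * N < \<sigma> * mart d N p k t H))
    \<le> exp (28 * K * N * \<tau>\<^sup>2 * exp (4 * lam) - \<tau> * (\<delta> * N))"
proof -
  define w' where "w' i = w i + (if i < t then \<sigma> * \<tau> / beta d N p (Suc i) else 0)" for i
  have w': "\<bar>w' i\<bar> \<le> 2 * \<tau> * exp (2 * lam)" if i: "i < n" for i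
  proof -
    have "\<tau> * (1 / beta d N p (Suc i)) \<le> \<tau> * exp (2 * lam)"
      using inverse_beta_le[of "Suc i"] i n \<tau> by (intro mult_left_mono) auto
    moreover have "\<bar>\<sigma> * \<tau> / beta d N p (Suc i)\<bar> = \<tau> * (1 / beta d N p (Suc i))"
      using \<tau> \<sigma> beta_pos[of "Suc i"] by (simp add: abs_mult)
    moreover have "0 \<le> \<tau> * exp (2 * lam)" using \<tau> by simp
    ultimately have "\<bar>if i < t then \<sigma> * \<tau> / beta d N p (Suc i) else 0\<bar> \<le> \<tau> * exp (2 * lam)" by simp
    then show ?thesis using w[OF i] unfolding w'_def by linarith
  qed
  have sum_w': "(\<Sum>i<n. w' i * incr d N p k i H) = (\<Sum>i<n. w i * incr d N p k i H) + \<tau> * (\<sigma> * mart d N p k t H)" for H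
  proof -
    have "(\<Sum>i<n. (if i < t then \<sigma> * \<tau> / beta d N p (Suc i) else 0) * incr d N p k i H)
      = (\<Sum>i<t. (if i < t then \<sigma> * \<tau> / beta d N p (Suc i) else 0) * incr d N p k i H)"
      using t by (intro sum.mono_neutral_right) auto
    also have "\<dots> = \<tau> * (\<sigma> * mart d N p k t H)"
      unfolding mart_def sum_distrib_left by (intro sum.cong) auto
    finally show ?thesis unfolding w'_def by (simp add: distrib_right sum.distrib)
  qed
  have "hexp d N p (\<lambda>H. exp (\<Sum>i<n. w i * incr d N p k i H) * of_bool (\<delta> * N < \<sigma> * mart d N p k t H))
    \<le> hexp d N p (\<lambda>H. exp (- (\<tau> * (\<delta> * N))) * exp (\<Sum>i<n. w' i * incr d N p k i H))"
  proof (rule hexp_mono)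
    fix H
    have "of_bool (\<delta> * N < \<sigma> * mart d N p k t H) \<le> exp (\<tau> * (\<sigma> * mart d N p k t H - \<delta> * N))"
      using \<tau> by simp
    then have "exp (\<Sum>i<n. w i * incr d N p k i H) * of_bool (\<delta> * N < \<sigma> * mart d N p k t H)
      \<le> exp (\<Sum>i<n. w i * incr d N p k i H) * exp (\<tau> * (\<sigma> * mart d N p k t H - \<delta> * N))"
      by (rule mult_left_mono) simp
    also have "\<dots> = exp (- (\<tau> * (\<delta> * N))) * exp (\<Sum>i<n. w' i * incr d N p k i H)"
      unfolding sum_w' exp_add[symmetric] by (simp add: algebra_simps)
    finally show "exp (\<Sum>i<n. w i * incr d N p k i H) * of_bool (\<delta> * N < \<sigma> * mart d N p k t H)
      \<le> exp (- (\<tau> * (\<delta> * N))) * exp (\<Sum>i<n. w' i * incr d N p k i H)" .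
  qed
  also have "\<dots> = exp (- (\<tau> * (\<delta> * N))) * hexp d N p (\<lambda>H. exp (\<Sum>i<n. w' i * incr d N p k i H))" by simp
  also have "hexp d N p (\<lambda>H. exp (\<Sum>i<n. w' i * incr d N p k i H)) \<le> exp (7 * K * (\<Sum>i<n. (w' i)\<^sup>2))"
    using w' \<tau> by (intro hexp_exp_sum_le[OF n]) (auto intro: order_trans)
  also have "\<dots> \<le> exp (28 * K * N * \<tau>\<^sup>2 * exp (4 * lam))"
  proof -
    have "(w' i)\<^sup>2 \<le> (2 * \<tau> * exp (2 * lam))\<^sup>2" if "i < n" for i
      using w'[OF that] by (metis abs_ge_zero power2_abs power_mono)
    then have "(\<Sum>i<n. (w' i)\<^sup>2) \<le> (\<Sum>i<n. (2 * \<tau> * exp (2 * lam))\<^sup>2)" by (intro sum_mono) auto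
    also have "\<dots> = n * (2 * \<tau> * exp (2 * lam))\<^sup>2" by simp
    also have "\<dots> \<le> N * (2 * \<tau> * exp (2 * lam))\<^sup>2" using n by (intro mult_right_mono) auto
    also have "(2 * \<tau> * exp (2 * lam))\<^sup>2 = 4 * \<tau>\<^sup>2 * exp (4 * lam)"
      by (simp add: power_mult_distrib exp_double[symmetric])
    finally have "7 * K * (\<Sum>i<n. (w' i)\<^sup>2) \<le> 7 * K * (N * (4 * \<tau>\<^sup>2 * exp (4 * lam)))"
      using K_ge1 by (intro mult_left_mono) auto
    then show ?thesis by (simp add: mult_ac)
  qed
  finally show ?thesis by (simp add: exp_diff exp_minus field_simps)
qed

text \<open>A union bound over the \<open>n + 1\<close> times and the two signs.\<close>

lemma hexp_exp_bad:
  fixes w :: "nat \<Rightarrow> real" and \<tau> \<delta> :: real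
  assumes n: "n < N" and \<tau>: "0 \<le> \<tau>" "2 * \<tau> * exp (2 * lam) \<le> 1"
    and w: "\<And>i. i < n \<Longrightarrow> \<bar>w i\<bar> \<le> \<tau> * exp (2 * lam)" 
  shows "hexp d N p (\<lambda>H. exp (\<Sum>i<n. w i * incr d N p k i H) * of_bool (\<exists>t\<le>n. \<delta> * N < \<bar>mart d N p k t H\<bar>))
    \<le> 2 * N * exp (28 * K * N * \<tau>\<^sup>2 * exp (4 * lam) - \<tau> * (\<delta> * N))"
proof -
  let ?e = "\<lambda>H. exp (\<Sum>i<n. w i * incr d N p k i H)"
  let ?r = "exp (28 * K * N * \<tau>\<^sup>2 * exp (4 * lam) - \<tau> * (\<delta> * N))"
  let ?f = "\<lambda>t \<sigma> H. ?e H * of_bool (\<delta> * N < \<sigma> * mart d N p k t H) :: real"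
  have one: "hexp d N p (?f t \<sigma>) \<le> ?r" if "t \<le> n" "\<bar>\<sigma>\<bar> = 1" for t \<sigma>
    by (rule hexp_exp_bad_one[OF n that(1) \<tau> w that(2)])
  have "hexp d N p (\<lambda>H. ?e H * of_bool (\<exists>t\<le>n. \<delta> * N < \<bar>mart d N p k t H\<bar>))
    \<le> hexp d N p (\<lambda>H. \<Sum>t\<le>n. ?f t 1 H + ?f t (-1) H)"
  proof (rule hexp_mono)
    fix H
    have nonneg: "0 \<le> ?f t 1 H + ?f t (-1) H" for t by simp
    show "?e H * of_bool (\<exists>t\<le>n. \<delta> * N < \<bar>mart d N p k t H\<bar>) \<le> (\<Sum>t\<le>n. ?f t 1 H + ?f t (-1) H)"
    proof (cases "\<exists>t\<le>n. \<delta> * N < \<bar>mart d N p k t H\<bar>")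
      case True
      then obtain t where t: "t \<le> n" "\<delta> * N < \<bar>mart d N p k t H\<bar>" by blast
      have "?e H * of_bool (\<exists>t\<le>n. \<delta> * N < \<bar>mart d N p k t H\<bar>) = ?e H" using True by simp
      also have "\<dots> \<le> ?f t 1 H + ?f t (-1) H" using t(2) by (auto simp: abs_if split: if_splits)
      also have "\<dots> \<le> (\<Sum>t\<le>n. ?f t 1 H + ?f t (-1) H)"
        using t(1) nonneg by (intro member_le_sum) auto
      finally show ?thesis .
    next
      case False
      then have "?e H * of_bool (\<exists>t\<le>n. \<delta> * N < \<bar>mart d N p k t H\<bar>) = 0" by simp
      then show ?thesis using nonneg by (simp only: sum_nonneg)
    qed
  qed
  also have "\<dots> = (\<Sum>t\<le>n. hexp d N p (?f t 1) + hexp d N p (?f t (-1)))"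
    by (subst hexp_sum) (intro sum.cong refl Bochner_Integration.integral_add integrable_random_hypergraph)
  also have "\<dots> \<le> (\<Sum>t\<le>n. ?r + ?r)"
    by (intro sum_mono add_mono one) auto
  also have "\<dots> = 2 * (Suc n) * ?r" by simp
  also have "\<dots> \<le> 2 * N * ?r" using n by (intro mult_right_mono) auto
  finally show ?thesis .
qed

text \<open>The mean-1 identity is split along \<open>G\<close>. On \<open>G\<close> the compensator
  is confined to \<open>[A, B]\<close>; off \<open>G\<close> the weighted mass is at most
  \<open>r\<close>, and dividing by the compensator's exponential, which is at least 1, cannot
  increase it.\<close>

lemma hexp_exp_sandwich:
  fixes w :: "nat \<Rightarrow> real"
  assumes n: "n < N"
    and good: "\<And>H. G H \<Longrightarrow> A \<le> (\<Sum>i<n. ln (mgf (w i) i H)) \<and> (\<Sum>i<n. ln (mgf (w i) i H)) \<le> B"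
    and bad: "hexp d N p (\<lambda>H. exp (\<Sum>i<n. w i * incr d N p k i H) * of_bool (\<not> G H)) \<le> r"
  shows "exp A * (1 - r) \<le> hexp d N p (\<lambda>H. exp (\<Sum>i<n. w i * incr d N p k i H))"
    and "hexp d N p (\<lambda>H. exp (\<Sum>i<n. w i * incr d N p k i H)) \<le> exp B + r"
proof -
  define W where "W H = (\<Sum>i<n. w i * incr d N p k i H)" for H
  define \<Phi> where "\<Phi> H = (\<Sum>i<n. ln (mgf (w i) i H))" for H
  have mart: "hexp d N p (\<lambda>H. exp (W H - \<Phi> H)) = 1"
    unfolding W_def \<Phi>_def by (rule hexp_exp_martingale[OF n])
  have \<Phi>0: "0 \<le> \<Phi> H" for H unfolding \<Phi>_def
  proof (intro sum_nonneg)
    fix i assume "i \<in> {..<n}"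
    then have "1 \<le> mgf (w i) i H" unfolding step_mgf_def using n by (intro mgf_ge_1 valid_explore') auto
    then show "0 \<le> ln (mgf (w i) i H)" by simp
  qed
  have bad': "hexp d N p (\<lambda>H. exp (W H) * of_bool (\<not> G H)) \<le> r" using bad by (simp add: W_def)
  have "hexp d N p (\<lambda>H. exp (W H)) \<le> hexp d N p (\<lambda>H. exp B * exp (W H - \<Phi> H) + exp (W H) * of_bool (\<not> G H))"
  proof (rule hexp_mono)
    fix H show "exp (W H) \<le> exp B * exp (W H - \<Phi> H) + exp (W H) * of_bool (\<not> G H)"
      using good[of H] by (cases "G H") (auto simp: \<Phi>_def add_increasing simp flip: exp_add)
  qed
  also have "\<dots> = exp B + hexp d N p (\<lambda>H. exp (W H) * of_bool (\<not> G H))" by (simp add: mart)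
  finally show "hexp d N p (\<lambda>H. exp (\<Sum>i<n. w i * incr d N p k i H)) \<le> exp B + r"
    using bad' unfolding W_def by linarith
  have "exp A * (1 - r) \<le> exp A * (1 - hexp d N p (\<lambda>H. exp (W H) * of_bool (\<not> G H)))"
    using bad' by (intro mult_left_mono) auto
  also have "\<dots> = hexp d N p (\<lambda>H. exp A * (exp (W H - \<Phi> H) - exp (W H) * of_bool (\<not> G H)))"
    by (simp add: mart)
  also have "\<dots> \<le> hexp d N p (\<lambda>H. exp (W H))"
  proof (rule hexp_mono)
    fix H show "exp A * (exp (W H - \<Phi> H) - exp (W H) * of_bool (\<not> G H)) \<le> exp (W H)"
    proof (cases "G H")
      case True
      then show ?thesis using good[of H] by (simp add: \<Phi>_def flip: exp_add)
    next
      case False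
      \<comment> \<open>The subtracted bad mass outweighs the normalised one because
        \<open>\<Phi>\<close> is nonnegative.\<close>
      have "exp (W H - \<Phi> H) - exp (W H) \<le> 0" using \<Phi>0[of H] by simp
      then have "exp A * (exp (W H - \<Phi> H) - exp (W H)) \<le> 0" by (intro mult_nonneg_nonpos) auto
      then have "exp A * (exp (W H - \<Phi> H) - exp (W H)) \<le> exp (W H)" using exp_ge_zero[of "W H"] by linarith
      then show ?thesis by (simp only: False not_False_eq_True of_bool_eq mult_1_right)
    qed
  qed
  finally show "exp A * (1 - r) \<le> hexp d N p (\<lambda>H. exp (\<Sum>i<n. w i * incr d N p k i H))" by (simp add: W_def)
qed

text \<open>As \<open>beta\<close> decreases, every weight is at most \<open>\<bar>h\<bar>\<close>
  in absolute value, so one cubic bound serves all steps.\<close>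

lemma sum_ln_mgf_approx:
  fixes h \<theta> :: real
  assumes n: "n < N" and h: "\<bar>h\<bar> \<le> 1" "7 * K * h\<^sup>2 \<le> 1"
  shows "\<bar>(\<Sum>i<n. ln (mgf (h * beta d N p n / beta d N p (Suc i)) i H))
    - N * h\<^sup>2 / 2 * ((beta d N p n)\<^sup>2 * ((\<Sum>i<n. step_var d N p (Suc i) (num_cand N k i H) / (beta d N p (Suc i))\<^sup>2) / N))\<bar>
    \<le> 55 * K\<^sup>2 * N * \<bar>h\<bar> ^ 3"
proof -
  define w where "w i = h * beta d N p n / beta d N p (Suc i)" for i
  let ?v = "\<lambda>i. step_var d N p (Suc i) (num_cand N k i H)"
  have w: "\<bar>w i\<bar> \<le> \<bar>h\<bar>" if "i < n" for i
  proof -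
    have "beta d N p n / beta d N p (Suc i) \<le> 1" using beta_antimono[of "Suc i" n] that beta_pos[of "Suc i"] by simp
    then have "\<bar>h\<bar> * (beta d N p n / beta d N p (Suc i)) \<le> \<bar>h\<bar> * 1" by (intro mult_left_mono) auto
    then show ?thesis using beta_pos[of n] beta_pos[of "Suc i"] by (simp add: w_def abs_mult)
  qed
  have each: "\<bar>ln (mgf (w i) i H) - (w i)\<^sup>2 * ?v i / 2\<bar> \<le> 55 * K\<^sup>2 * \<bar>h\<bar> ^ 3" if i: "i < n" for i
  proof -
    have sq: "(w i)\<^sup>2 \<le> h\<^sup>2" using w[OF i] by (metis abs_le_square_iff)
    have "7 * K * (w i)\<^sup>2 \<le> 7 * K * h\<^sup>2" using sq K_ge1 by (intro mult_left_mono) auto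
    then have "\<bar>ln (mgf (w i) i H) - (w i)\<^sup>2 * ?v i / 2\<bar> \<le> 55 * K\<^sup>2 * \<bar>w i\<bar> ^ 3"
      unfolding step_mgf_def num_cand_def using i n h w[OF i] by (intro ln_mgf_approx valid_explore') auto
    also have "\<dots> \<le> 55 * K\<^sup>2 * \<bar>h\<bar> ^ 3" using w[OF i] by (intro mult_left_mono power_mono) auto
    finally show ?thesis .
  qed
  have "(\<Sum>i<n. (w i)\<^sup>2 * ?v i / 2) = (\<Sum>i<n. h\<^sup>2 / 2 * ((beta d N p n)\<^sup>2 * (?v i / (beta d N p (Suc i))\<^sup>2)))"
    by (intro sum.cong) (simp_all add: w_def power_divide power_mult_distrib)
  also have "\<dots> = h\<^sup>2 / 2 * ((beta d N p n)\<^sup>2 * (\<Sum>i<n. ?v i / (beta d N p (Suc i))\<^sup>2))"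
    by (simp only: sum_distrib_left)
  also have "\<dots> = N * h\<^sup>2 / 2 * ((beta d N p n)\<^sup>2 * ((\<Sum>i<n. ?v i / (beta d N p (Suc i))\<^sup>2) / N))"
    using N_pos by simp
  finally have eq: "(\<Sum>i<n. (w i)\<^sup>2 * ?v i / 2) = N * h\<^sup>2 / 2 * ((beta d N p n)\<^sup>2 * ((\<Sum>i<n. ?v i / (beta d N p (Suc i))\<^sup>2) / N))" .
  have "\<bar>(\<Sum>i<n. ln (mgf (w i) i H)) - (\<Sum>i<n. (w i)\<^sup>2 * ?v i / 2)\<bar> = \<bar>\<Sum>i<n. ln (mgf (w i) i H) - (w i)\<^sup>2 * ?v i / 2\<bar>"
    by (simp only: sum_subtractf)
  also have "\<dots> \<le> (\<Sum>i<n. \<bar>ln (mgf (w i) i H) - (w i)\<^sup>2 * ?v i / 2\<bar>)" by (rule sum_abs)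
  also have "\<dots> \<le> (\<Sum>i<n. 55 * K\<^sup>2 * \<bar>h\<bar> ^ 3)" using each by (intro sum_mono) auto
  also have "\<dots> = n * (55 * K\<^sup>2 * \<bar>h\<bar> ^ 3)" by simp
  also have "\<dots> \<le> N * (55 * K\<^sup>2 * \<bar>h\<bar> ^ 3)" using n by (intro mult_right_mono) auto
  finally show ?thesis unfolding eq unfolding w_def by (simp add: mult_ac)
qed

end

section \<open>Asymptotics\<close>

lemma real_mult_exp_lim:
  fixes q :: real
  assumes "0 < q"
  shows "(\<lambda>N. 2 * real N * exp (- (q * real N))) \<longlonglongrightarrow> 0"
proof -
  have "filterlim (\<lambda>N. q * real N) at_top sequentially"
    by (rule filterlim_tendsto_pos_mult_at_top[OF tendsto_const assms filterlim_real_sequentially])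
  then have "(\<lambda>N. (q * real N) ^ 1 / exp (q * real N)) \<longlonglongrightarrow> 0"
    by (rule filterlim_compose[OF tendsto_power_div_exp_0])
  then have "(\<lambda>N. 2 / q * ((q * real N) ^ 1 / exp (q * real N))) \<longlonglongrightarrow> 0"
    by (rule tendsto_mult_right_zero)
  then show ?thesis using assms by (simp add: exp_minus field_simps)
qed

locale exploration_sequence =
  fixes d :: nat and lam :: real and p :: "nat \<Rightarrow> real" and k \<gamma> :: "nat \<Rightarrow> nat"
  assumes d2: "2 \<le> d" and lam1: "1 < lam"
    and p: "\<And>N. p N = lam * fact (d - 2) / real N ^ (d - 1)"
    and k_lim: "(\<lambda>N. real (k N) / real N) \<longlonglongrightarrow> 0"
    and \<gamma>_lim: "(\<lambda>N. real (\<gamma> N) / real N) \<longlonglongrightarrow> rho d lam"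
begin

lemmas rho_less_1 = rho_root(2)[OF d2 lam1]

lemma lim_div_N: "(\<lambda>N. c / real N) \<longlonglongrightarrow> 0"
  by (rule lim_const_over_n)

lemma eventually_exploration: "\<forall>\<^sub>F N in sequentially. exploration d N (k N) lam (p N)"
proof -
  have "\<forall>\<^sub>F N in sequentially. real (k N) / real N < 1" using order_tendstoD(2)[OF k_lim] by simp
  moreover have "\<forall>\<^sub>F N in sequentially. 2 * lam \<le> real N"
    using filterlim_real_sequentially by (simp add: filterlim_at_top)
  ultimately show ?thesis using eventually_ge_at_top[of d]
  proof eventually_elim
    case (elim N)
    then have "0 < real N" using d2 by simp
    then have "k N \<le> N" using elim by simp
    then show ?case using elim d2 lam1 p by unfold_locales auto
  qed
qed

text \<open>The margin \<open>d + 1\<close> is what \<open>N_a_lim\<close> needs at time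
  \<open>Suc (\<gamma> N)\<close>, the last index in the telescoped variance.\<close>

lemma eventually_\<gamma>: "\<forall>\<^sub>F N in sequentially. \<gamma> N + d + 1 < N"
proof -
  have "(\<lambda>N. real (\<gamma> N) / real N + real (d + 1) / real N) \<longlonglongrightarrow> rho d lam + 0"
    by (intro tendsto_add \<gamma>_lim lim_div_N)
  then have "\<forall>\<^sub>F N in sequentially. real (\<gamma> N) / real N + real (d + 1) / real N < 1"
    using order_tendstoD(2) rho_less_1 by (metis add.right_neutral)
  then show ?thesis using eventually_gt_at_top[of 0]
  proof eventually_elim
    case (elim N)
    then have "real (\<gamma> N + d + 1) / real N < 1" by (simp add: add_divide_distrib)
    then have "real (\<gamma> N + d + 1) < real N" using elim by simp
    then show ?case by (simp only: of_nat_less_iff)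
  qed
qed

lemma beta_lim: "(\<lambda>N. beta d N (p N) (\<gamma> N)) \<longlonglongrightarrow> 1 - rho d lam"
proof (rule real_tendsto_sandwich)
  show "\<forall>\<^sub>F N in sequentially. fluid d lam (real (\<gamma> N) / real N + real d / real N) * exp (- (2 * lam\<^sup>2 / N)) \<le> beta d N (p N) (\<gamma> N)"
    using eventually_exploration eventually_\<gamma>
    by eventually_elim (rule exploration.beta_ge_fluid, auto)
  show "\<forall>\<^sub>F N in sequentially. beta d N (p N) (\<gamma> N) \<le> fluid d lam (real (\<gamma> N) / real N) * exp (lam / real (d - 1) * (1 - (1 - real d / real N) ^ (d - 1)))"
    using eventually_exploration eventually_\<gamma>
    by eventually_elim (rule exploration.beta_le_fluid, auto)
  have cont: "isCont (fluid d lam) x" for x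
    using fluid_deriv[OF d2 lam1] DERIV_isCont by blast
  have "(\<lambda>N. fluid d lam (real (\<gamma> N) / real N + real d / real N) * exp (- (2 * lam\<^sup>2 / N))) \<longlonglongrightarrow> fluid d lam (rho d lam + 0) * exp (- 0)"
    by (intro tendsto_intros isCont_tendsto_compose[OF cont] \<gamma>_lim lim_div_N)
  then show "(\<lambda>N. fluid d lam (real (\<gamma> N) / real N + real d / real N) * exp (- (2 * lam\<^sup>2 / N))) \<longlonglongrightarrow> 1 - rho d lam"
    by (simp add: fluid_rho[OF d2 lam1])
  have "(\<lambda>N. fluid d lam (real (\<gamma> N) / real N) * exp (lam / real (d - 1) * (1 - (1 - real d / real N) ^ (d - 1))))
    \<longlonglongrightarrow> fluid d lam (rho d lam) * exp (lam / real (d - 1) * (1 - (1 - 0) ^ (d - 1)))"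
    by (intro tendsto_intros isCont_tendsto_compose[OF cont] \<gamma>_lim lim_div_N)
  then show "(\<lambda>N. fluid d lam (real (\<gamma> N) / real N) * exp (lam / real (d - 1) * (1 - (1 - real d / real N) ^ (d - 1)))) \<longlonglongrightarrow> 1 - rho d lam"
    by (simp add: fluid_rho[OF d2 lam1])
qed

lemma N_a_lim:
  assumes "(\<lambda>N. real (t N) / real N) \<longlonglongrightarrow> x" "\<forall>\<^sub>F N in sequentially. t N + d \<le> N"
  shows "(\<lambda>N. real N * a_coeff d N (p N) (t N)) \<longlonglongrightarrow> lam * (1 - x) ^ (d - 2)"
proof (rule real_tendsto_sandwich)
  show "\<forall>\<^sub>F N in sequentially. lam * (1 - real (t N) / real N - real d / real N) ^ (d - 2) \<le> real N * a_coeff d N (p N) (t N)"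
    using eventually_exploration assms(2)
    by eventually_elim (rule exploration.N_a_bounds(1))
  show "\<forall>\<^sub>F N in sequentially. real N * a_coeff d N (p N) (t N) \<le> lam * (1 - real (t N) / real N) ^ (d - 2)"
    using eventually_exploration assms(2)
    by eventually_elim (rule exploration.N_a_bounds(2))
  have "(\<lambda>N. lam * (1 - real (t N) / real N - real d / real N) ^ (d - 2)) \<longlonglongrightarrow> lam * (1 - x - 0) ^ (d - 2)"
    by (intro tendsto_intros assms lim_div_N)
  then show "(\<lambda>N. lam * (1 - real (t N) / real N - real d / real N) ^ (d - 2)) \<longlonglongrightarrow> lam * (1 - x) ^ (d - 2)" by simp
  show "(\<lambda>N. lam * (1 - real (t N) / real N) ^ (d - 2)) \<longlonglongrightarrow> lam * (1 - x) ^ (d - 2)"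
    by (intro tendsto_intros assms)
qed

lemma variance_lim:
  "(\<lambda>N. (beta d N (p N) (\<gamma> N))\<^sup>2 * ((1 / beta d N (p N) (\<gamma> N) - 1) + real N * (a_coeff d N (p N) 1 - a_coeff d N (p N) (Suc (\<gamma> N)))))
    \<longlonglongrightarrow> c_const d lam"
proof -
  have 1: "(\<lambda>N. real N * a_coeff d N (p N) 1) \<longlonglongrightarrow> lam * (1 - 0) ^ (d - 2)"
    using eventually_ge_at_top[of "d + 1"] by (intro N_a_lim) (auto simp: lim_div_N elim!: eventually_mono)
  have "(\<lambda>N. real (\<gamma> N) / real N + 1 / real N) \<longlonglongrightarrow> rho d lam + 0"
    by (intro tendsto_add \<gamma>_lim lim_div_N)
  then have "(\<lambda>N. real (Suc (\<gamma> N)) / real N) \<longlonglongrightarrow> rho d lam"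
    by (simp add: add_divide_distrib add.commute)
  then have 2: "(\<lambda>N. real N * a_coeff d N (p N) (Suc (\<gamma> N))) \<longlonglongrightarrow> lam * (1 - rho d lam) ^ (d - 2)"
    by (rule N_a_lim) (use eventually_\<gamma> in \<open>auto elim: eventually_mono\<close>)
  have "(\<lambda>N. (beta d N (p N) (\<gamma> N))\<^sup>2 * ((1 / beta d N (p N) (\<gamma> N) - 1) + (real N * a_coeff d N (p N) 1 - real N * a_coeff d N (p N) (Suc (\<gamma> N)))))
    \<longlonglongrightarrow> (1 - rho d lam)\<^sup>2 * ((1 / (1 - rho d lam) - 1) + (lam * (1 - 0) ^ (d - 2) - lam * (1 - rho d lam) ^ (d - 2)))"
    using rho_less_1 by (intro tendsto_intros beta_lim 1 2) auto
  then show ?thesis by (simp add: c_const_eq[OF d2 lam1] right_diff_distrib)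
qed

text \<open>The threshold \<open>\<delta>\<close> is fixed before \<open>N\<close>, from the minimum
  of \<open>gap\<close> on a compact range inside \<open>(0, rho)\<close>. On the good event a
  restart there would force \<open>gap\<close> below that minimum, so only few restarts
  remain.\<close>

lemma good_trajectory:
  assumes e: "0 < e"
  shows "\<exists>\<delta>::real. 0 < \<delta> \<and> (\<forall>\<^sub>F N in sequentially. \<forall>H. (\<forall>t\<le>\<gamma> N. \<bar>mart d N (p N) (k N) t H\<bar> \<le> \<delta> * N) \<longrightarrow>
    (\<forall>t<\<gamma> N. \<bar>num_cand N (k N) t H / N - beta d N (p N) (Suc t)\<bar> \<le> e))"
proof -
  \<comment> \<open>The restart term \<open>3 * exp (2 * lam) * e1\<close> of
    \<open>num_cand_near_beta\<close> becomes \<open>e / 4\<close>.\<close>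
  define e1 where "e1 = e / (12 * exp (2 * lam))"
  have e1: "0 < e1" "3 * exp (2 * lam) * e1 = e / 4" using e by (simp_all add: e1_def)
  obtain g where g: "0 < g" "\<And>x. e1 \<le> x \<Longrightarrow> x \<le> rho d lam - e1 \<Longrightarrow> g \<le> gap d lam x"
    using gap_bounded_below[OF d2 lam1 e1(1)] by blast
  \<comment> \<open>The first bound is for the final estimate; with the second,
    \<open>\<delta> + err N < g\<close> once \<open>err N < g / 2\<close>, which rules out restarts
    in the middle range.\<close>
  define \<delta> where "\<delta> = min (e / 4) (g / 2)"
  have \<delta>: "0 < \<delta>" "\<delta> \<le> e / 4" "\<delta> \<le> g / 2" using e g by (auto simp: \<delta>_def)
  define c1 where "c1 = lam\<^sup>2 * exp (2 * lam)"
  define c2 where "c2 = lam\<^sup>2 * exp (2 * lam) + lam + exp (2 * lam) + 1"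
  define err where "err N = c1 / real N + (exp (lam / real (d - 1) * (1 - (1 - real d / real N) ^ (d - 1))) - 1)" for N :: nat
  have "err \<longlonglongrightarrow> 0 + (exp (lam / real (d - 1) * (1 - (1 - 0) ^ (d - 1))) - 1)"
    unfolding err_def[abs_def] by (intro tendsto_intros lim_div_N)
  then have "err \<longlonglongrightarrow> 0" by simp
  then have ev1: "\<forall>\<^sub>F N in sequentially. err N < g / 2" using g(1) by (intro order_tendstoD(2)) auto
  have "(\<lambda>N. c2 / real N + real (k N) / real N) \<longlonglongrightarrow> 0 + 0"
    by (intro tendsto_add lim_div_N k_lim)
  then have ev2: "\<forall>\<^sub>F N in sequentially. c2 / real N + real (k N) / real N < e / 4"
    using e by (intro order_tendstoD(2)) auto
  have ev3: "\<forall>\<^sub>F N in sequentially. real (\<gamma> N) / real N < rho d lam + e1"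
    using e1(1) by (intro order_tendstoD(2)[OF \<gamma>_lim]) auto
  have "\<forall>\<^sub>F N in sequentially. \<forall>H. (\<forall>t\<le>\<gamma> N. \<bar>mart d N (p N) (k N) t H\<bar> \<le> \<delta> * N) \<longrightarrow>
    (\<forall>t<\<gamma> N. \<bar>num_cand N (k N) t H / N - beta d N (p N) (Suc t)\<bar> \<le> e)"
    using eventually_exploration eventually_\<gamma> ev1 ev2 ev3
  proof eventually_elim
    case (elim N)
    interpret exploration d N "k N" lam "p N" by (rule elim(1))
    show ?case
    proof (intro allI impI)
      fix H t assume mart: "\<forall>t\<le>\<gamma> N. \<bar>mart d N (p N) (k N) t H\<bar> \<le> \<delta> * N" and t: "t < \<gamma> N"
      have "(\<Sum>i<t. restart N (k N) i H) \<le> 3 * e1 * N + 1"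
      proof (rule sum_restart_le[where r = "rho d lam"])
        have "real (\<gamma> N) \<le> (rho d lam + e1) * N" using elim(5) N_pos by (simp add: field_simps)
        then show "real t \<le> (rho d lam + e1) * N" using t by simp
        fix i assume i: "i < t" "restart N (k N) i H \<noteq> 0"
        have "gap d lam (i / N) \<le> \<delta> + err N"
          using restart_gap[of i H \<delta>] i t mart elim(2) by (simp add: err_def c1_def)
        then have "gap d lam (i / N) < g" using elim(3) \<delta> by linarith
        then show "\<not> (e1 \<le> i / N \<and> i / N \<le> rho d lam - e1)" using g(2)[of "i / N"] by linarith
      qed (rule e1)
      then have "\<bar>num_cand N (k N) t H / N - beta d N (p N) (Suc t)\<bar> \<le> \<delta> + 3 * exp (2 * lam) * e1 + (c2 + k N) / N"
        unfolding c2_def using mart t elim(2) e1 by (intro num_cand_near_beta) auto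
      also have "\<dots> \<le> e" using \<delta> e1(2) elim(4) e unfolding add_divide_distrib by linarith
      finally show "\<bar>num_cand N (k N) t H / N - beta d N (p N) (Suc t)\<bar> \<le> e" .
    qed
  qed
  with \<delta>(1) show ?thesis by (intro exI[of _ \<delta>] conjI)
qed

lemma good_variance:
  assumes e: "0 < e"
  shows "\<exists>\<delta>::real. 0 < \<delta> \<and> (\<forall>\<^sub>F N in sequentially. \<forall>H. (\<forall>t\<le>\<gamma> N. \<bar>mart d N (p N) (k N) t H\<bar> \<le> \<delta> * N) \<longrightarrow>
    \<bar>(beta d N (p N) (\<gamma> N))\<^sup>2 * ((\<Sum>i<\<gamma> N. step_var d N (p N) (Suc i) (num_cand N (k N) i H) / (beta d N (p N) (Suc i))\<^sup>2) / N)
      - c_const d lam\<bar> \<le> e)"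
proof -
  define V where "V N = (1 / beta d N (p N) (\<gamma> N) - 1) + real N * (a_coeff d N (p N) 1 - a_coeff d N (p N) (Suc (\<gamma> N)))" for N
  have ve: "0 < var_err d lam" unfolding var_err_def using lam1
    by (intro mult_pos_pos add_pos_nonneg add_nonneg_pos) auto
  define e1 where "e1 = e / (3 * var_err d lam)"
  have e1: "0 < e1" "var_err d lam * e1 = e / 3" using e ve by (simp_all add: e1_def)
  obtain \<delta> :: real where \<delta>: "0 < \<delta>" and good: "\<forall>\<^sub>F N in sequentially. \<forall>H. (\<forall>t\<le>\<gamma> N. \<bar>mart d N (p N) (k N) t H\<bar> \<le> \<delta> * N) \<longrightarrow>
    (\<forall>t<\<gamma> N. \<bar>num_cand N (k N) t H / N - beta d N (p N) (Suc t)\<bar> \<le> e1)"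
    using good_trajectory[OF e1(1)] by (elim exE conjE) (rule that)
  have ev1: "\<forall>\<^sub>F N in sequentially. var_err d lam / real N < e / 3"
    using e by (intro order_tendstoD(2)[OF lim_div_N]) auto
  have ev2: "\<forall>\<^sub>F N in sequentially. \<bar>(beta d N (p N) (\<gamma> N))\<^sup>2 * V N - c_const d lam\<bar> < e / 3"
    using tendstoD[OF variance_lim, of "e / 3"] e by (simp add: V_def dist_real_def)
  have "\<forall>\<^sub>F N in sequentially. \<forall>H. (\<forall>t\<le>\<gamma> N. \<bar>mart d N (p N) (k N) t H\<bar> \<le> \<delta> * N) \<longrightarrow>
    \<bar>(beta d N (p N) (\<gamma> N))\<^sup>2 * ((\<Sum>i<\<gamma> N. step_var d N (p N) (Suc i) (num_cand N (k N) i H) / (beta d N (p N) (Suc i))\<^sup>2) / N)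
      - c_const d lam\<bar> \<le> e"
    using eventually_exploration eventually_\<gamma> good ev1 ev2
  proof eventually_elim
    case (elim N)
    interpret exploration d N "k N" lam "p N" by (rule elim(1))
    let ?b = "beta d N (p N) (\<gamma> N)"
    show ?case
    proof (intro allI impI)
      fix H assume "\<forall>t\<le>\<gamma> N. \<bar>mart d N (p N) (k N) t H\<bar> \<le> \<delta> * N"
      then have near: "\<And>i. i < \<gamma> N \<Longrightarrow> \<bar>num_cand N (k N) i H / N - beta d N (p N) (Suc i)\<bar> \<le> e1"
        using elim(3) by blast
      define W where "W = (\<Sum>i<\<gamma> N. step_var d N (p N) (Suc i) (num_cand N (k N) i H) / (beta d N (p N) (Suc i))\<^sup>2) / N"
      have "\<bar>W - V N\<bar> \<le> var_err d lam * (e1 + 1 / N)"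
        unfolding W_def V_def using near elim(2) e1 d2 by (intro sum_var_approx) auto
      also have "\<dots> \<le> e / 3 + e / 3" using elim(4) e1 by (simp add: distrib_left)
      finally have "\<bar>?b\<^sup>2 * (W - V N)\<bar> \<le> 1 * (e / 3 + e / 3)"
        unfolding abs_mult using beta_pos[of "\<gamma> N"] beta_le_1[of "\<gamma> N"] by (intro mult_mono) (auto simp: power_le_one)
      then have "\<bar>?b\<^sup>2 * W - ?b\<^sup>2 * V N\<bar> \<le> e / 3 + e / 3" by (simp only: right_diff_distrib mult_1_left)
      then have "\<bar>?b\<^sup>2 * W - c_const d lam\<bar> \<le> e" using elim(5) by linarith
      then show "\<bar>?b\<^sup>2 * ((\<Sum>i<\<gamma> N. step_var d N (p N) (Suc i) (num_cand N (k N) i H) / (beta d N (p N) (Suc i))\<^sup>2) / N)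
        - c_const d lam\<bar> \<le> e" by (simp only: W_def)
    qed
  qed
  with \<delta> show ?thesis by (intro exI[of _ \<delta>] conjI)
qed

lemma log_mgf_lim:
  fixes \<alpha> \<theta> :: real
  assumes \<alpha>: "1 / 2 < \<alpha>" "\<alpha> < 1"
  shows "(\<lambda>N. ln (hexp d N (p N) (\<lambda>H. exp (\<Sum>i<\<gamma> N. \<theta> * real N powr (\<alpha> - 1) * beta d N (p N) (\<gamma> N) / beta d N (p N) (Suc i)
      * incr d N (p N) (k N) i H))) / real N powr (2 * \<alpha> - 1)) \<longlonglongrightarrow> c_const d lam * \<theta>\<^sup>2 / 2"
proof (rule tendstoI)
  fix e :: real assume e: "0 < e"
  define L where "L N = hexp d N (p N) (\<lambda>H. exp (\<Sum>i<\<gamma> N. \<theta> * real N powr (\<alpha> - 1) * beta d N (p N) (\<gamma> N) / beta d N (p N) (Suc i)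
      * incr d N (p N) (k N) i H))" for N
  define h where "h N = \<theta> * real N powr (\<alpha> - 1)" for N :: nat
  define s where "s N = real N powr (2 * \<alpha> - 1)" for N :: nat
  define c where "c = c_const d lam"
  let ?K = "mgf_bound d lam"
  have c: "0 < c" unfolding c_def by (rule c_const_pos[OF d2 lam1])
  have K: "1 \<le> ?K" using lam1 by (simp add: mgf_bound_def)
  \<comment> \<open>Makes the variance error \<open>\<theta>\<^sup>2 / 2 * e1\<close> at most
    \<open>e / 4\<close>; the summand 1 covers \<open>\<theta> = 0\<close>.\<close>
  define e1 where "e1 = e / 2 / (\<theta>\<^sup>2 + 1)"
  have \<theta>1: "0 < \<theta>\<^sup>2 + 1" by (simp add: add_nonneg_pos)
  have e1: "0 < e1" using e \<theta>1 by (simp add: e1_def)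
  have "(\<theta>\<^sup>2 + 1) * e1 = e / 2"
    unfolding e1_def by (rule nonzero_mult_div_cancel_left[OF less_imp_neq[OF \<theta>1, symmetric], folded times_divide_eq_right])
  then have e1': "\<theta>\<^sup>2 / 2 * e1 \<le> e / 4" using e1 by (simp add: algebra_simps)
  define V where "V N H = (beta d N (p N) (\<gamma> N))\<^sup>2 * ((\<Sum>i<\<gamma> N. step_var d N (p N) (Suc i) (num_cand N (k N) i H) / (beta d N (p N) (Suc i))\<^sup>2) / N)" for N H
  obtain \<delta> :: real where \<delta>: "0 < \<delta>" and good: "\<forall>\<^sub>F N in sequentially. \<forall>H. (\<forall>t\<le>\<gamma> N. \<bar>mart d N (p N) (k N) t H\<bar> \<le> \<delta> * N) \<longrightarrow> \<bar>V N H - c\<bar> \<le> e1"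
    using good_variance[OF e1] by (elim exE conjE) (rule that, assumption, unfold V_def c_def)
  \<comment> \<open>The first bound keeps the combined weights at most 1; the second makes the
    quadratic cost at most half of the linear gain \<open>\<tau> * \<delta> * N\<close>.\<close>
  define \<tau> where "\<tau> = min (1 / (2 * exp (2 * lam))) (\<delta> / (56 * ?K * exp (4 * lam)))"
  have \<tau>: "0 < \<tau>" using \<delta> K by (simp add: \<tau>_def)
  have "\<tau> * (2 * exp (2 * lam)) \<le> 1 / (2 * exp (2 * lam)) * (2 * exp (2 * lam))"
    by (intro mult_right_mono) (simp_all add: \<tau>_def)
  then have \<tau>1: "2 * \<tau> * exp (2 * lam) \<le> 1" by (simp add: mult_ac)
  have "\<tau> * (56 * ?K * exp (4 * lam)) \<le> \<delta> / (56 * ?K * exp (4 * lam)) * (56 * ?K * exp (4 * lam))"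
    using K by (intro mult_right_mono) (simp_all add: \<tau>_def)
  then have "\<tau> * (56 * ?K * exp (4 * lam)) \<le> \<delta>" using K by simp
  then have "\<tau> * (\<tau> * (56 * ?K * exp (4 * lam))) \<le> \<tau> * \<delta>" using \<tau> by (intro mult_left_mono) auto
  then have \<tau>2: "28 * ?K * \<tau>\<^sup>2 * exp (4 * lam) \<le> \<tau> * \<delta> / 2" by (simp add: power2_eq_square mult_ac)
  have powr0: "(\<lambda>N. real N powr (\<alpha> - 1)) \<longlonglongrightarrow> 0"
    using \<alpha> by (intro tendsto_neg_powr filterlim_real_sequentially) auto
  have h0: "h \<longlonglongrightarrow> 0" unfolding h_def[abs_def] using tendsto_mult_right_zero[OF powr0] by simp
  have s_top: "filterlim s at_top sequentially"
    unfolding s_def[abs_def] using \<alpha> by (intro filterlim_compose[OF real_powr_at_top filterlim_real_sequentially]) auto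
  have ev1: "\<forall>\<^sub>F N in sequentially. \<bar>h N\<bar> < min 1 (\<tau> * exp (2 * lam))"
    using \<tau> tendsto_rabs_zero[OF h0] by (intro order_tendstoD(2)) auto
  have "(\<lambda>N. 7 * ?K * (h N)\<^sup>2) \<longlonglongrightarrow> 7 * ?K * 0\<^sup>2" by (intro tendsto_intros h0)
  then have ev2: "\<forall>\<^sub>F N in sequentially. 7 * ?K * (h N)\<^sup>2 < 1" by (intro order_tendstoD(2)) auto
  have "(\<lambda>N. 55 * ?K\<^sup>2 * \<theta>\<^sup>2 * \<bar>h N\<bar>) \<longlonglongrightarrow> 55 * ?K\<^sup>2 * \<theta>\<^sup>2 * \<bar>0\<bar>" by (intro tendsto_intros h0)
  then have ev3: "\<forall>\<^sub>F N in sequentially. 55 * ?K\<^sup>2 * \<theta>\<^sup>2 * \<bar>h N\<bar> < e / 4" using e by (intro order_tendstoD(2)) auto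
  have "0 < \<tau> * \<delta> / 2" using \<tau> \<delta> by simp
  then have "(\<lambda>N. 2 * real N * exp (- (\<tau> * \<delta> / 2 * real N))) \<longlonglongrightarrow> 0" 
    by (rule real_mult_exp_lim)
  \<comment> \<open>A weighted bad mass of at most \<open>1 / 2\<close> is enough: it changes the
    logarithm by at most \<open>ln 2\<close>, which vanishes after division by the speed.\<close>
  then have ev4: "\<forall>\<^sub>F N in sequentially. 2 * real N * exp (- (\<tau> * \<delta> / 2 * real N)) < 1 / 2" by (intro order_tendstoD(2)) auto
  have "(\<lambda>N. ln 2 / s N) \<longlonglongrightarrow> 0" by (intro tendsto_divide_0[OF tendsto_const] filterlim_at_top_imp_at_infinity s_top)
  then have ev5: "\<forall>\<^sub>F N in sequentially. ln 2 / s N < e / 2" using e by (intro order_tendstoD(2)) auto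
  have "\<forall>\<^sub>F N in sequentially. dist (ln (L N) / s N) (c * \<theta>\<^sup>2 / 2) < e"
    using eventually_exploration eventually_\<gamma> good ev1 ev2 ev3 ev4 ev5
  proof eventually_elim
    case (elim N)
    interpret exploration d N "k N" lam "p N" by (rule elim(1))
    let ?w = "\<lambda>i. h N * beta d N (p N) (\<gamma> N) / beta d N (p N) (Suc i)"
    let ?G = "\<lambda>H. \<forall>t\<le>\<gamma> N. \<bar>mart d N (p N) (k N) t H\<bar> \<le> \<delta> * N"
    have n: "\<gamma> N < N" using elim(2) by simp
    have s: "0 < s N" using N_pos by (simp add: s_def)
    \<comment> \<open>The scaling identity \<open>1 + 2 * (\<alpha> - 1) = 2 * \<alpha> - 1\<close>
      that fixes the speed.\<close>
    have Nh: "N * (h N)\<^sup>2 = \<theta>\<^sup>2 * s N"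
    proof -
      have "real N * (real N powr (\<alpha> - 1))\<^sup>2 = real N powr 1 * (real N powr (\<alpha> - 1) * real N powr (\<alpha> - 1))"
        using N_pos by (simp add: power2_eq_square)
      also have "\<dots> = s N" unfolding s_def powr_add[symmetric] by simp
      finally show ?thesis by (simp add: h_def power_mult_distrib)
    qed
    have good': "s N * (c * \<theta>\<^sup>2 / 2 - e / 2) \<le> (\<Sum>i<\<gamma> N. ln (mgf (?w i) i H)) \<and> (\<Sum>i<\<gamma> N. ln (mgf (?w i) i H)) \<le> s N * (c * \<theta>\<^sup>2 / 2 + e / 2)"
      if "?G H" for H
    proof -
      have "\<bar>(\<Sum>i<\<gamma> N. ln (mgf (?w i) i H)) - N * (h N)\<^sup>2 / 2 * V N H\<bar> \<le> 55 * K\<^sup>2 * N * \<bar>h N\<bar> ^ 3"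
        unfolding V_def using n elim(4,5) by (intro sum_ln_mgf_approx) auto
      also have "55 * K\<^sup>2 * N * \<bar>h N\<bar> ^ 3 = 55 * K\<^sup>2 * \<bar>h N\<bar> * (N * (h N)\<^sup>2)"
        by (simp add: power3_eq_cube power2_eq_square)
      also have "\<dots> = s N * (55 * K\<^sup>2 * \<theta>\<^sup>2 * \<bar>h N\<bar>)" unfolding Nh by simp
      also have "\<dots> \<le> s N * (e / 4)" using elim(6) s by (intro mult_left_mono) auto
      finally have 1: "\<bar>(\<Sum>i<\<gamma> N. ln (mgf (?w i) i H)) - N * (h N)\<^sup>2 / 2 * V N H\<bar> \<le> s N * (e / 4)" .
      have eq: "N * (h N)\<^sup>2 / 2 * V N H - s N * (c * \<theta>\<^sup>2 / 2) = s N * (\<theta>\<^sup>2 / 2 * (V N H - c))"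
        unfolding Nh by (simp add: algebra_simps)
      have "\<bar>V N H - c\<bar> \<le> e1" using elim(3) that by blast
      then have "\<theta>\<^sup>2 / 2 * \<bar>V N H - c\<bar> \<le> \<theta>\<^sup>2 / 2 * e1" by (intro mult_left_mono) auto
      then have "\<theta>\<^sup>2 / 2 * \<bar>V N H - c\<bar> \<le> e / 4" using e1' by (rule order_trans)
      then have "s N * (\<theta>\<^sup>2 / 2 * \<bar>V N H - c\<bar>) \<le> s N * (e / 4)" by (rule mult_left_mono) (use s in simp)
      then have "\<bar>N * (h N)\<^sup>2 / 2 * V N H - s N * (c * \<theta>\<^sup>2 / 2)\<bar> \<le> s N * (e / 4)"
        unfolding eq using s by (simp add: abs_mult)
      then show ?thesis using 1 unfolding right_diff_distrib distrib_left abs_le_iff by linarith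
    qed
    have bad: "hexp d N (p N) (\<lambda>H. exp (\<Sum>i<\<gamma> N. ?w i * incr d N (p N) (k N) i H) * of_bool (\<not> ?G H)) \<le> 1 / 2"
    proof -
      have w: "\<bar>?w i\<bar> \<le> \<tau> * exp (2 * lam)" if "i < \<gamma> N" for i
      proof -
        have "beta d N (p N) (\<gamma> N) / beta d N (p N) (Suc i) \<le> 1"
          using beta_antimono[of "Suc i" "\<gamma> N"] that beta_pos[of "Suc i"] by simp
        then have "\<bar>h N\<bar> * (beta d N (p N) (\<gamma> N) / beta d N (p N) (Suc i)) \<le> \<bar>h N\<bar> * 1" by (intro mult_left_mono) auto
        also have "\<dots> \<le> \<tau> * exp (2 * lam)" using elim(4) by simp
        finally show ?thesis using beta_pos[of "\<gamma> N"] beta_pos[of "Suc i"] by (simp add: abs_mult)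
      qed
      have "(\<not> ?G H) = (\<exists>t\<le>\<gamma> N. \<delta> * N < \<bar>mart d N (p N) (k N) t H\<bar>)" for H by (auto simp: not_le)
      then have "hexp d N (p N) (\<lambda>H. exp (\<Sum>i<\<gamma> N. ?w i * incr d N (p N) (k N) i H) * of_bool (\<not> ?G H))
        = hexp d N (p N) (\<lambda>H. exp (\<Sum>i<\<gamma> N. ?w i * incr d N (p N) (k N) i H) * of_bool (\<exists>t\<le>\<gamma> N. \<delta> * N < \<bar>mart d N (p N) (k N) t H\<bar>))"
        by (simp only:)
      also have "\<dots> \<le> 2 * N * exp (28 * K * N * \<tau>\<^sup>2 * exp (4 * lam) - \<tau> * (\<delta> * N))"
        using \<tau> by (intro hexp_exp_bad[OF n _ \<tau>1 w]) auto
      also have "\<dots> \<le> 2 * N * exp (- (\<tau> * \<delta> / 2 * real N))"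
      proof -
        have "28 * K * \<tau>\<^sup>2 * exp (4 * lam) * N \<le> \<tau> * \<delta> / 2 * N" using \<tau>2 by (intro mult_right_mono) auto
        then have "28 * K * N * \<tau>\<^sup>2 * exp (4 * lam) - \<tau> * (\<delta> * N) \<le> - (\<tau> * \<delta> / 2 * real N)" by (simp add: mult_ac)
        then show ?thesis by (intro mult_left_mono) auto
      qed
      also have "\<dots> \<le> 1 / 2" using elim(7) by simp
      finally show ?thesis .
    qed
    have L: "L N = hexp d N (p N) (\<lambda>H. exp (\<Sum>i<\<gamma> N. ?w i * incr d N (p N) (k N) i H))"
      by (simp add: L_def h_def)
    have low: "exp (s N * (c * \<theta>\<^sup>2 / 2 - e / 2)) * (1 - 1 / 2) \<le> L N"
      and up: "L N \<le> exp (s N * (c * \<theta>\<^sup>2 / 2 + e / 2)) + 1 / 2"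
      unfolding L by (rule hexp_exp_sandwich[OF n good' bad]; assumption)+
    have Lpos: "0 < L N" by (rule less_le_trans[OF _ low]) simp
    have "1 \<le> exp (s N * (c * \<theta>\<^sup>2 / 2 + e / 2))" using s c e by simp
    then have "L N \<le> exp (s N * (c * \<theta>\<^sup>2 / 2 + e / 2)) * 2" using up by linarith
    then have "ln (L N) \<le> ln (exp (s N * (c * \<theta>\<^sup>2 / 2 + e / 2)) * 2)" using Lpos by (subst ln_le_cancel_iff) auto
    also have "\<dots> = s N * (c * \<theta>\<^sup>2 / 2 + e / 2) + ln 2" by (simp add: ln_mult)
    finally have "ln (L N) / s N \<le> (s N * (c * \<theta>\<^sup>2 / 2 + e / 2) + ln 2) / s N" using s by (intro divide_right_mono) auto
    then have u: "ln (L N) / s N \<le> c * \<theta>\<^sup>2 / 2 + e / 2 + ln 2 / s N" using s by (simp add: add_divide_distrib)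
    have "exp (s N * (c * \<theta>\<^sup>2 / 2 - e / 2)) / 2 \<le> L N" using low by simp
    then have "ln (exp (s N * (c * \<theta>\<^sup>2 / 2 - e / 2)) / 2) \<le> ln (L N)" using Lpos by (subst ln_le_cancel_iff) auto
    moreover have "ln (exp (s N * (c * \<theta>\<^sup>2 / 2 - e / 2)) / 2) = s N * (c * \<theta>\<^sup>2 / 2 - e / 2) - ln 2" by (simp add: ln_div)
    ultimately have "s N * (c * \<theta>\<^sup>2 / 2 - e / 2) - ln 2 \<le> ln (L N)" by simp
    then have "(s N * (c * \<theta>\<^sup>2 / 2 - e / 2) - ln 2) / s N \<le> ln (L N) / s N" using s by (intro divide_right_mono) auto
    then have "c * \<theta>\<^sup>2 / 2 - e / 2 - ln 2 / s N \<le> ln (L N) / s N" using s by (simp add: diff_divide_distrib)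
    then show ?case using u elim(8) unfolding dist_real_def abs_less_iff by linarith
  qed
  then show "\<forall>\<^sub>F N in sequentially. dist (ln (hexp d N (p N) (\<lambda>H. exp (\<Sum>i<\<gamma> N. \<theta> * real N powr (\<alpha> - 1) * beta d N (p N) (\<gamma> N) / beta d N (p N) (Suc i)
      * incr d N (p N) (k N) i H))) / real N powr (2 * \<alpha> - 1)) (c_const d lam * \<theta>\<^sup>2 / 2) < e"
    by (simp only: L_def s_def c_def)
qed

end

text \<open>Since \<open>nat\<close> sends negative values to 0, the sandwich is built from
  \<open>max 0 (f N)\<close>; the limit survives because \<open>x\<close> is nonnegative.\<close>

lemma nat_floor_div_lim:
  assumes "(\<lambda>N. f N / real N) \<longlonglongrightarrow> x" "0 \<le> x"
  shows "(\<lambda>N. real (nat \<lfloor>f N\<rfloor>) / real N) \<longlonglongrightarrow> x"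
proof (rule real_tendsto_sandwich)
  have bounds: "max 0 y - 1 \<le> real (nat \<lfloor>y\<rfloor>)" "real (nat \<lfloor>y\<rfloor>) \<le> max 0 y" for y :: real
    by linarith+
  show "\<forall>\<^sub>F N in sequentially. max 0 (f N) / real N - 1 / real N \<le> real (nat \<lfloor>f N\<rfloor>) / real N"
    by (intro always_eventually allI) (simp only: diff_divide_distrib[symmetric] divide_right_mono[OF bounds(1)] of_nat_0_le_iff)
  show "\<forall>\<^sub>F N in sequentially. real (nat \<lfloor>f N\<rfloor>) / real N \<le> max 0 (f N) / real N"
    by (intro always_eventually allI) (simp only: divide_right_mono[OF bounds(2)] of_nat_0_le_iff)
  have max_div: "max 0 (f N) / real N = max 0 (f N / real N)" for N
    by (cases "N = 0") (auto simp: max_def field_simps)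
  have lim: "(\<lambda>N. max 0 (f N) / real N) \<longlonglongrightarrow> max 0 x"
    unfolding max_div by (intro tendsto_intros assms)
  then show "(\<lambda>N. max 0 (f N) / real N) \<longlonglongrightarrow> x" using assms(2) by (simp add: max_def)
  have "(\<lambda>N. max 0 (f N) / real N - 1 / real N) \<longlonglongrightarrow> max 0 x - 0"
    by (intro tendsto_diff lim lim_const_over_n)
  then show "(\<lambda>N. max 0 (f N) / real N - 1 / real N) \<longlonglongrightarrow> x" using assms(2) by (simp add: max_def)
qed

theorem theorem3p1:
  fixes d :: nat and lam \<alpha> \<kappa> \<zeta> :: real
    and p :: "nat \<Rightarrow> real" and k \<gamma> :: "nat \<Rightarrow> nat"
  assumes "d \<ge> 2" and "lam > 1" and "1 / 2 < \<alpha>" and "\<alpha> < 1"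
    and "2 * \<alpha> - 1 < \<kappa>" and "\<kappa> < \<alpha>"
    and p: "\<And>N. p N = lam * fact (d - 2) / real N ^ (d - 1)"
    and k: "\<And>N. k N = nat \<lfloor>real N powr \<kappa>\<rfloor>"
    and \<gamma>: "\<And>N. \<gamma> N = nat \<lfloor>rho d lam * real N + \<zeta> * real N powr \<alpha>\<rfloor>"
  shows "moderate_deviation_principle
    (\<lambda>N. measure_pmf (random_hypergraph d N (p N)))
    (\<lambda>N H. beta d N (p N) (\<gamma> N) * S_mart d N (p N) (k N) (\<gamma> N) H / real N powr \<alpha>)
    (\<lambda>N. real N powr (2 * \<alpha> - 1))
    (\<lambda>x. ereal (x\<^sup>2 / (2 * c_const d lam)))"
proof -
  have powr_div: "(\<lambda>N. real N powr a / real N) \<longlonglongrightarrow> 0" if "a < 1" for a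
  proof (rule Lim_transform_eventually)
    show "(\<lambda>N. real N powr (a - 1)) \<longlonglongrightarrow> 0"
      using that by (intro tendsto_neg_powr filterlim_real_sequentially) auto
    show "\<forall>\<^sub>F N in sequentially. real N powr (a - 1) = real N powr a / real N"
      using eventually_gt_at_top[of 0] by eventually_elim (simp add: powr_diff)
  qed
  have k_lim: "(\<lambda>N. real (k N) / real N) \<longlonglongrightarrow> 0"
    unfolding k using assms by (intro nat_floor_div_lim powr_div) auto
  have \<gamma>_lim: "(\<lambda>N. real (\<gamma> N) / real N) \<longlonglongrightarrow> rho d lam"
    unfolding \<gamma>
  proof (rule nat_floor_div_lim)
    have "(\<lambda>N. rho d lam + \<zeta> * (real N powr \<alpha> / real N)) \<longlonglongrightarrow> rho d lam + \<zeta> * 0"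
      using assms by (intro tendsto_intros powr_div)
    then have lim: "(\<lambda>N. rho d lam + \<zeta> * (real N powr \<alpha> / real N)) \<longlonglongrightarrow> rho d lam" by simp
    show "(\<lambda>N. (rho d lam * real N + \<zeta> * real N powr \<alpha>) / real N) \<longlonglongrightarrow> rho d lam"
      using lim by (rule Lim_transform_eventually)
        (use eventually_gt_at_top[of 0] in \<open>eventually_elim, simp add: add_divide_distrib\<close>)
    show "0 \<le> rho d lam" using rho_root(1)[of d lam] assms by simp
  qed
  interpret exploration_sequence d lam p k \<gamma>
    using assms k_lim \<gamma>_lim by unfold_locales auto
  show ?thesis
  proof (rule mdp_of_gaussian_log_mgf)
    show "prob_space (measure_pmf (random_hypergraph d N (p N)))" for N
      by (rule measure_pmf.prob_space_axioms)
    show "(\<lambda>H. beta d N (p N) (\<gamma> N) * S_mart d N (p N) (k N) (\<gamma> N) H / real N powr \<alpha>)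
      \<in> borel_measurable (measure_pmf (random_hypergraph d N (p N)))" for N
      by simp
    show "integrable (measure_pmf (random_hypergraph d N (p N))) (\<lambda>H. exp (\<theta> * real N powr (2 * \<alpha> - 1)
        * (beta d N (p N) (\<gamma> N) * S_mart d N (p N) (k N) (\<gamma> N) H / real N powr \<alpha>)))" for N \<theta>
      by (rule integrable_random_hypergraph)
    show "0 < c_const d lam" by (rule c_const_pos[OF d2 lam1])
    show "filterlim (\<lambda>N. real N powr (2 * \<alpha> - 1)) at_top sequentially"
      using assms by (intro filterlim_compose[OF real_powr_at_top filterlim_real_sequentially]) auto
    fix \<theta> :: real
    show "(\<lambda>N. ln (hexp d N (p N) (\<lambda>H. exp (\<theta> * real N powr (2 * \<alpha> - 1)
        * (beta d N (p N) (\<gamma> N) * S_mart d N (p N) (k N) (\<gamma> N) H / real N powr \<alpha>)))) / real N powr (2 * \<alpha> - 1))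
      \<longlonglongrightarrow> c_const d lam * \<theta>\<^sup>2 / 2"
    \<comment> \<open>For large \<open>N\<close> the two transforms coincide: \<open>S_mart\<close>
      equals its explicit form almost everywhere, and speed over normalisation is
      \<open>N powr (\<alpha> - 1)\<close>.\<close>
    proof (rule Lim_transform_eventually[OF log_mgf_lim])
      show "\<forall>\<^sub>F N in sequentially. ln (hexp d N (p N) (\<lambda>H. exp (\<Sum>i<\<gamma> N. \<theta> * real N powr (\<alpha> - 1) * beta d N (p N) (\<gamma> N) / beta d N (p N) (Suc i)
          * incr d N (p N) (k N) i H))) / real N powr (2 * \<alpha> - 1) =
        ln (hexp d N (p N) (\<lambda>H. exp (\<theta> * real N powr (2 * \<alpha> - 1)
          * (beta d N (p N) (\<gamma> N) * S_mart d N (p N) (k N) (\<gamma> N) H / real N powr \<alpha>)))) / real N powr (2 * \<alpha> - 1)"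
        using eventually_exploration eventually_\<gamma>
      proof eventually_elim
        case (elim N)
        interpret exploration d N "k N" lam "p N" by (rule elim(1))
        have powr_eq: "real N powr (2 * \<alpha> - 1) / real N powr \<alpha> = real N powr (\<alpha> - 1)"
          unfolding powr_diff[symmetric] by simp
        have "AE H in measure_pmf (random_hypergraph d N (p N)).
          S_mart d N (p N) (k N) (\<gamma> N) H = (\<Sum>i<\<gamma> N. incr d N (p N) (k N) i H / beta d N (p N) (Suc i))"
          using elim(2) by (intro S_mart_eq_incr d2 p_nonneg p_le_1 kN) auto
        then have "hexp d N (p N) (\<lambda>H. exp (\<Sum>i<\<gamma> N. \<theta> * real N powr (\<alpha> - 1) * beta d N (p N) (\<gamma> N) / beta d N (p N) (Suc i)
            * incr d N (p N) (k N) i H)) =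
          hexp d N (p N) (\<lambda>H. exp (\<theta> * real N powr (2 * \<alpha> - 1)
            * (beta d N (p N) (\<gamma> N) * S_mart d N (p N) (k N) (\<gamma> N) H / real N powr \<alpha>)))"
        proof (intro integral_cong_AE, simp, simp, elim eventually_mono)
          fix H assume S: "S_mart d N (p N) (k N) (\<gamma> N) H = (\<Sum>i<\<gamma> N. incr d N (p N) (k N) i H / beta d N (p N) (Suc i))"
          have "\<theta> * real N powr (2 * \<alpha> - 1) * (beta d N (p N) (\<gamma> N) * S_mart d N (p N) (k N) (\<gamma> N) H / real N powr \<alpha>)
            = \<theta> * real N powr (\<alpha> - 1) * beta d N (p N) (\<gamma> N) * S_mart d N (p N) (k N) (\<gamma> N) H"
            unfolding powr_eq[symmetric] by simp
          also have "\<dots> = (\<Sum>i<\<gamma> N. \<theta> * real N powr (\<alpha> - 1) * beta d N (p N) (\<gamma> N) / beta d N (p N) (Suc i) * incr d N (p N) (k N) i H)"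
            unfolding S sum_distrib_left by (intro sum.cong) auto
          finally show "exp (\<Sum>i<\<gamma> N. \<theta> * real N powr (\<alpha> - 1) * beta d N (p N) (\<gamma> N) / beta d N (p N) (Suc i) * incr d N (p N) (k N) i H)
            = exp (\<theta> * real N powr (2 * \<alpha> - 1) * (beta d N (p N) (\<gamma> N) * S_mart d N (p N) (k N) (\<gamma> N) H / real N powr \<alpha>))"
            by simp
        qed
        then show ?case by (simp only:)
      qed
    qed (rule assms)+
  qed
qed

end
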